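(* Let $(M,D,g)$ and $(M',D',g')$ be corank-one sub-Riemannian manifolds of the same dimension, with type maps $\alpha_M: M\to\mathbb{RP}^{n-1}$ and $\alpha_{M'}:M'\to\mathbb{RP}^{n-1}$. Given any $x\in M$ and $y\in M'$, the following properties are equivalent: (i) $\alpha_M(x)=\alpha_{M'}(y)$; (ii) there is a (graded) Lie algebra isomorphism $\gamma_{xy}:\mathrm{gr}(T_xM,D_x)\to \mathrm{gr}(T_yM',D'_y)$ such that its component of degree $-1$, $\gamma_{xy}^{-1}:(D_x,g_x)\to(D'_y,g'_y)$, is a linear isometry; (iii) there is a linear isometry $\gamma_{xy}^{-1}:(D_x,g_x)\to(D'_y,g'_y)$ which additionally preserves the Levi form, in the sense that there is a linear map $\gamma_{xy}^{-2}:T_xM/D_x\to T_yM'/D'_y$ such that for all $X,Y\in D_x$ $$\mathcal{L}_{D'}(\gamma_{xy}^{-1}(X),\gamma_{xy}^{-1}(Y))=\gamma_{xy}^{-2}(\mathcal{L}_D(X,Y)).$$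
   Context: All manifolds and maps are smooth. For a corank-one distribution $D\subseteq TM$ (a subbundle with $\mathrm{rank}\,D=\dim M-1$), the Levi map is the bundle map $\mathcal{L}_D:D\times D\to TM/D$, $(X,Y)\mapsto[X,Y]\bmod D$. $D$ is a corank-one structure if $\mathcal{L}_D$ is non-zero at every point (so $D$ is bracket-generating of step 2). A corank-one sub-Riemannian manifold $(M,D,g)$ is a manifold $M$ with a corank-one structure $D$ and a Riemannian metric $g$ on the vector bundle $D$. The osculating Lie algebra at $x$ is the graded nilpotent Lie algebra $\mathrm{gr}(T_xM,D_x)=T_xM/D_x\oplus D_x$, with $D_x$ in degree $-1$ and $T_xM/D_x$ in degree $-2$; the bracket of two elements of $D_x$ is given by $\mathcal{L}_D$ at $x$, and $T_xM/D_x$ is central. For a graded isomorphism $\gamma$, the superscripts in $\gamma^{-1},\gamma^{-2}$ denote the components in degree $-1$ and $-2$ (not inverses). Type map: write $\dim M=2n+1$ or $2n+2$ with $n\ge1$. Near $x$ write $D=\ker\theta$ for a one-form $\theta$ and define $J:D\to D$ by $d\theta(X,Y)=g(JX,Y)$ for $X,Y\in D$. $J_x$ is skew-symmetric with respect to $g_x$, so its eigenvalues (with multiplicity) are $\pm i\alpha_j^x$, $j=1,\dots,n$, with $0\le\alpha_1^x\le\dots\le\alpha_n^x$ not all zero (plus one extra eigenvalue $0$ if $\dim M=2n+2$). The type is $\alpha_M:M\to\mathbb{RP}^{n-1}$, $x\mapsto[\alpha_1^x:\dots:\alpha_n^x]$; it does not depend on the choice of $\theta$. *)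

theory Defs
  imports
    "HOL-Analysis.Analysis"
    "HOL-Library.Function_Algebras"
    "Jordan_Normal_Form.Char_Poly"
begin

instantiation "fun" :: (type, real_vector) real_vector
begin

definition scaleR_fun :: "real \<Rightarrow> ('a \<Rightarrow> 'b) \<Rightarrow> 'a \<Rightarrow> 'b"
  where "scaleR_fun c f = (\<lambda>x. c *\<^sub>R f x)"

instance
  by standard (auto simp: scaleR_fun_def scaleR_add_right scaleR_add_left)

end

primrec Ck_on :: "nat \<Rightarrow> 'a::real_normed_vector set \<Rightarrow> ('a \<Rightarrow> 'b::real_normed_vector) \<Rightarrow> bool"
  where
    "Ck_on 0 S f \<longleftrightarrow> continuous_on S f"
  | "Ck_on (Suc k) S f \<longleftrightarrow>
       (\<forall>x\<in>S. f differentiable (at x)) \<and> (\<forall>v. Ck_on k S (\<lambda>x. frechet_derivative f (at x) v))"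

text \<open>Intended for open \<open>S\<close> and finite-dimensional domains.\<close>

definition smooth_on :: "'a::real_normed_vector set \<Rightarrow> ('a \<Rightarrow> 'b::real_normed_vector) \<Rightarrow> bool"
  where "smooth_on S f \<longleftrightarrow> (\<forall>k. Ck_on k S f)"

type_synonym ('m, 'e) chart = "'m set \<times> ('m \<Rightarrow> 'e)"

text \<open>
  The manifold is the whole type \<open>'m\<close>, which is Hausdorff and second countable; its dimension is
  \<open>DIM('e)\<close>. Values of a chart \<open>\<phi>\<close> outside its domain \<open>U\<close> are irrelevant.
\<close>

definition smooth_atlas ::
  "('m::{t2_space,second_countable_topology}, 'e::euclidean_space) chart set \<Rightarrow> bool"
  where "smooth_atlas A \<longleftrightarrow>
    (\<forall>(U, \<phi>)\<in>A. open U \<and> open (\<phi> ` U) \<and> homeomorphism U (\<phi> ` U) \<phi> (inv_into U \<phi>)) \<and>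
    (\<Union>(U, \<phi>)\<in>A. U) = UNIV \<and>
    (\<forall>(U, \<phi>)\<in>A. \<forall>(V, \<psi>)\<in>A. smooth_on (\<phi> ` (U \<inter> V)) (\<psi> \<circ> inv_into U \<phi>))"

definition smooth_fun_on ::
  "('m::topological_space, 'e::euclidean_space) chart set \<Rightarrow> 'm set \<Rightarrow> ('m \<Rightarrow> real) \<Rightarrow> bool"
  where "smooth_fun_on A W f \<longleftrightarrow> (\<forall>(U, \<phi>)\<in>A. smooth_on (\<phi> ` (U \<inter> W)) (f \<circ> inv_into U \<phi>))"

definition smooth_near ::
  "('m::topological_space, 'e::euclidean_space) chart set \<Rightarrow> 'm \<Rightarrow> ('m \<Rightarrow> real) \<Rightarrow> bool"
  where "smooth_near A p f \<longleftrightarrow> (\<exists>W. open W \<and> p \<in> W \<and> smooth_fun_on A W f)"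

text \<open>
  Tangent vectors at \<open>p\<close> are the derivations of the functions that are smooth near \<open>p\<close>.
  They are extended by \<open>0\<close> to all other functions, so that distinct derivations correspond to
  distinct elements of the type. Locality (dependence on the germ only) follows from the Leibniz
  rule, since functions here are not required to be smooth away from \<open>p\<close>.
\<close>

type_synonym 'm tvec = "('m \<Rightarrow> real) \<Rightarrow> real"

definition tangent_space ::
  "('m::topological_space, 'e::euclidean_space) chart set \<Rightarrow> 'm \<Rightarrow> 'm tvec set"
  where "tangent_space A p = {v.
    (\<forall>f g. smooth_near A p f \<longrightarrow> smooth_near A p g \<longrightarrow>
      v (f + g) = v f + v g \<and> v (f * g) = f p * v g + g p * v f) \<and>
    (\<forall>c f. smooth_near A p f \<longrightarrow> v (c *\<^sub>R f) = c * v f) \<and>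
    (\<forall>f. \<not> smooth_near A p f \<longrightarrow> v f = 0)}"

text \<open>
  Vector fields, forms and functions on an open set \<open>U\<close> are total functions on \<open>'m\<close> whose values
  outside \<open>U\<close> are irrelevant.
\<close>

definition vector_field_on ::
  "('m::topological_space, 'e::euclidean_space) chart set \<Rightarrow> 'm set \<Rightarrow> ('m \<Rightarrow> 'm tvec) \<Rightarrow> bool"
  where "vector_field_on A U X \<longleftrightarrow>
    (\<forall>p\<in>U. X p \<in> tangent_space A p) \<and>
    (\<forall>W f. open W \<longrightarrow> W \<subseteq> U \<longrightarrow> smooth_fun_on A W f \<longrightarrow> smooth_fun_on A W (\<lambda>p. X p f))"

definition lie_bracket ::
  "('m::topological_space, 'e::euclidean_space) chart set \<Rightarrow>
    ('m \<Rightarrow> 'm tvec) \<Rightarrow> ('m \<Rightarrow> 'm tvec) \<Rightarrow> 'm \<Rightarrow> 'm tvec"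
  where "lie_bracket A X Y p =
    (\<lambda>f. if smooth_near A p f then X p (\<lambda>q. Y q f) - Y p (\<lambda>q. X q f) else 0)"

text \<open>
  Tangent spaces, distributions and their quotients at a point are not types, so linear maps
  between them are relativised to carriers.
\<close>

record 'v real_vspace =
  vcarrier :: "'v set"
  vadd :: "'v \<Rightarrow> 'v \<Rightarrow> 'v"
  vscale :: "real \<Rightarrow> 'v \<Rightarrow> 'v"

definition vlinear :: "('v, 'x) real_vspace_scheme \<Rightarrow> ('w, 'y) real_vspace_scheme \<Rightarrow> ('v \<Rightarrow> 'w) \<Rightarrow> bool"
  where "vlinear V W f \<longleftrightarrow>
    f ` vcarrier V \<subseteq> vcarrier W \<and>
    (\<forall>u\<in>vcarrier V. \<forall>v\<in>vcarrier V. f (vadd V u v) = vadd W (f u) (f v)) \<and>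
    (\<forall>c. \<forall>u\<in>vcarrier V. f (vscale V c u) = vscale W c (f u))"

definition sub_space :: "'v::real_vector set \<Rightarrow> 'v real_vspace"
  where "sub_space S = \<lparr>vcarrier = S, vadd = (+), vscale = (*\<^sub>R)\<rparr>"

definition coset :: "'v::real_vector set \<Rightarrow> 'v \<Rightarrow> 'v set"
  where "coset S u = {u + s |s. s \<in> S}"

text \<open>The quotient \<open>T/S\<close>; its zero element is \<open>S\<close>.\<close>

definition quot_space :: "'v::real_vector set \<Rightarrow> 'v set \<Rightarrow> 'v set real_vspace"
  where "quot_space T S =
    \<lparr>vcarrier = coset S ` T,
     vadd = (\<lambda>P Q. {p + q |p q. p \<in> P \<and> q \<in> Q}),
     vscale = (\<lambda>c P. {c *\<^sub>R p + s |p s. p \<in> P \<and> s \<in> S})\<rparr>"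

definition direct_sum :: "'v real_vspace \<Rightarrow> 'w real_vspace \<Rightarrow> ('v \<times> 'w) real_vspace"
  where "direct_sum V W =
    \<lparr>vcarrier = vcarrier V \<times> vcarrier W,
     vadd = (\<lambda>(a, b) (c, d). (vadd V a c, vadd W b d)),
     vscale = (\<lambda>r (a, b). (vscale V r a, vscale W r b))\<rparr>"

record 'v graded_lie_algebra = "'v real_vspace" +
  bracket :: "'v \<Rightarrow> 'v \<Rightarrow> 'v"
  degree_part :: "int \<Rightarrow> 'v set"

definition graded_lie_iso :: "'v graded_lie_algebra \<Rightarrow> 'w graded_lie_algebra \<Rightarrow> ('v \<Rightarrow> 'w) \<Rightarrow> bool"
  where "graded_lie_iso V W \<gamma> \<longleftrightarrow>
    vlinear V W \<gamma> \<and> bij_betw \<gamma> (vcarrier V) (vcarrier W) \<and>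
    (\<forall>u\<in>vcarrier V. \<forall>v\<in>vcarrier V. \<gamma> (bracket V u v) = bracket W (\<gamma> u) (\<gamma> v)) \<and>
    (\<forall>k. \<gamma> ` degree_part V k = degree_part W k)"

text \<open>Between spaces of the same finite dimension such a map is automatically bijective.\<close>

definition linear_isometry ::
  "'v::real_vector set \<Rightarrow> ('v \<Rightarrow> 'v \<Rightarrow> real) \<Rightarrow> 'w::real_vector set \<Rightarrow> ('w \<Rightarrow> 'w \<Rightarrow> real) \<Rightarrow> ('v \<Rightarrow> 'w) \<Rightarrow> bool"
  where "linear_isometry V g W h f \<longleftrightarrow>
    vlinear (sub_space V) (sub_space W) f \<and> (\<forall>u\<in>V. \<forall>v\<in>V. h (f u) (f v) = g u v)"

text \<open>A smooth subbundle of rank \<open>k\<close> is a family of subspaces locally spanned by a smooth frame.\<close>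

definition distribution ::
  "('m::topological_space, 'e::euclidean_space) chart set \<Rightarrow> nat \<Rightarrow> ('m \<Rightarrow> 'm tvec set) \<Rightarrow> bool"
  where "distribution A k D \<longleftrightarrow>
    (\<forall>p. \<exists>U E. open U \<and> p \<in> U \<and> (\<forall>i<k. vector_field_on A U (E i)) \<and>
      (\<forall>q\<in>U. inj_on (\<lambda>i. E i q) {..<k} \<and> independent ((\<lambda>i. E i q) ` {..<k}) \<and>
        D q = span ((\<lambda>i. E i q) ` {..<k})))"

definition section_on ::
  "('m::topological_space, 'e::euclidean_space) chart set \<Rightarrow> ('m \<Rightarrow> 'm tvec set) \<Rightarrow> 'm set \<Rightarrow>
    ('m \<Rightarrow> 'm tvec) \<Rightarrow> bool"
  where "section_on A D U X \<longleftrightarrow> vector_field_on A U X \<and> (\<forall>p\<in>U. X p \<in> D p)"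

text \<open>
  The class of \<open>[X, Y]\<close> at \<open>x\<close> modulo \<open>D\<close>, where \<open>X\<close> and \<open>Y\<close> are any local sections of \<open>D\<close>
  through \<open>u\<close> and \<open>v\<close>; it does not depend on the choice of these sections.
\<close>

definition levi_map ::
  "('m::topological_space, 'e::euclidean_space) chart set \<Rightarrow> ('m \<Rightarrow> 'm tvec set) \<Rightarrow> 'm \<Rightarrow>
    'm tvec \<Rightarrow> 'm tvec \<Rightarrow> 'm tvec set"
  where "levi_map A D x u v =
    (SOME q. \<exists>U X Y. open U \<and> x \<in> U \<and> section_on A D U X \<and> section_on A D U Y \<and>
      X x = u \<and> Y x = v \<and> q = coset (D x) (lie_bracket A X Y x))"

definition corank_one_structure ::
  "('m::topological_space, 'e::euclidean_space) chart set \<Rightarrow> ('m \<Rightarrow> 'm tvec set) \<Rightarrow> bool"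
  where "corank_one_structure (A :: ('m, 'e) chart set) D \<longleftrightarrow>
    distribution A (DIM('e) - 1) D \<and>
    (\<forall>x. \<exists>u\<in>D x. \<exists>v\<in>D x. levi_map A D x u v \<noteq> coset (D x) 0)"

definition riemannian_metric_on ::
  "('m::topological_space, 'e::euclidean_space) chart set \<Rightarrow> ('m \<Rightarrow> 'm tvec set) \<Rightarrow>
    ('m \<Rightarrow> 'm tvec \<Rightarrow> 'm tvec \<Rightarrow> real) \<Rightarrow> bool"
  where "riemannian_metric_on A D g \<longleftrightarrow>
    (\<forall>p. \<forall>u\<in>D p. \<forall>v\<in>D p. \<forall>w\<in>D p. \<forall>a b.
      g p u v = g p v u \<and> g p (a *\<^sub>R u + b *\<^sub>R v) w = a * g p u w + b * g p v w \<and>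
      (u \<noteq> 0 \<longrightarrow> g p u u > 0)) \<and>
    (\<forall>W X Y. open W \<longrightarrow> section_on A D W X \<longrightarrow> section_on A D W Y \<longrightarrow>
      smooth_fun_on A W (\<lambda>p. g p (X p) (Y p)))"

definition corank_one_sub_riemannian ::
  "('m::{t2_space,second_countable_topology}, 'e::euclidean_space) chart set \<Rightarrow>
    ('m \<Rightarrow> 'm tvec set) \<Rightarrow> ('m \<Rightarrow> 'm tvec \<Rightarrow> 'm tvec \<Rightarrow> real) \<Rightarrow> bool"
  where "corank_one_sub_riemannian A D g \<longleftrightarrow>
    smooth_atlas A \<and> corank_one_structure A D \<and> riemannian_metric_on A D g"

text \<open>The underlying space is \<open>T\<^sub>xM/D\<^sub>x \<oplus> D\<^sub>x\<close>; \<open>coset (D x) 0\<close> is the zero of the first summand.\<close>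

definition osculating_algebra ::
  "('m::topological_space, 'e::euclidean_space) chart set \<Rightarrow> ('m \<Rightarrow> 'm tvec set) \<Rightarrow> 'm \<Rightarrow>
    ('m tvec set \<times> 'm tvec) graded_lie_algebra"
  where "osculating_algebra A D x =
    real_vspace.extend (direct_sum (quot_space (tangent_space A x) (D x)) (sub_space (D x)))
      (graded_lie_algebra.fields
        (\<lambda>(_, u) (_, v). (levi_map A D x u v, 0))
        (\<lambda>k. if k = - 1 then {coset (D x) 0} \<times> D x
             else if k = - 2 then (coset (D x) ` tangent_space A x) \<times> {0}
             else {(coset (D x) 0, 0)}))"

definition degree_minus_one ::
  "('m \<Rightarrow> 'm tvec set) \<Rightarrow> 'm \<Rightarrow> ('m tvec set \<times> 'm tvec \<Rightarrow> 'n tvec set \<times> 'n tvec) \<Rightarrow> 'm tvec \<Rightarrow> 'n tvec"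
  where "degree_minus_one D x \<gamma> = (\<lambda>u. snd (\<gamma> (coset (D x) 0, u)))"

definition one_form_on ::
  "('m::topological_space, 'e::euclidean_space) chart set \<Rightarrow> 'm set \<Rightarrow> ('m \<Rightarrow> 'm tvec \<Rightarrow> real) \<Rightarrow> bool"
  where "one_form_on A U \<theta> \<longleftrightarrow>
    (\<forall>p\<in>U. \<forall>u\<in>tangent_space A p. \<forall>v\<in>tangent_space A p. \<forall>a b.
      \<theta> p (a *\<^sub>R u + b *\<^sub>R v) = a * \<theta> p u + b * \<theta> p v) \<and>
    (\<forall>W X. open W \<longrightarrow> W \<subseteq> U \<longrightarrow> vector_field_on A W X \<longrightarrow> smooth_fun_on A W (\<lambda>p. \<theta> p (X p)))"

text \<open>The invariant formula for \<open>d\<theta>\<close>, normalised without the factor \<open>1/2\<close> used by some authors.\<close>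

definition exterior_derivative ::
  "('m::topological_space, 'e::euclidean_space) chart set \<Rightarrow> ('m \<Rightarrow> 'm tvec \<Rightarrow> real) \<Rightarrow>
    ('m \<Rightarrow> 'm tvec) \<Rightarrow> ('m \<Rightarrow> 'm tvec) \<Rightarrow> 'm \<Rightarrow> real"
  where "exterior_derivative A \<theta> X Y p =
    X p (\<lambda>q. \<theta> q (Y q)) - Y p (\<lambda>q. \<theta> q (X q)) - \<theta> p (lie_bracket A X Y p)"

definition defining_form ::
  "('m::topological_space, 'e::euclidean_space) chart set \<Rightarrow> ('m \<Rightarrow> 'm tvec set) \<Rightarrow> 'm set \<Rightarrow>
    ('m \<Rightarrow> 'm tvec \<Rightarrow> real) \<Rightarrow> bool"
  where "defining_form A D U \<theta> \<longleftrightarrow>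
    one_form_on A U \<theta> \<and> (\<forall>p\<in>U. D p = {v \<in> tangent_space A p. \<theta> p v = 0})"

definition represents_dtheta ::
  "('m::topological_space, 'e::euclidean_space) chart set \<Rightarrow> ('m \<Rightarrow> 'm tvec set) \<Rightarrow>
    ('m \<Rightarrow> 'm tvec \<Rightarrow> 'm tvec \<Rightarrow> real) \<Rightarrow> 'm \<Rightarrow> ('m \<Rightarrow> 'm tvec \<Rightarrow> real) \<Rightarrow> ('m tvec \<Rightarrow> 'm tvec) \<Rightarrow> bool"
  where "represents_dtheta A D g x \<theta> J \<longleftrightarrow>
    vlinear (sub_space (D x)) (sub_space (D x)) J \<and>
    (\<forall>W X Y. open W \<longrightarrow> x \<in> W \<longrightarrow> section_on A D W X \<longrightarrow> section_on A D W Y \<longrightarrow>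
      exterior_derivative A \<theta> X Y x = g x (J (X x)) (Y x))"

text \<open>
  The complex eigenvalues, with algebraic multiplicity, of an endomorphism \<open>J\<close> of a
  finite-dimensional real space \<open>V\<close>: the roots of the characteristic polynomial of its matrix in
  a basis (any basis gives the same result).
\<close>

definition is_basis :: "'v::real_vector set \<Rightarrow> 'v list \<Rightarrow> bool"
  where "is_basis V bs \<longleftrightarrow> distinct bs \<and> independent (set bs) \<and> span (set bs) = V"

definition matrix_in_basis :: "'v::real_vector list \<Rightarrow> ('v \<Rightarrow> 'v) \<Rightarrow> real Matrix.mat"
  where "matrix_in_basis bs J =
    Matrix.mat (length bs) (length bs) (\<lambda>(i, j). representation (set bs) (J (bs ! j)) (bs ! i))"

definition eigenvalues :: "'v::real_vector set \<Rightarrow> ('v \<Rightarrow> 'v) \<Rightarrow> complex multiset"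
  where "eigenvalues V J =
    proots (char_poly (map_mat complex_of_real (matrix_in_basis (SOME bs. is_basis V bs) J)))"

text \<open>The class of a non-zero vector of length \<open>n\<close> in the projective space of dimension \<open>n - 1\<close>.\<close>

definition proj_point :: "real list \<Rightarrow> real list set"
  where "proj_point a = {map ((*) c) a |c. c \<noteq> 0}"

text \<open>
  If \<open>dim M = 2n + 1\<close> or \<open>dim M = 2n + 2\<close>, then \<open>n = (dim M - 1) div 2\<close>, and the rank
  \<open>dim M - 1\<close> of \<open>D\<close> exceeds \<open>2n\<close> by \<open>0\<close> or \<open>1\<close>, the number of extra zero eigenvalues. The point
  of projective space obtained does not depend on the choice of \<open>\<theta>\<close>.
\<close>

definition type_map ::
  "('m::topological_space, 'e::euclidean_space) chart set \<Rightarrow> ('m \<Rightarrow> 'm tvec set) \<Rightarrow>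
    ('m \<Rightarrow> 'm tvec \<Rightarrow> 'm tvec \<Rightarrow> real) \<Rightarrow> 'm \<Rightarrow> real list set"
  where "type_map (A :: ('m, 'e) chart set) D g x =
    (let n = (DIM('e) - 1) div 2 in
      SOME P. \<exists>U \<theta> J \<alpha>. open U \<and> x \<in> U \<and> defining_form A D U \<theta> \<and> represents_dtheta A D g x \<theta> J \<and>
        length \<alpha> = n \<and> sorted \<alpha> \<and> (\<forall>a\<in>set \<alpha>. 0 \<le> a) \<and>
        eigenvalues (D x) J =
          mset (map (\<lambda>a. \<i> * complex_of_real a) \<alpha>) + mset (map (\<lambda>a. - \<i> * complex_of_real a) \<alpha>) +
          replicate_mset (DIM('e) - 1 - 2 * n) 0 \<and>
        P = proj_point \<alpha>)"

end

theory Submission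
  imports Defs
begin

text \<open>
  Write \<open>D = ker \<theta>\<close> near \<open>x\<close>. On sections \<open>X\<close>, \<open>Y\<close> of \<open>D\<close> one has \<open>d\<theta>(X, Y) = - \<theta> [X, Y]\<close>,
  and the value of the right-hand side at \<open>x\<close> depends only on \<open>X x\<close> and \<open>Y x\<close>. Hence \<open>\<theta>\<close> identifies
  the Levi form at \<open>x\<close> with the skew form \<open>- g (J u) v\<close>, and another choice of \<open>\<theta>\<close> multiplies \<open>J\<close> by a
  non-zero constant. An isometry \<open>\<gamma>\<close> between the fibres preserves the Levi forms up to a linear map of the
  one-dimensional quotients iff \<open>J' \<gamma> = c \<gamma> J\<close> for some \<open>c \<noteq> 0\<close>. By the normal form of skew
  operators, such an isometry exists iff the lists of the \<open>\<alpha>\<^sub>j\<close> are proportional.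
\<close>

section \<open>Smooth functions of several variables\<close>

text \<open>Tangent vectors are derivations, and \<open>levi_map\<close> and \<open>type_map\<close>
  are \<open>SOME\<close> terms, so much of the geometric work is well-definedness. Derivations are
  tied to charts by one fact: the coordinate functions separate them. This is what Hadamard's lemma
  is for, and it stands in for the dimension of the tangent space. The form \<theta> is a
  determinant whose coefficients are cofactors of a smooth frame, which makes it smooth without the
  choice of a complement of D. At the point, the geometry is condensed into linear data (V, g, T, L,
  t, J); the quotient T/V is a line because V is the kernel of the nonzero functional t. The normal
  form splits off invariant planes of J. They come from a complex eigenvector on the image of J,
  where skewness excludes the eigenvalue 0. The ratio c of two forms may be negative. Exchanging the
  two vectors of every plane replaces c by its absolute value, which keeps the numbers nonnegative
  and sorted. The eigenvalues determine the sorted list, so the type can be read off any sorted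
  frame.\<close>

lemma Ck_on_subset: "Ck_on k S f \<Longrightarrow> T \<subseteq> S \<Longrightarrow> Ck_on k T f"
  by (induction k arbitrary: f) (auto intro: continuous_on_subset)

lemma frechet_derivative_cong_open:
  assumes "open S" "x \<in> S" "\<And>z. z \<in> S \<Longrightarrow> f z = g z"
  shows "frechet_derivative f (at x) = frechet_derivative g (at x)"
proof -
  have "(f has_derivative D) (at x) \<longleftrightarrow> (g has_derivative D) (at x)" for D
    using assms has_derivative_transform_within_open[of _ _ x UNIV S] by metis
  then show ?thesis unfolding frechet_derivative_def by simp
qed

text \<open>On an open set, agreement at all points is agreement near each point, so the derivatives
  agree too. Local expressions such as \<open>f \<circ> inv_into U \<phi>\<close> are controlled on
  the chart image only, hence the need for this transfer.\<close>

lemma Ck_on_cong: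
  assumes "open S" "\<And>z. z \<in> S \<Longrightarrow> f z = g z" "Ck_on k S f"
  shows "Ck_on k S g"
  using assms(2,3)
proof (induction k arbitrary: f g)
  case 0
  then show ?case using continuous_on_cong[of S S f g] by auto
next
  case (Suc k)
  have "g differentiable (at x)" if "x \<in> S" for x
    using Suc.prems that assms(1) has_derivative_transform_within_open[of f _ x UNIV S g]
    unfolding differentiable_def by (metis Ck_on.simps(2) differentiable_def)
  moreover have "Ck_on k S (\<lambda>x. frechet_derivative g (at x) v)" for v
    by (rule Suc.IH[of "\<lambda>x. frechet_derivative f (at x) v"])
      (use Suc.prems frechet_derivative_cong_open[OF assms(1), of _ f g] in auto)
  ultimately show ?case by simp
qed

text \<open>Frees the inductions from \<open>frechet_derivative\<close>: by uniqueness of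
  derivatives any known formula may take its place.\<close>

lemma Ck_on_Suc_I:
  assumes "open S" "\<And>x. x \<in> S \<Longrightarrow> (f has_derivative f' x) (at x)" "\<And>v. Ck_on k S (\<lambda>x. f' x v)"
  shows "Ck_on (Suc k) S f"
proof -
  have "Ck_on k S (\<lambda>x. frechet_derivative f (at x) v)" for v
    by (rule Ck_on_cong[OF assms(1) _ assms(3)[of v]]) (use assms(2) frechet_derivative_at in metis)
  then show ?thesis using assms(2) by (auto simp: differentiable_def)
qed

lemma Ck_on_Suc_D:
  assumes "Ck_on (Suc k) S f"
  shows "\<And>x. x \<in> S \<Longrightarrow> (f has_derivative frechet_derivative f (at x)) (at x)"
    "\<And>v. Ck_on k S (\<lambda>x. frechet_derivative f (at x) v)"
  using assms frechet_derivative_works by auto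

text \<open>\<open>Ck_on (Suc k)\<close> speaks of the derivatives of f and does not mention order k
  for f itself; at the bottom, continuity of f comes from differentiability.\<close>

lemma Ck_on_pred: "Ck_on (Suc k) S f \<Longrightarrow> Ck_on k S f"
proof (induction k arbitrary: f)
  case 0
  then show ?case
    by (auto intro!: continuous_at_imp_continuous_on differentiable_imp_continuous_within)
qed simp

lemma Ck_on_continuous: "Ck_on k S f \<Longrightarrow> continuous_on S f"
proof (induction k)
  case (Suc k)
  then show ?case using Ck_on_pred by blast
qed simp

lemma Ck_on_const: "open S \<Longrightarrow> Ck_on k S (\<lambda>x. c)"
proof (induction k arbitrary: c)
  case (Suc k)
  then show ?case by (intro Ck_on_Suc_I[where f' = "\<lambda>_ _. 0"]) (auto intro!: derivative_eq_intros)
qed simp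

lemma Ck_on_bounded_linear:
  assumes "open S" "bounded_linear h" "Ck_on k S f"
  shows "Ck_on k S (\<lambda>x. h (f x))"
  using assms(3)
proof (induction k arbitrary: f)
  case 0
  then show ?case using assms(2) by (auto intro: bounded_linear.continuous_on)
next
  case (Suc k)
  show ?case
    by (rule Ck_on_Suc_I[OF assms(1) bounded_linear.has_derivative[OF assms(2) Ck_on_Suc_D(1)[OF Suc.prems]]
          Suc.IH[OF Ck_on_Suc_D(2)[OF Suc.prems]]])
qed

lemma Ck_on_add:
  assumes "open S" "Ck_on k S f" "Ck_on k S g"
  shows "Ck_on k S (\<lambda>x. f x + g x)"
  using assms(2,3)
proof (induction k arbitrary: f g)
  case 0
  then show ?case by (auto intro: continuous_intros)
next
  case (Suc k)
  show ?case
    by (rule Ck_on_Suc_I[OF assms(1) has_derivative_add[OF Ck_on_Suc_D(1)[OF Suc.prems(1)]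
        Ck_on_Suc_D(1)[OF Suc.prems(2)]]
          Suc.IH[OF Ck_on_Suc_D(2)[OF Suc.prems(1)] Ck_on_Suc_D(2)[OF Suc.prems(2)]]])
qed

lemma Ck_on_sum:
  assumes "open S" "\<And>i. i \<in> I \<Longrightarrow> Ck_on k S (f i)"
  shows "Ck_on k S (\<lambda>x. \<Sum>i\<in>I. f i x)"
  using assms(2) by (induction I rule: infinite_finite_induct) (auto intro: Ck_on_const Ck_on_add assms(1))

lemma Ck_on_mult:
  fixes f g :: "'a::real_normed_vector \<Rightarrow> real"
  assumes "open S" "Ck_on k S f" "Ck_on k S g"
  shows "Ck_on k S (\<lambda>x. f x * g x)"
  using assms(2,3)
proof (induction k arbitrary: f g)
  case 0
  then show ?case by (auto intro: continuous_intros)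
next
  case (Suc k)
  show ?case
    by (rule Ck_on_Suc_I[OF assms(1) has_derivative_mult[OF Ck_on_Suc_D(1)[OF Suc.prems(1)]
        Ck_on_Suc_D(1)[OF Suc.prems(2)]]
          Ck_on_add[OF assms(1) Suc.IH[OF Ck_on_pred[OF Suc.prems(1)] Ck_on_Suc_D(2)[OF Suc.prems(2)]]
            Suc.IH[OF Ck_on_Suc_D(2)[OF Suc.prems(1)] Ck_on_pred[OF Suc.prems(2)]]]])
qed

text \<open>The chain rule gives the derivative of f at \<open>h x\<close> applied to the derivative
  of h. Expanding the latter in \<open>Basis\<close> yields a sum of products of real functions; the
  partial derivatives of f, composed with the same h, fall under the induction hypothesis.\<close>

lemma Ck_on_compose:
  fixes f :: "'b::euclidean_space \<Rightarrow> real" and h :: "'a::real_normed_vector \<Rightarrow> 'b"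
  assumes "open S" "open T" "h ` S \<subseteq> T" "Ck_on k T f" "Ck_on k S h"
  shows "Ck_on k S (\<lambda>x. f (h x))"
  using assms(4,5)
proof (induction k arbitrary: f)
  case 0
  then show ?case using assms(3) by (auto intro: continuous_on_compose2)
next
  case (Suc k)
  show ?case
  proof (rule Ck_on_Suc_I[OF assms(1)])
    fix x assume x: "x \<in> S"
    then have hx: "h x \<in> T" using assms(3) by auto
    let ?dh = "frechet_derivative h (at x)" and ?df = "frechet_derivative f (at (h x))"
    have "((\<lambda>x. f (h x)) has_derivative (\<lambda>v. ?df (?dh v))) (at x)"
      using diff_chain_at[OF Ck_on_Suc_D(1)[OF Suc.prems(2) x] Ck_on_Suc_D(1)[OF Suc.prems(1) hx]]
      by (simp add: o_def)
    moreover have "?df (?dh v) = (\<Sum>b\<in>Basis. (?dh v \<bullet> b) * ?df b)" for v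
    proof -
      interpret df: linear ?df
        using Ck_on_Suc_D(1)[OF Suc.prems(1) hx] has_derivative_linear by blast
      have "?df (?dh v) = ?df (\<Sum>b\<in>Basis. (?dh v \<bullet> b) *\<^sub>R b)" by (simp add: euclidean_representation)
      also have "\<dots> = (\<Sum>b\<in>Basis. (?dh v \<bullet> b) * ?df b)" by (simp add: df.sum df.scale)
      finally show ?thesis .
    qed
    ultimately show "((\<lambda>x. f (h x)) has_derivative
        (\<lambda>v. \<Sum>b\<in>Basis. (?dh v \<bullet> b) * ?df b)) (at x)" by simp
  next
    fix v
    show "Ck_on k S (\<lambda>x. \<Sum>b\<in>Basis. (frechet_derivative h (at x) v \<bullet> b) *
        frechet_derivative f (at (h x)) b)"
      by (intro Ck_on_sum Ck_on_mult assms(1) Suc.IH Ck_on_Suc_D(2)[OF Suc.prems(1)] Ck_on_pred[OF Suc.prems(2)]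
          Ck_on_bounded_linear[OF assms(1) bounded_linear_inner_left] Ck_on_Suc_D(2)[OF Suc.prems(2)])
  qed
qed

section \<open>Integrals along rays and Hadamard's lemma\<close>

lemma ray_in_ball:
  fixes a z :: "'a::real_normed_vector"
  assumes "z \<in> ball a r" "t \<in> {0..1}"
  shows "a + t *\<^sub>R (z - a) \<in> ball a r"
proof -
  have "dist a (a + t *\<^sub>R (z - a)) = \<bar>t\<bar> * dist a z"
    by (simp add: dist_norm norm_minus_commute)
  also have "\<dots> \<le> 1 * dist a z" using assms by (intro mult_right_mono) auto
  finally show ?thesis using assms by auto
qed

text \<open>Differentiating under the integral brings down a factor t from the ray, so the weight w
  becomes t * w t; the general weight makes the induction close. One order of differentiability is
  lost because already continuity in z is read off from the Leibniz rule, which uses a continuous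
  derivative.\<close>

lemma Ck_on_ray_integral:
  fixes f :: "'a::euclidean_space \<Rightarrow> real" and w :: "real \<Rightarrow> real"
  assumes "Ck_on (Suc k) (ball a r) f" "continuous_on {0..1} w"
  shows "Ck_on k (ball a r) (\<lambda>z. integral {0..1} (\<lambda>t. w t * f (a + t *\<^sub>R (z - a))))"
  using assms
proof (induction k arbitrary: f w)
  note ray = ray_in_ball[of _ a r]
  have cont: "continuous_on (ball a r \<times> {0..1}) (\<lambda>(z, t). w t * f (a + t *\<^sub>R (z - a)))"
    if "continuous_on (ball a r) f" "continuous_on {0..1} w" for f w :: "_ \<Rightarrow> real"
    unfolding split_beta
    by (intro continuous_on_mult continuous_on_compose2[OF that(1)] continuous_on_compose2[OF that(2)] continuous_intros)
      (use ray in auto)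
  have D: "((\<lambda>z. integral {0..1} (\<lambda>t. w t * f (a + t *\<^sub>R (z - a)))) has_derivative
      (\<lambda>v. integral {0..1} (\<lambda>t. (t * w t) * frechet_derivative f (at (a + t *\<^sub>R (z - a))) v))) (at z)"
    if f: "Ck_on (Suc 0) (ball a r) f" and w: "continuous_on {0..1} w" and z: "z \<in> ball a r" for f w z
  proof -
    have Pair: "continuous_on {0..1} (Pair z)" "z \<in> ball a r \<Longrightarrow> Pair z ` {0..1} \<subseteq> ball a r \<times> {0..1}" for z
      by (auto intro: continuous_intros)
    let ?d = "\<lambda>z t v. (t * w t) * frechet_derivative f (at (a + t *\<^sub>R (z - a))) v"
    have bl: "bounded_linear (?d z t)" if "z \<in> ball a r" "t \<in> {0..1}" for z t
      by (intro bounded_linear_intros has_derivative_bounded_linear[OF Ck_on_Suc_D(1)[OF f]] ray that)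
    \<comment> \<open>\<open>leibniz_rule\<close> wants the derivative of the integrand as a bounded
      linear function that depends continuously on z and t; in finite dimension this continuity is
      checked componentwise.\<close>
    define X where "X z t = Blinfun (?d z t)" for z t
    have X: "blinfun_apply (X z t) = ?d z t" if "z \<in> ball a r" "t \<in> {0..1}" for z t
      unfolding X_def by (rule bounded_linear_Blinfun_apply[OF bl[OF that]])
    have cf: "continuous_on (ball a r) f" using Ck_on_continuous[OF f] .
    have cw: "continuous_on {0..1} (\<lambda>t. t * w t)" using w by (intro continuous_intros)
    have cX: "continuous_on (ball a r \<times> {0..1}) (\<lambda>(z, t). X z t)"
    proof (rule continuous_on_blinfun_componentwise)
      fix i :: 'a
      have "continuous_on (ball a r \<times> {0..1}) (\<lambda>(z, t). ?d z t i)"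
        using Ck_on_continuous[OF Ck_on_Suc_D(2)[OF f]] by (intro cont cw)
      then show "continuous_on (ball a r \<times> {0..1}) (\<lambda>x. blinfun_apply (case x of (z, t) \<Rightarrow> X z t) i)"
        by (rule continuous_on_eq) (auto simp: X)
    qed
    have "((\<lambda>z. integral (cbox 0 1) (\<lambda>t. w t * f (a + t *\<^sub>R (z - a)))) has_derivative
      integral (cbox 0 1) (X z)) (at z within ball a r)"
    proof (rule leibniz_rule)
      fix z t assume z: "z \<in> ball a r" and t: "t \<in> cbox 0 (1::real)"
      then have t': "t \<in> {0..1}" by simp
      have "((\<lambda>z. a + t *\<^sub>R (z - a)) has_derivative (\<lambda>v. t *\<^sub>R v)) (at z)"
        by (auto intro!: derivative_eq_intros)
      from has_derivative_mult_right[OF diff_chain_at[OF this Ck_on_Suc_D(1)[OF f ray[OF z t']]], of "w t"]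
      have "((\<lambda>z. w t * f (a + t *\<^sub>R (z - a))) has_derivative
         (\<lambda>v. w t * frechet_derivative f (at (a + t *\<^sub>R (z - a))) (t *\<^sub>R v))) (at z)"
        by (simp add: o_def)
      moreover have "w t * frechet_derivative f (at (a + t *\<^sub>R (z - a))) (t *\<^sub>R v) = ?d z t v" for v
        using linear_scale[OF has_derivative_linear[OF Ck_on_Suc_D(1)[OF f ray[OF z t']]], of t v] by simp
      ultimately show "((\<lambda>z. w t * f (a + t *\<^sub>R (z - a))) has_derivative blinfun_apply (X z t)) (at z within ball a r)"
        using X[OF z t'] has_derivative_at_withinI by fastforce
    next
      fix z assume z: "z \<in> ball a r"
      have "continuous_on {0..1} (\<lambda>t. w t * f (a + t *\<^sub>R (z - a)))"
        using continuous_on_compose2[OF cont[OF cf w] Pair(1)] Pair(2)[OF z] by simp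
      then show "(\<lambda>t. w t * f (a + t *\<^sub>R (z - a))) integrable_on cbox 0 1"
        by (intro integrable_continuous) simp
    qed (use cX z in auto)
    moreover have "blinfun_apply (integral (cbox 0 1) (X z)) = (\<lambda>v. integral {0..1} (\<lambda>t. ?d z t v))"
    proof
      fix v
      have "continuous_on {0..1} (X z)"
        using continuous_on_compose2[OF cX Pair(1)] Pair(2)[OF z] by simp
      then have "(X z) integrable_on cbox 0 1" by (intro integrable_continuous) simp
      then have "blinfun_apply (integral (cbox 0 1) (X z)) v = integral (cbox 0 1) (\<lambda>t. blinfun_apply (X z t) v)"
        by (rule blinfun_apply_integral)
      also have "\<dots> = integral {0..1} (\<lambda>t. ?d z t v)"
        unfolding cbox_interval by (rule integral_cong) (simp add: X[OF z])
      finally show "blinfun_apply (integral (cbox 0 1) (X z)) v = integral {0..1} (\<lambda>t. ?d z t v)" .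
    qed
    ultimately show ?thesis using z at_within_open[of z "ball a r"] by simp
  qed
  {
    case 0
    have "continuous (at z) (\<lambda>z. integral {0..1} (\<lambda>t. w t * f (a + t *\<^sub>R (z - a))))" if "z \<in> ball a r" for z
      using D[OF 0 that] by (rule has_derivative_continuous)
    then show ?case by (auto intro: continuous_at_imp_continuous_on)
  next
    case (Suc k)
    have 1: "Ck_on (Suc 0) (ball a r) f"
      using Suc.prems(1) Ck_on_continuous[OF Ck_on_Suc_D(2)[OF Suc.prems(1)]]
      by (simp only: Ck_on.simps) blast
    have cw: "continuous_on {0..1} (\<lambda>t. t * w t)" using Suc.prems(2) by (intro continuous_intros)
    show ?case
      by (rule Ck_on_Suc_I[OF _ D[OF 1 Suc.prems(2)] Suc.IH[OF Ck_on_Suc_D(2)[OF Suc.prems(1)] cw]]) auto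
  }
qed

text \<open>By the fundamental theorem of calculus along the ray from a to z, f z - f a is the
  integral of the derivative in the direction z - a. Expanding this direction in
  \<open>Basis\<close> shows the b-th factor to be the integral of the b-th partial derivative along
  the ray.\<close>

lemma hadamard:
  fixes f :: "'a::euclidean_space \<Rightarrow> real"
  assumes "smooth_on (ball a r) f"
  obtains h where "\<And>b. b \<in> Basis \<Longrightarrow> smooth_on (ball a r) (h b)"
    "\<And>z. z \<in> ball a r \<Longrightarrow> f z = f a + (\<Sum>b\<in>Basis. ((z - a) \<bullet> b) * h b z)"
proof
  have C: "Ck_on k (ball a r) f" for k using assms by (simp add: smooth_on_def)
  \<comment> \<open>The factor 1 is the initial weight in \<open>Ck_on_ray_integral\<close>.\<close>
  let ?h = "\<lambda>b z. integral {0..1} (\<lambda>t. 1 * frechet_derivative f (at (a + t *\<^sub>R (z - a))) b)"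
  show "smooth_on (ball a r) (?h b)" for b
    unfolding smooth_on_def
    by (intro allI Ck_on_ray_integral Ck_on_Suc_D(2)[OF C] continuous_intros)
  fix z assume z: "z \<in> ball a r"
  note ray = ray_in_ball[OF z]
  let ?D = "\<lambda>t. frechet_derivative f (at (a + t *\<^sub>R (z - a)))"
  have "((\<lambda>t. f (a + t *\<^sub>R (z - a))) has_vector_derivative ?D t (z - a)) (at t within {0..1})"
    if t: "t \<in> {0..1}" for t
  proof -
    have "((\<lambda>t. a + t *\<^sub>R (z - a)) has_derivative (\<lambda>s. s *\<^sub>R (z - a))) (at t)"
      by (auto intro!: derivative_eq_intros)
    from diff_chain_at[OF this Ck_on_Suc_D(1)[OF C ray[OF t]]]
    have "((\<lambda>t. f (a + t *\<^sub>R (z - a))) has_derivative (\<lambda>s. ?D t (s *\<^sub>R (z - a)))) (at t)"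
      by (simp add: o_def)
    then show ?thesis
      using linear_scale[OF has_derivative_linear[OF Ck_on_Suc_D(1)[OF C ray[OF t]]]]
      by (simp add: has_vector_derivative_def has_derivative_at_withinI)
  qed
  then have "((\<lambda>t. ?D t (z - a)) has_integral f (a + 1 *\<^sub>R (z - a)) - f (a + 0 *\<^sub>R (z - a))) {0..1}"
    by (intro fundamental_theorem_of_calculus) auto
  then have "f z - f a = integral {0..1} (\<lambda>t. ?D t (z - a))"
    by (simp add: integral_unique)
  also have "\<dots> = integral {0..1} (\<lambda>t. \<Sum>b\<in>Basis. ((z - a) \<bullet> b) * ?D t b)"
  proof (rule integral_cong)
    fix t :: real assume t: "t \<in> {0..1}"
    interpret d: linear "?D t" using has_derivative_linear[OF Ck_on_Suc_D(1)[OF C ray[OF t]]] .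
    have "?D t (z - a) = ?D t (\<Sum>b\<in>Basis. ((z - a) \<bullet> b) *\<^sub>R b)" by (simp add: euclidean_representation)
    also have "\<dots> = (\<Sum>b\<in>Basis. ((z - a) \<bullet> b) * ?D t b)" by (simp add: d.sum d.scale)
    finally show "?D t (z - a) = (\<Sum>b\<in>Basis. ((z - a) \<bullet> b) * ?D t b)" .
  qed
  also have "\<dots> = (\<Sum>b\<in>Basis. integral {0..1} (\<lambda>t. ((z - a) \<bullet> b) * ?D t b))"
  proof (rule integral_sum)
    fix b :: 'a
    have "continuous_on {0..1} (\<lambda>t. ?D t b)"
      by (rule continuous_on_compose2[OF Ck_on_continuous[OF Ck_on_Suc_D(2)[OF C]]])
        (auto intro!: continuous_intros ray simp del: mem_ball)
    then show "(\<lambda>t. ((z - a) \<bullet> b) * ?D t b) integrable_on {0..1}"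
      by (intro integrable_continuous_interval continuous_intros)
  qed simp
  finally show "f z = f a + (\<Sum>b\<in>Basis. ((z - a) \<bullet> b) * ?h b z)" by simp
qed

section \<open>Derivations and vector fields\<close>

locale smooth_manifold =
  fixes A :: "('m::{t2_space,second_countable_topology}, 'e::euclidean_space) chart set"
  assumes atlas: "smooth_atlas A"
begin

lemma chart_homeomorphism:
  assumes "(U, \<phi>) \<in> A"
  shows "open U" "open (\<phi> ` U)" "homeomorphism U (\<phi> ` U) \<phi> (inv_into U \<phi>)"
  using atlas assms unfolding smooth_atlas_def by (metis (mono_tags, lifting) case_prodD)+

lemma chart_transition:
  assumes "(U, \<phi>) \<in> A" "(V, \<psi>) \<in> A"
  shows "smooth_on (\<phi> ` (U \<inter> V)) (\<psi> \<circ> inv_into U \<phi>)"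
  using atlas assms unfolding smooth_atlas_def by (metis (mono_tags, lifting) case_prodD)

lemma chart_around: obtains U \<phi> where "(U, \<phi>) \<in> A" "p \<in> U"
  using atlas unfolding smooth_atlas_def by blast

lemma chart_inv: "(U, \<phi>) \<in> A \<Longrightarrow> q \<in> U \<Longrightarrow> inv_into U \<phi> (\<phi> q) = q"
  using chart_homeomorphism(3) homeomorphism_apply1 by metis

lemma chart_image_open:
  assumes "(U, \<phi>) \<in> A" "open W"
  shows "open (\<phi> ` (U \<inter> W))"
proof -
  have "openin (top_of_set (\<phi> ` U)) (\<phi> ` (U \<inter> W))"
    by (rule homeomorphism_imp_open_map[OF chart_homeomorphism(3)[OF assms(1)] openin_open_Int[OF assms(2)]])
  then show ?thesis using chart_homeomorphism(2)[OF assms(1)] by (rule openin_open_trans)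
qed

lemma smooth_fun_onI:
  assumes "\<And>U \<phi> k. (U, \<phi>) \<in> A \<Longrightarrow> Ck_on k (\<phi> ` (U \<inter> W)) (f \<circ> inv_into U \<phi>)"
  shows "smooth_fun_on A W f"
  using assms unfolding smooth_fun_on_def smooth_on_def by auto

lemma smooth_fun_onD:
  "smooth_fun_on A W f \<Longrightarrow> (U, \<phi>) \<in> A \<Longrightarrow> Ck_on k (\<phi> ` (U \<inter> W)) (f \<circ> inv_into U \<phi>)"
  unfolding smooth_fun_on_def smooth_on_def by auto

lemma smooth_fun_on_subset: "smooth_fun_on A W f \<Longrightarrow> V \<subseteq> W \<Longrightarrow> smooth_fun_on A V f"
  by (rule smooth_fun_onI, rule Ck_on_subset[OF smooth_fun_onD]) auto

lemma smooth_fun_on_cong: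
  assumes "open W" "\<And>q. q \<in> W \<Longrightarrow> f q = g q" "smooth_fun_on A W f"
  shows "smooth_fun_on A W g"
proof (rule smooth_fun_onI)
  fix U \<phi> k assume U: "(U, \<phi>) \<in> A"
  show "Ck_on k (\<phi> ` (U \<inter> W)) (g \<circ> inv_into U \<phi>)"
    by (rule Ck_on_cong[OF chart_image_open[OF U assms(1)] _ smooth_fun_onD[OF assms(3) U]])
      (auto simp: chart_inv[OF U] assms(2))
qed

lemma smooth_fun_on_const: "open W \<Longrightarrow> smooth_fun_on A W (\<lambda>q. c)"
  by (auto intro!: smooth_fun_onI Ck_on_const chart_image_open simp: o_def)

lemma smooth_fun_on_add:
  assumes "open W" "smooth_fun_on A W f" "smooth_fun_on A W g"
  shows "smooth_fun_on A W (\<lambda>q. f q + g q)"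
  using smooth_fun_onD[OF assms(2)] smooth_fun_onD[OF assms(3)]
  by (auto intro!: smooth_fun_onI Ck_on_add chart_image_open assms(1) simp: o_def)

lemma smooth_fun_on_mult:
  assumes "open W" "smooth_fun_on A W f" "smooth_fun_on A W g"
  shows "smooth_fun_on A W (\<lambda>q. f q * g q)"
  using smooth_fun_onD[OF assms(2)] smooth_fun_onD[OF assms(3)]
  by (auto intro!: smooth_fun_onI Ck_on_mult chart_image_open assms(1) simp: o_def)

lemma smooth_fun_on_sum:
  assumes "open W" "\<And>i. i \<in> I \<Longrightarrow> smooth_fun_on A W (f i)"
  shows "smooth_fun_on A W (\<lambda>q. \<Sum>i\<in>I. f i q)"
  using assms(2) by (induction I rule: infinite_finite_induct)
    (auto intro!: smooth_fun_on_add smooth_fun_on_const assms(1))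

lemma smooth_fun_on_prod:
  assumes "open W" "\<And>i. i \<in> I \<Longrightarrow> smooth_fun_on A W (f i)"
  shows "smooth_fun_on A W (\<lambda>q. \<Prod>i\<in>I. f i q)"
  using assms(2) by (induction I rule: infinite_finite_induct)
    (auto intro!: smooth_fun_on_mult smooth_fun_on_const assms(1))

text \<open>One chart containing W is enough: every other chart differs from it by a smooth
  transition map, and \<open>Ck_on_compose\<close> applies.\<close>

lemma smooth_fun_on_chartI:
  assumes "(U, \<phi>) \<in> A" "open W" "W \<subseteq> U" "smooth_on (\<phi> ` W) (f \<circ> inv_into U \<phi>)"
  shows "smooth_fun_on A W f"
proof (rule smooth_fun_onI)
  fix V \<psi> k assume V: "(V, \<psi>) \<in> A"
  have *: "\<phi> ` (U \<inter> W) = \<phi> ` W" using assms(3) by (simp add: inf.absorb2)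
  have o: "open (\<psi> ` (V \<inter> W))" "open (\<phi> ` W)"
    using chart_image_open[OF V assms(2)] chart_image_open[OF assms(1,2)] * by auto
  have "Ck_on k (\<psi> ` (V \<inter> W)) (\<lambda>z. (f \<circ> inv_into U \<phi>) ((\<phi> \<circ> inv_into V \<psi>) z))"
  proof (rule Ck_on_compose[OF o])
    show "(\<phi> \<circ> inv_into V \<psi>) ` \<psi> ` (V \<inter> W) \<subseteq> \<phi> ` W"
      using chart_inv[OF V] by auto
    show "Ck_on k (\<phi> ` W) (f \<circ> inv_into U \<phi>)" using assms(4) by (simp add: smooth_on_def)
    have "Ck_on k (\<psi> ` (V \<inter> U)) (\<phi> \<circ> inv_into V \<psi>)"
      using chart_transition[OF V assms(1)] by (simp add: smooth_on_def)
    then show "Ck_on k (\<psi> ` (V \<inter> W)) (\<phi> \<circ> inv_into V \<psi>)"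
      by (rule Ck_on_subset) (use assms(3) in auto)
  qed
  then show "Ck_on k (\<psi> ` (V \<inter> W)) (f \<circ> inv_into V \<psi>)"
    by (rule Ck_on_cong[OF o(1), rotated]) (use chart_inv[OF V] chart_inv[OF assms(1)] assms(3) in auto)
qed

lemma smooth_fun_on_coord:
  assumes "(U, \<phi>) \<in> A"
  shows "smooth_fun_on A U (\<lambda>q. inner (\<phi> q) b)"
proof (rule smooth_fun_onI)
  fix V \<psi> k assume V: "(V, \<psi>) \<in> A"
  have "Ck_on k (\<psi> ` (V \<inter> U)) (\<phi> \<circ> inv_into V \<psi>)"
    using chart_transition[OF V assms] by (simp add: smooth_on_def)
  from Ck_on_bounded_linear[OF chart_image_open[OF V chart_homeomorphism(1)[OF assms]]
      bounded_linear_inner_left[of b] this]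
  show "Ck_on k (\<psi> ` (V \<inter> U)) ((\<lambda>q. inner (\<phi> q) b) \<circ> inv_into V \<psi>)"
    by (simp add: o_def)
qed

section \<open>Functions that are smooth near a point\<close>

lemma smooth_nearI: "open W \<Longrightarrow> p \<in> W \<Longrightarrow> smooth_fun_on A W f \<Longrightarrow> smooth_near A p f"
  unfolding smooth_near_def by blast

lemma smooth_near_cong:
  assumes "open W" "p \<in> W" "\<And>q. q \<in> W \<Longrightarrow> f q = g q" "smooth_near A p f"
  shows "smooth_near A p g"
proof -
  obtain V where V: "open V" "p \<in> V" "smooth_fun_on A V f" using assms(4) unfolding smooth_near_def by blast
  show ?thesis
    by (rule smooth_nearI[of "V \<inter> W"], (use V assms in auto)[2],
        rule smooth_fun_on_cong[of _ f]) (use V assms smooth_fun_on_subset in auto)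
qed

lemma smooth_near_const: "smooth_near A p (\<lambda>q. c)"
  by (rule smooth_nearI[of UNIV]) (auto intro: smooth_fun_on_const)

lemma smooth_near_binop:
  assumes "smooth_near A p f" "smooth_near A p g"
  obtains V where "open V" "p \<in> V" "smooth_fun_on A V f" "smooth_fun_on A V g"
proof -
  obtain V W where "open V" "p \<in> V" "smooth_fun_on A V f" "open W" "p \<in> W" "smooth_fun_on A W g"
    using assms unfolding smooth_near_def by blast
  then show ?thesis using that[of "V \<inter> W"] smooth_fun_on_subset by auto
qed

lemma smooth_near_add: "smooth_near A p f \<Longrightarrow> smooth_near A p g \<Longrightarrow> smooth_near A p (\<lambda>q. f q + g q)"
  by (erule (1) smooth_near_binop) (blast intro: smooth_nearI smooth_fun_on_add)

lemma smooth_near_mult: "smooth_near A p f \<Longrightarrow> smooth_near A p g \<Longrightarrow> smooth_near A p (\<lambda>q. f q * g q)"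
  by (erule (1) smooth_near_binop) (blast intro: smooth_nearI smooth_fun_on_mult)

lemma smooth_near_cmult: "smooth_near A p f \<Longrightarrow> smooth_near A p (\<lambda>q. c * f q)"
  using smooth_near_mult[OF smooth_near_const] .

lemma smooth_near_sum:
  "(\<And>i. i \<in> I \<Longrightarrow> smooth_near A p (f i)) \<Longrightarrow> smooth_near A p (\<lambda>q. \<Sum>i\<in>I. f i q)"
  by (induction I rule: infinite_finite_induct) (auto intro: smooth_near_const smooth_near_add)

section \<open>Algebra and locality of derivations\<close>

lemma tangent_add:
  "v \<in> tangent_space A p \<Longrightarrow> smooth_near A p f \<Longrightarrow> smooth_near A p g \<Longrightarrow>
    v (\<lambda>q. f q + g q) = v f + v g"
  unfolding tangent_space_def plus_fun_def by auto

lemma tangent_mult: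
  "v \<in> tangent_space A p \<Longrightarrow> smooth_near A p f \<Longrightarrow> smooth_near A p g \<Longrightarrow>
    v (\<lambda>q. f q * g q) = f p * v g + g p * v f"
  unfolding tangent_space_def times_fun_def by auto

lemma tangent_cmult:
  "v \<in> tangent_space A p \<Longrightarrow> smooth_near A p f \<Longrightarrow> v (\<lambda>q. c * f q) = c * v f"
  unfolding tangent_space_def scaleR_fun_def by auto

lemma tangent_not_smooth: "v \<in> tangent_space A p \<Longrightarrow> \<not> smooth_near A p f \<Longrightarrow> v f = 0"
  unfolding tangent_space_def by auto

lemma tangent_lincomb:
  assumes "v \<in> tangent_space A p" "smooth_near A p f" "smooth_near A p g"
  shows "v (\<lambda>q. a * f q + b * g q) = a * v f + b * v g"
  using tangent_add[OF assms(1) smooth_near_cmult[OF assms(2)] smooth_near_cmult[OF assms(3)]]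
    tangent_cmult[OF assms(1)] assms by simp

text \<open>The Leibniz rule for 1 * 1 gives v 1 = 2 * v 1, hence v 1 = 0; homogeneity does the
  rest.\<close>

lemma tangent_const: "v \<in> tangent_space A p \<Longrightarrow> v (\<lambda>q. c) = 0"
  using tangent_mult[OF _ smooth_near_const[of p 1] smooth_near_const[of p 1], of v]
    tangent_cmult[OF _ smooth_near_const[of p 1], of v c] by simp

lemma tangent_sum:
  assumes "v \<in> tangent_space A p" "\<And>i. i \<in> I \<Longrightarrow> smooth_near A p (f i)"
  shows "v (\<lambda>q. \<Sum>i\<in>I. f i q) = (\<Sum>i\<in>I. v (f i))"
  using assms(2) by (induction I rule: infinite_finite_induct)
    (auto simp: tangent_const[OF assms(1)] tangent_add[OF assms(1)] smooth_near_sum)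

(* The indicator of W is smooth near p, and multiplying by it kills the difference f - g. *)
lemma tangent_local:
  assumes v: "v \<in> tangent_space A p" and W: "open W" "p \<in> W" and eq: "\<And>q. q \<in> W \<Longrightarrow> f q = g q"
  shows "v f = v g"
proof (cases "smooth_near A p f")
  case False
  then have "\<not> smooth_near A p g" using smooth_near_cong[OF W, of g f] eq by metis
  then show ?thesis using tangent_not_smooth[OF v] False by simp
next
  case f: True
  then have g: "smooth_near A p g" using smooth_near_cong[OF W, of f g] eq by metis
  let ?h = "\<lambda>q. 1 * f q + (-1) * g q" and ?\<chi> = "\<lambda>q. if q \<in> W then 1 else (0::real)"
  have \<chi>: "smooth_near A p ?\<chi>"
    by (rule smooth_near_cong[OF W, of "\<lambda>q. 1"]) (auto intro: smooth_near_const)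
  have h: "smooth_near A p ?h" by (intro smooth_near_add smooth_near_cmult f g)
  have "v (\<lambda>q. ?h q * ?\<chi> q) = v (\<lambda>q. 0)" using eq by (auto intro!: arg_cong[where f = v])
  then have "v ?h = 0" using tangent_mult[OF v h \<chi>] eq W by (simp add: tangent_const[OF v])
  then show ?thesis using tangent_lincomb[OF v f g, of 1 "-1"] by simp
qed

lemma tangent_locally_0:
  "v \<in> tangent_space A p \<Longrightarrow> open W \<Longrightarrow> p \<in> W \<Longrightarrow> (\<And>q. q \<in> W \<Longrightarrow> f q = 0) \<Longrightarrow> v f = 0"
  using tangent_local[of v p W f "\<lambda>q. 0"] tangent_const[of v p 0] by simp

lemma tangent_space_lincomb:
  assumes "u \<in> tangent_space A p" "v \<in> tangent_space A p"
  shows "a *\<^sub>R u + b *\<^sub>R v \<in> tangent_space A p"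
  unfolding tangent_space_def
proof (intro CollectI conjI allI impI)
  fix f g assume f: "smooth_near A p f" and g: "smooth_near A p g"
  note fg = tangent_add[OF assms(1) f g] tangent_add[OF assms(2) f g]
    tangent_mult[OF assms(1) f g] tangent_mult[OF assms(2) f g]
  show "(a *\<^sub>R u + b *\<^sub>R v) (f + g) = (a *\<^sub>R u + b *\<^sub>R v) f + (a *\<^sub>R u + b *\<^sub>R v) g"
    by (simp add: scaleR_fun_def plus_fun_def fg distrib_left)
  show "(a *\<^sub>R u + b *\<^sub>R v) (f * g) = f p * (a *\<^sub>R u + b *\<^sub>R v) g + g p * (a *\<^sub>R u + b *\<^sub>R v) f"
    by (simp add: scaleR_fun_def times_fun_def fg distrib_left)
next
  fix c f assume "smooth_near A p f"
  then show "(a *\<^sub>R u + b *\<^sub>R v) (c *\<^sub>R f) = c * (a *\<^sub>R u + b *\<^sub>R v) f"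
    using tangent_cmult[OF assms(1)] tangent_cmult[OF assms(2)] by (simp add: scaleR_fun_def distrib_left)
qed (use tangent_not_smooth[OF assms(1)] tangent_not_smooth[OF assms(2)] in \<open>simp add: scaleR_fun_def\<close>)

lemma subspace_tangent_space: "subspace (tangent_space A p)"
proof (rule subspaceI)
  show "0 \<in> tangent_space A p" by (simp add: tangent_space_def)
  show "u + v \<in> tangent_space A p" if "u \<in> tangent_space A p" "v \<in> tangent_space A p" for u v
    using tangent_space_lincomb[OF that, of 1 1] by simp
  show "c *\<^sub>R v \<in> tangent_space A p" if "v \<in> tangent_space A p" for c v
    using tangent_space_lincomb[OF that that, of c 0] by simp
qed

text \<open>Hadamard's lemma writes f near p as f p plus products of centred coordinates with smooth
  factors. The Leibniz rule then makes v f a combination of the values of v on the coordinates, so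
  tangent vectors can be compared through their coordinates.\<close>

lemma tangent_eq_0:
  assumes v: "v \<in> tangent_space A p" and U: "(U, \<phi>) \<in> A" "p \<in> U"
    and 0: "\<And>b. b \<in> Basis \<Longrightarrow> v (\<lambda>q. inner (\<phi> q) b) = 0"
  shows "v = 0"
proof
  fix f
  show "v f = 0 f"
  proof (cases "smooth_near A p f")
    case True
    then obtain W where W: "open W" "p \<in> W" "smooth_fun_on A W f" unfolding smooth_near_def by blast
    have "open (\<phi> ` (U \<inter> W))" "\<phi> p \<in> \<phi> ` (U \<inter> W)" using chart_image_open U W by auto
    then obtain r where r: "r > 0" "ball (\<phi> p) r \<subseteq> \<phi> ` (U \<inter> W)" by (meson openE)
    have "smooth_on (ball (\<phi> p) r) (f \<circ> inv_into U \<phi>)"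
      unfolding smooth_on_def using Ck_on_subset[OF smooth_fun_onD[OF W(3) U(1)] r(2)] by blast
    from hadamard[OF this] obtain h where h: "\<And>b. b \<in> Basis \<Longrightarrow> smooth_on (ball (\<phi> p) r) (h b)"
      "\<And>z. z \<in> ball (\<phi> p) r \<Longrightarrow> (f \<circ> inv_into U \<phi>) z = (f \<circ> inv_into U \<phi>) (\<phi> p) +
          (\<Sum>b\<in>Basis. (inner (z - \<phi> p) b) * h b z)" by metis
    \<comment> \<open>The expansion is valid only on the part of the chart that is mapped into the
      ball; \<open>tangent_local\<close> lets v ignore everything else.\<close>
    define B where "B = {q \<in> U. \<phi> q \<in> ball (\<phi> p) r}"
    have "B = U \<inter> \<phi> -` ball (\<phi> p) r" by (auto simp: B_def)
    then have B: "open B" "p \<in> B" "B \<subseteq> U" "\<phi> ` B \<subseteq> ball (\<phi> p) r"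
      using chart_homeomorphism[OF U(1)] U(2) r(1)
      by (auto simp: homeomorphism_def intro: continuous_open_preimage)
    have hs: "smooth_near A p (\<lambda>q. h b (\<phi> q))" if "b \<in> Basis" for b
    proof (rule smooth_nearI[OF B(1,2)], rule smooth_fun_on_chartI[OF U(1) B(1,3)])
      have "Ck_on k (\<phi> ` B) (h b)" for k
        using Ck_on_subset[OF _ B(4), of k "h b"] h(1)[OF that] by (simp add: smooth_on_def)
      moreover have "open (\<phi> ` B)" using chart_image_open[OF U(1) B(1)] B(3) by (simp add: inf.absorb2)
      ultimately have "Ck_on k (\<phi> ` B) ((\<lambda>q. h b (\<phi> q)) \<circ> inv_into U \<phi>)" for k
        by (rule Ck_on_cong[rotated 2]) (use B(3) chart_inv[OF U(1)] in auto)
      then show "smooth_on (\<phi> ` B) ((\<lambda>q. h b (\<phi> q)) \<circ> inv_into U \<phi>)"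
        by (simp add: smooth_on_def)
    qed
    have cs: "smooth_near A p (\<lambda>q. inner (\<phi> q) b)" for b
      using smooth_nearI[OF chart_homeomorphism(1)[OF U(1)] U(2) smooth_fun_on_coord[OF U(1)]] .
    have cs': "smooth_near A p (\<lambda>q. inner (\<phi> q - \<phi> p) b)" for b
      using smooth_near_add[OF cs[of b] smooth_near_const[of p "- (inner (\<phi> p) b)"]] by (simp add: inner_diff_left)
    have v0: "v (\<lambda>q. inner (\<phi> q - \<phi> p) b) = 0" if "b \<in> Basis" for b
      using tangent_add[OF v cs[of b] smooth_near_const[of p "- (inner (\<phi> p) b)"]] 0[OF that] tangent_const[OF v]
      by (simp add: inner_diff_left)
    have "v f = v (\<lambda>q. f p + (\<Sum>b\<in>Basis. (inner (\<phi> q - \<phi> p) b) * h b (\<phi> q)))"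
    proof (rule tangent_local[OF v B(1,2)])
      fix q assume "q \<in> B"
      then show "f q = f p + (\<Sum>b\<in>Basis. (inner (\<phi> q - \<phi> p) b) * h b (\<phi> q))"
        using h(2)[of "\<phi> q"] B(3) U chart_inv[OF U(1), of q] chart_inv[OF U(1,2)] by (auto simp: B_def)
    qed
    also have "\<dots> = v (\<lambda>q. \<Sum>b\<in>Basis. (inner (\<phi> q - \<phi> p) b) * h b (\<phi> q))"
      by (subst tangent_add[OF v smooth_near_const])
        (simp_all add: tangent_const[OF v] smooth_near_sum smooth_near_mult cs' hs)
    also have "\<dots> = (\<Sum>b\<in>Basis. v (\<lambda>q. (inner (\<phi> q - \<phi> p) b) * h b (\<phi> q)))"
      by (rule tangent_sum[OF v]) (auto intro!: smooth_near_mult cs' hs)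
    also have "\<dots> = 0"
      by (intro sum.neutral ballI) (auto simp: tangent_mult[OF v cs' hs] v0)
    finally show ?thesis by simp
  qed (use tangent_not_smooth[OF v] in simp)
qed

section \<open>Vector fields and their brackets\<close>

lemma vector_field_onD:
  "vector_field_on A U X \<Longrightarrow> p \<in> U \<Longrightarrow> X p \<in> tangent_space A p"
  "vector_field_on A U X \<Longrightarrow> open W \<Longrightarrow> W \<subseteq> U \<Longrightarrow> smooth_fun_on A W f \<Longrightarrow>
    smooth_fun_on A W (\<lambda>p. X p f)"
  unfolding vector_field_on_def by simp_all

lemma vector_field_on_subset:
  "vector_field_on A U X \<Longrightarrow> V \<subseteq> U \<Longrightarrow> vector_field_on A V X"
  unfolding vector_field_on_def by (meson subset_iff)

lemma vector_field_on_smooth_near: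
  assumes "vector_field_on A U X" "open U" "p \<in> U" "smooth_near A p f"
  shows "smooth_near A p (\<lambda>q. X q f)"
proof -
  obtain W where W: "open W" "p \<in> W" "smooth_fun_on A W f" using assms(4) unfolding smooth_near_def by blast
  have "smooth_fun_on A (U \<inter> W) (\<lambda>q. X q f)"
    using vector_field_onD(2)[OF assms(1) _ _ smooth_fun_on_subset[OF W(3)]] assms(2) W(1) by blast
  then show ?thesis using smooth_nearI[of "U \<inter> W"] assms(2,3) W(1,2) by blast
qed

lemma vector_field_on_lincomb:
  assumes "vector_field_on A U X" "vector_field_on A U Y"
  shows "vector_field_on A U (\<lambda>q. a *\<^sub>R X q + b *\<^sub>R Y q)"
  unfolding vector_field_on_def
proof (intro conjI ballI allI impI)
  fix W f assume W: "open W" "W \<subseteq> U" "smooth_fun_on A W f"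
  show "smooth_fun_on A W (\<lambda>p. (a *\<^sub>R X p + b *\<^sub>R Y p) f)"
    using vector_field_onD(2)[OF assms(1) W] vector_field_onD(2)[OF assms(2) W]
    by (auto simp: scaleR_fun_def intro!: smooth_fun_on_add smooth_fun_on_mult smooth_fun_on_const W(1))
qed (simp add: tangent_space_lincomb vector_field_onD(1)[OF assms(1)] vector_field_onD(1)[OF assms(2)])

lemma vector_field_on_sum:
  assumes "open U" "\<And>i. i \<in> I \<Longrightarrow> vector_field_on A U (X i)"
  shows "vector_field_on A U (\<lambda>q. \<Sum>i\<in>I. c i *\<^sub>R X i q)"
  using assms(2)
proof (induction I rule: infinite_finite_induct)
  case (insert i I)
  have "vector_field_on A U (\<lambda>q. c i *\<^sub>R X i q + 1 *\<^sub>R (\<Sum>i\<in>I. c i *\<^sub>R X i q))"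
    using insert by (intro vector_field_on_lincomb) auto
  then show ?case by (simp only: sum.insert[OF insert.hyps] scaleR_one)
qed (simp_all add: vector_field_on_def subspace_0[OF subspace_tangent_space] smooth_fun_on_const)

text \<open>A composite of two vector fields satisfies the Leibniz rule up to two products of first
  derivatives. These products are symmetric in the two fields and cancel in the commutator.\<close>

lemma lie_bracket_tangent:
  assumes U: "open U" "p \<in> U" and X: "vector_field_on A U X" and Y: "vector_field_on A U Y"
  shows "lie_bracket A X Y p \<in> tangent_space A p"
proof -
  have near: "smooth_near A p (\<lambda>q. Z q f)" if "vector_field_on A U Z" "smooth_near A p f" for Z f
    using vector_field_on_smooth_near[OF that(1) U that(2)] .
  \<comment> \<open>An expression under \<open>Z p\<close> may be rewritten only if the identity
    holds for all q near p, so the assumptions on f, g and the inner field are needed on a whole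
    neighbourhood.\<close>
  have ev: "\<exists>W. open W \<and> p \<in> W \<and> (\<forall>q\<in>W. Z q \<in> tangent_space A q \<and> smooth_near A q f \<and> smooth_near A q g)"
    if Z: "vector_field_on A U Z" and f: "smooth_near A p f" and g: "smooth_near A p g" for Z f g
  proof -
    obtain W where "open W" "p \<in> W" "smooth_fun_on A W f" "smooth_fun_on A W g"
      using smooth_near_binop[OF f g] by metis
    then show ?thesis using vector_field_onD(1)[OF Z] U
      by (intro exI[of _ "W \<inter> U"]) (auto intro: smooth_nearI)
  qed
  have add: "Z p (\<lambda>q. Z' q (\<lambda>q. f q + g q)) = Z p (\<lambda>q. Z' q f) + Z p (\<lambda>q. Z' q g)"
    if Z: "vector_field_on A U Z" "vector_field_on A U Z'" "smooth_near A p f" "smooth_near A p g" for Z Z' f g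
  proof -
    obtain W where W: "open W" "p \<in> W" "\<And>q. q \<in> W \<Longrightarrow> Z' q \<in> tangent_space A q \<and> smooth_near A q f \<and> smooth_near A q g"
      using ev[OF Z(2,3,4)] by metis
    have "Z p (\<lambda>q. Z' q (\<lambda>q. f q + g q)) = Z p (\<lambda>q. Z' q f + Z' q g)"
      by (rule tangent_local[OF vector_field_onD(1)[OF Z(1) U(2)] W(1,2)]) (use W(3) tangent_add in blast)
    then show ?thesis using tangent_add[OF vector_field_onD(1)[OF Z(1) U(2)]] near[OF Z(2)] Z by simp
  qed
  have mult: "Z p (\<lambda>q. Z' q (\<lambda>q. f q * g q)) =
      f p * Z p (\<lambda>q. Z' q g) + Z' p g * Z p f + (g p * Z p (\<lambda>q. Z' q f) + Z' p f * Z p g)"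
    if Z: "vector_field_on A U Z" "vector_field_on A U Z'" "smooth_near A p f" "smooth_near A p g" for Z Z' f g
  proof -
    obtain W where W: "open W" "p \<in> W" "\<And>q. q \<in> W \<Longrightarrow> Z' q \<in> tangent_space A q \<and> smooth_near A q f \<and> smooth_near A q g"
      using ev[OF Z(2,3,4)] by metis
    have "Z p (\<lambda>q. Z' q (\<lambda>q. f q * g q)) = Z p (\<lambda>q. f q * Z' q g + g q * Z' q f)"
      by (rule tangent_local[OF vector_field_onD(1)[OF Z(1) U(2)] W(1,2)]) (use W(3) tangent_mult in blast)
    then show ?thesis
      using tangent_add[OF vector_field_onD(1)[OF Z(1) U(2)]] tangent_mult[OF vector_field_onD(1)[OF Z(1) U(2)]]
        near[OF Z(2)] Z smooth_near_mult by simp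
  qed
  have cmult: "Z p (\<lambda>q. Z' q (\<lambda>q. c * f q)) = c * Z p (\<lambda>q. Z' q f)"
    if Z: "vector_field_on A U Z" "vector_field_on A U Z'" "smooth_near A p f" for Z Z' f c
  proof -
    obtain W where W: "open W" "p \<in> W" "\<And>q. q \<in> W \<Longrightarrow> Z' q \<in> tangent_space A q \<and> smooth_near A q f"
      using ev[OF Z(2,3,3)] by metis
    have "Z p (\<lambda>q. Z' q (\<lambda>q. c * f q)) = Z p (\<lambda>q. c * Z' q f)"
      by (rule tangent_local[OF vector_field_onD(1)[OF Z(1) U(2)] W(1,2)]) (use W(3) tangent_cmult in blast)
    then show ?thesis using tangent_cmult[OF vector_field_onD(1)[OF Z(1) U(2)]] near[OF Z(2)] Z by simp
  qed
  show ?thesis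
    unfolding tangent_space_def
  proof (intro CollectI conjI allI impI)
    fix f g assume f: "smooth_near A p f" and g: "smooth_near A p g"
    show "lie_bracket A X Y p (f + g) = lie_bracket A X Y p f + lie_bracket A X Y p g"
      using f g smooth_near_add[OF f g] add[OF X Y f g] add[OF Y X f g]
      by (simp add: lie_bracket_def plus_fun_def)
    show "lie_bracket A X Y p (f * g) = f p * lie_bracket A X Y p g + g p * lie_bracket A X Y p f"
      using f g smooth_near_mult[OF f g] mult[OF X Y f g] mult[OF Y X f g]
      by (simp add: lie_bracket_def times_fun_def algebra_simps)
  next
    fix c f assume f: "smooth_near A p f"
    show "lie_bracket A X Y p (c *\<^sub>R f) = c * lie_bracket A X Y p f"
      using f smooth_near_cmult[OF f] cmult[OF X Y f] cmult[OF Y X f]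
      by (simp add: lie_bracket_def scaleR_fun_def right_diff_distrib)
  qed (simp add: lie_bracket_def)
qed

lemma lie_bracket_skew: "lie_bracket A X Y p = - lie_bracket A Y X p"
  by (auto simp: lie_bracket_def)

text \<open>Constant coefficients suffice for what follows: differences of sections and lifts of
  linear combinations of vectors are of this kind.\<close>

lemma lie_bracket_lincomb:
  assumes U: "open U" "p \<in> U" and X: "vector_field_on A U X" "vector_field_on A U X'"
    and Y: "vector_field_on A U Y"
  shows "lie_bracket A (\<lambda>q. a *\<^sub>R X q + b *\<^sub>R X' q) Y p =
    a *\<^sub>R lie_bracket A X Y p + b *\<^sub>R lie_bracket A X' Y p"
proof
  fix f
  show "lie_bracket A (\<lambda>q. a *\<^sub>R X q + b *\<^sub>R X' q) Y p f =
    (a *\<^sub>R lie_bracket A X Y p + b *\<^sub>R lie_bracket A X' Y p) f"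
  proof (cases "smooth_near A p f")
    case True
    then show ?thesis
      using tangent_lincomb[OF vector_field_onD(1)[OF Y U(2)] vector_field_on_smooth_near[OF X(1) U True]
          vector_field_on_smooth_near[OF X(2) U True], of a b]
      by (simp add: lie_bracket_def scaleR_fun_def algebra_simps)
  qed (simp add: lie_bracket_def scaleR_fun_def)
qed

end

section \<open>Corank-one distributions\<close>

text \<open>Frames are indexed families, whereas \<open>span\<close> and \<open>independent\<close>
  speak of sets of vectors; injectivity of the indexing reconciles the two.\<close>

lemma span_image_eq_sums:
  assumes "finite I" "inj_on f I"
  shows "span (f ` I) = {\<Sum>i\<in>I. c i *\<^sub>R f i |c. True}"
proof -
  have "span (f ` I) = range (\<lambda>u. \<Sum>v\<in>f ` I. u v *\<^sub>R v)"
    using span_finite assms(1) by blast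
  also have "\<dots> = {\<Sum>i\<in>I. c i *\<^sub>R f i |c. True}"
  proof (intro equalityI subsetI)
    fix z assume "z \<in> {\<Sum>i\<in>I. c i *\<^sub>R f i |c. True}"
    then obtain c where "z = (\<Sum>i\<in>I. c i *\<^sub>R f i)" by auto
    then have "z = (\<Sum>v\<in>f ` I. c (inv_into I f v) *\<^sub>R v)"
      using assms by (simp add: sum.reindex)
    then show "z \<in> range (\<lambda>u. \<Sum>v\<in>f ` I. u v *\<^sub>R v)" by auto
  next
    fix z assume "z \<in> range (\<lambda>u. \<Sum>v\<in>f ` I. u v *\<^sub>R v)"
    then obtain u where "z = (\<Sum>v\<in>f ` I. u v *\<^sub>R v)" by auto
    then have "z = (\<Sum>i\<in>I. u (f i) *\<^sub>R f i)" using assms by (simp add: sum.reindex)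
    then show "z \<in> {\<Sum>i\<in>I. c i *\<^sub>R f i |c. True}"
      by (intro CollectI exI[of _ "\<lambda>i. u (f i)"]) simp
  qed
  finally show ?thesis .
qed

lemma independent_image_sum_0:
  assumes "finite I" "inj_on f I" "independent (f ` I)" "(\<Sum>i\<in>I. c i *\<^sub>R f i) = 0" "i \<in> I"
  shows "c i = 0"
proof -
  have "(\<Sum>v\<in>f ` I. c (inv_into I f v) *\<^sub>R v) = 0"
    using assms by (simp add: sum.reindex)
  from independentD[OF assms(3) _ subset_refl this, of "f i"] show ?thesis
    using assms by simp
qed

lemma coset_eq_iff:
  assumes "subspace S"
  shows "coset S u = coset S v \<longleftrightarrow> u - v \<in> S"
proof
  assume "coset S u = coset S v"
  moreover have "u \<in> coset S u" using subspace_0[OF assms] by (force simp: coset_def)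
  ultimately obtain s where "s \<in> S" "u = v + s" by (auto simp: coset_def)
  then show "u - v \<in> S" by simp
next
  have sub: "coset S u \<subseteq> coset S v" if "u - v \<in> S" for u v
  proof
    fix z assume "z \<in> coset S u"
    then obtain s where "s \<in> S" "z = u + s" by (auto simp: coset_def)
    then have "z = v + ((u - v) + s)" "(u - v) + s \<in> S"
      using subspace_add[OF assms that] by auto
    then show "z \<in> coset S v" unfolding coset_def by blast
  qed
  assume "u - v \<in> S"
  moreover from this have "v - u \<in> S" using subspace_neg[OF assms] by fastforce
  ultimately show "coset S u = coset S v" using sub by blast
qed

context smooth_manifold
begin

text \<open>By the Leibniz formula a determinant is a polynomial in its entries.\<close>

lemma smooth_fun_on_det:
  assumes "open W" "\<And>i j. i < n \<Longrightarrow> j < n \<Longrightarrow> smooth_fun_on A W (\<lambda>q. a q i j)"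
  shows "smooth_fun_on A W (\<lambda>q. Determinant.det (Matrix.mat n n (\<lambda>(i, j). a q i j)))"
proof -
  have less: "p i < n" if "p permutes {0..<n}" "i < n" for p i
    using permutes_in_image[OF that(1), of i] that(2) by simp
  have "Determinant.det (Matrix.mat n n (\<lambda>(i, j). a q i j)) =
      (\<Sum>p | p permutes {0..<n}. signof p * (\<Prod>i = 0..<n. a q i (p i)))" for q
    by (subst Determinant.det_def'[of _ n]) (auto intro!: sum.cong prod.cong simp: less)
  then show ?thesis
    using assms by (auto intro!: smooth_fun_on_sum smooth_fun_on_mult smooth_fun_on_prod smooth_fun_on_const
        simp: less)
qed

end

section \<open>Defining forms and brackets of sections\<close>

locale corank_one_distribution = smooth_manifold A
  for A :: "('m::{t2_space,second_countable_topology}, 'e::euclidean_space) chart set" +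
  fixes D :: "'m \<Rightarrow> 'm tvec set"
  assumes distribution: "distribution A (DIM('e) - 1) D"
begin

lemma subspace_D: "subspace (D p)"
  using distribution unfolding distribution_def by (metis subspace_span)

lemma D_tangent: "D p \<subseteq> tangent_space A p"
proof -
  obtain U E where U: "p \<in> U" and E: "\<forall>i<DIM('e) - 1. vector_field_on A U (E i)"
    and D: "D p = span ((\<lambda>i. E i p) ` {..<DIM('e) - 1})"
    using distribution unfolding distribution_def by metis
  have "(\<lambda>i. E i p) ` {..<DIM('e) - 1} \<subseteq> tangent_space A p"
    using vector_field_onD(1)[OF E[rule_format] U] by blast
  then show ?thesis unfolding D by (rule span_minimal[OF _ subspace_tangent_space])
qed

lemma section_on_lincomb:
  "section_on A D U X \<Longrightarrow> section_on A D U Y \<Longrightarrow> section_on A D U (\<lambda>q. a *\<^sub>R X q + b *\<^sub>R Y q)"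
  unfolding section_on_def
  by (simp add: vector_field_on_lincomb subspace_add[OF subspace_D] subspace_scale[OF subspace_D])

lemma section_on_subset: "section_on A D U X \<Longrightarrow> V \<subseteq> U \<Longrightarrow> section_on A D V X"
  unfolding section_on_def using vector_field_on_subset by (meson subset_iff)

(* The form v \<mapsto> det (E 0, \<dots>, E (k - 1), v) in coordinates, for a frame E of D; its coefficients c are cofactors. *)
lemma defining_form_exists:
  obtains U V \<phi> bs E \<theta> c where
    "open U" "x \<in> U" "U \<subseteq> V" "(V, \<phi>) \<in> A"
    "\<And>i. i < DIM('e) - 1 \<Longrightarrow> vector_field_on A U (E i)"
    "\<And>q. q \<in> U \<Longrightarrow> inj_on (\<lambda>i. E i q) {..<DIM('e) - 1}"
    "\<And>q. q \<in> U \<Longrightarrow> independent ((\<lambda>i. E i q) ` {..<DIM('e) - 1})"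
    "\<And>q. q \<in> U \<Longrightarrow> D q = span ((\<lambda>i. E i q) ` {..<DIM('e) - 1})"
    "defining_form A D U \<theta>"
    "\<And>q v. \<theta> q v = (\<Sum>i<DIM('e). c i q * v (\<lambda>p. inner (\<phi> p) (bs ! i)))"
    "\<And>i. i < DIM('e) \<Longrightarrow> smooth_fun_on A U (c i)"
proof -
  obtain U0 E where E: "open U0" "x \<in> U0" "\<forall>i<DIM('e) - 1. vector_field_on A U0 (E i)"
    "\<forall>q\<in>U0. inj_on (\<lambda>i. E i q) {..<DIM('e) - 1} \<and> independent ((\<lambda>i. E i q) ` {..<DIM('e) - 1}) \<and>
        D q = span ((\<lambda>i. E i q) ` {..<DIM('e) - 1})"
    using distribution unfolding distribution_def by metis
  obtain V \<phi> where V: "(V, \<phi>) \<in> A" "x \<in> V" by (rule chart_around)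
  define U where "U = U0 \<inter> V"
  define k where "k = DIM('e) - 1"
  have k: "DIM('e) = Suc k" using DIM_positive[where 'a='e] unfolding k_def by simp
  have U: "open U" "x \<in> U" "U \<subseteq> V" using E V chart_homeomorphism(1) by (auto simp: U_def)
  have EU: "i < k \<Longrightarrow> vector_field_on A U (E i)" for i
    using E(3) vector_field_on_subset[of U0 "E i" U] by (auto simp: U_def k_def)
  have frame: "inj_on (\<lambda>i. E i q) {..<k}" "independent ((\<lambda>i. E i q) ` {..<k})"
    "D q = span ((\<lambda>i. E i q) ` {..<k})" if "q \<in> U" for q
    using E(4) that by (auto simp: U_def k_def)
  obtain bs :: "'e list" where bs: "set bs = Basis" "distinct bs"
    using finite_distinct_list[OF finite_Basis] by blast
  have len: "length bs = Suc k" using distinct_card[OF bs(2)] bs(1) k by simp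
  define co where "co i = (\<lambda>p. inner (\<phi> p) (bs ! i))" for i
  have co: "smooth_fun_on A W (co i)" if "W \<subseteq> U" for W i
    unfolding co_def using smooth_fun_on_subset[OF smooth_fun_on_coord[OF V(1)]] that U(3) by blast
  have coord_0: "v = 0" if "v \<in> tangent_space A q" "q \<in> U" "\<And>i. i < Suc k \<Longrightarrow> v (co i) = 0" for v q
  proof (rule tangent_eq_0[OF that(1) V(1)])
    fix b :: 'e assume "b \<in> Basis"
    then obtain i where "i < Suc k" "b = bs ! i" using bs(1) len by (metis in_set_conv_nth)
    then show "v (\<lambda>q. inner (\<phi> q) b) = 0" using that(3)[of i] by (simp add: co_def)
  qed (use that U in auto)
  define M where "M q v = Matrix.mat (Suc k) (Suc k) (\<lambda>(i, j). if j < k then E j q (co i) else v (co i))"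
    for q and v :: "'m tvec"
  define \<theta> where "\<theta> q v = Determinant.det (M q v)" for q v
  \<comment> \<open>The cofactor of row i in the last column k; the conditional skips the deleted
    row. It involves the frame only, so it is smooth in q and does not depend on v.\<close>
  define c where "c i q = (-1) ^ (i + k) * Determinant.det
      (Matrix.mat k k (\<lambda>(i', j). E j q (co (if i' < i then i' else Suc i'))))" for i q
  have M: "M q v \<in> carrier_mat (Suc k) (Suc k)" for q v by (simp add: M_def)
  have \<theta>: "\<theta> q v = (\<Sum>i<Suc k. c i q * v (co i))" for q v
  proof -
    have "cofactor (M q v) i k = c i q" if "i < Suc k" for i
    proof -
      have "mat_delete (M q v) i k = Matrix.mat k k (\<lambda>(i', j). E j q (co (if i' < i then i' else Suc i')))"
        by (rule eq_matI) (auto simp: mat_delete_def M_def)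
      then show ?thesis by (simp add: cofactor_def c_def)
    qed
    then show ?thesis
      unfolding \<theta>_def laplace_expansion_column[OF M lessI]
      by (intro sum.cong) (auto simp: M_def mult.commute)
  qed
  have c: "smooth_fun_on A U (c i)" for i
    unfolding c_def
    by (intro smooth_fun_on_mult smooth_fun_on_const smooth_fun_on_det U vector_field_onD(2)[OF EU] co) auto
  have ker: "v \<in> D q \<longleftrightarrow> \<theta> q v = 0" if q: "q \<in> U" and v: "v \<in> tangent_space A q" for q v
  proof -
    have T: "(\<Sum>j<k. w j *\<^sub>R E j q) + a *\<^sub>R v \<in> tangent_space A q" for w a
      using vector_field_onD(1)[OF EU q] v subspace_tangent_space[of q]
      by (intro subspace_add subspace_sum subspace_scale) auto
    \<comment> \<open>The rows of the matrix are coordinates, and coordinates separate tangent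
      vectors; a relation between the columns is therefore a relation between the frame and v
      themselves.\<close>
    have Mw: "M q v *\<^sub>v w = 0\<^sub>v (Suc k) \<longleftrightarrow> (\<Sum>j<k. (w $ j) *\<^sub>R E j q) + (w $ k) *\<^sub>R v = 0"
      if w: "w \<in> carrier_vec (Suc k)" for w
    proof -
      have entry: "(M q v *\<^sub>v w) $ i = ((\<Sum>j<k. (w $ j) *\<^sub>R E j q) + (w $ k) *\<^sub>R v) (co i)" if "i < Suc k" for i
      proof -
        have sum_apply: "(\<Sum>j\<in>J. f j) z = (\<Sum>j\<in>J. f j z)" for f :: "nat \<Rightarrow> 'm tvec" and J z
          by (induction J rule: infinite_finite_induct) auto
        have "(M q v *\<^sub>v w) $ i = (\<Sum>j<Suc k. M q v $$ (i, j) * w $ j)"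
          using that w M[of q v] by (auto simp: scalar_prod_def M_def atLeast0LessThan intro!: sum.cong)
        also have "\<dots> = (\<Sum>j<k. w $ j * E j q (co i)) + w $ k * v (co i)"
          using that by (simp add: M_def mult.commute)
        finally show ?thesis by (simp add: sum_apply scaleR_fun_def)
      qed
      show ?thesis
      proof
        assume 0: "M q v *\<^sub>v w = 0\<^sub>v (Suc k)"
        show "(\<Sum>j<k. (w $ j) *\<^sub>R E j q) + (w $ k) *\<^sub>R v = 0"
          by (rule coord_0[OF T q], subst entry[symmetric]) (auto simp: 0)
      next
        assume 0: "(\<Sum>j<k. (w $ j) *\<^sub>R E j q) + (w $ k) *\<^sub>R v = 0"
        show "M q v *\<^sub>v w = 0\<^sub>v (Suc k)"
        proof (rule eq_vecI)
          show "(M q v *\<^sub>v w) $ i = 0\<^sub>v (Suc k) $ i" if "i < dim_vec (0\<^sub>v (Suc k))" for i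
            using entry[of i] that unfolding 0 by simp
        qed (use M[of q v] in simp)
      qed
    qed
    note sums = span_image_eq_sums[OF finite_lessThan frame(1)[OF q]]
    show ?thesis
    proof
      assume "v \<in> D q"
      then obtain a where a: "v = (\<Sum>j<k. a j *\<^sub>R E j q)" using frame(3)[OF q] sums by auto
      \<comment> \<open>The last entry -1 moves v to the other side of the relation and makes w
        nonzero.\<close>
      define w where "w = Matrix.vec (Suc k) (\<lambda>j. if j < k then a j else -1)"
      have w: "w \<in> carrier_vec (Suc k)" "w $ k = -1" "\<And>j. j < k \<Longrightarrow> w $ j = a j" by (auto simp: w_def)
      have "M q v *\<^sub>v w = 0\<^sub>v (Suc k)" unfolding Mw[OF w(1)] w(2) using a w(3) by simp
      moreover have "w \<noteq> 0\<^sub>v (Suc k)" using w(2) by auto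
      ultimately show "\<theta> q v = 0" unfolding \<theta>_def det_0_iff_vec_prod_zero[OF M] using w(1) by blast
    next
      assume "\<theta> q v = 0"
      then obtain w where w: "w \<in> carrier_vec (Suc k)" "w \<noteq> 0\<^sub>v (Suc k)" "M q v *\<^sub>v w = 0\<^sub>v (Suc k)"
        unfolding \<theta>_def det_0_iff_vec_prod_zero[OF M] by blast
      have 0: "(\<Sum>j<k. (w $ j) *\<^sub>R E j q) + (w $ k) *\<^sub>R v = 0" using Mw w by blast
      \<comment> \<open>A nontrivial relation without v would contradict the independence of the
        frame, so the relation can be solved for v.\<close>
      have "w $ k \<noteq> 0"
      proof
        assume k0: "w $ k = 0"
        then have "w $ j = 0" if "j < k" for j
          using independent_image_sum_0[OF finite_lessThan frame(1)[OF q] frame(2)[OF q], of "\<lambda>j. w $ j" j] 0 that by simp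
        then have "w = 0\<^sub>v (Suc k)" using w(1) k0 by (intro eq_vecI) (auto simp: less_Suc_eq)
        then show False using w(2) by blast
      qed
      moreover have "(w $ k) *\<^sub>R v = - (\<Sum>j<k. (w $ j) *\<^sub>R E j q)"
        using 0 by (simp add: eq_neg_iff_add_eq_0 add.commute)
      ultimately have "v = (- (1 / w $ k)) *\<^sub>R (\<Sum>j<k. (w $ j) *\<^sub>R E j q)"
        by (metis (no_types, lifting) scaleR_minus_left scaleR_minus_right scaleR_one scaleR_scaleR nonzero_eq_divide_eq)
      moreover have "(\<Sum>j<k. (w $ j) *\<^sub>R E j q) \<in> D q" unfolding frame(3)[OF q] sums by blast
      ultimately show "v \<in> D q" using subspace_scale[OF subspace_D] by blast
    qed
  qed
  have "one_form_on A U \<theta>"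
    unfolding one_form_on_def
  proof (intro conjI allI impI ballI)
    fix q u v a b
    show "\<theta> q (a *\<^sub>R u + b *\<^sub>R v) = a * \<theta> q u + b * \<theta> q v"
      unfolding \<theta> by (simp add: scaleR_fun_def sum.distrib sum_distrib_left algebra_simps)
  next
    fix W X assume W: "open W" "W \<subseteq> U" "vector_field_on A W X"
    show "smooth_fun_on A W (\<lambda>p. \<theta> p (X p))"
      unfolding \<theta>
      by (intro smooth_fun_on_sum smooth_fun_on_mult W(1) smooth_fun_on_subset[OF c W(2)] vector_field_onD(2)[OF W(3)] co W) simp
  qed
  then have "defining_form A D U \<theta>"
    unfolding defining_form_def using ker D_tangent by blast
  moreover have "\<theta> q v = (\<Sum>i<DIM('e). c i q * v (\<lambda>p. inner (\<phi> p) (bs ! i)))" for q v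
    unfolding k \<theta> co_def ..
  ultimately show thesis
    using that[OF U V(1), of E \<theta> c bs] EU frame c unfolding k_def by blast
qed

text \<open>The coefficients of u in the frame at x are kept constant over the
  neighbourhood.\<close>

lemma section_through:
  assumes "u \<in> D x"
  obtains U X where "open U" "x \<in> U" "section_on A D U X" "X x = u"
proof -
  obtain U V \<phi> bs E \<theta> c where U: "open U" "x \<in> U"
    and E: "\<And>i. i < DIM('e) - 1 \<Longrightarrow> vector_field_on A U (E i)"
    and frame: "\<And>q. q \<in> U \<Longrightarrow> inj_on (\<lambda>i. E i q) {..<DIM('e) - 1}"
    "\<And>q. q \<in> U \<Longrightarrow> D q = span ((\<lambda>i. E i q) ` {..<DIM('e) - 1})"
    by (rule defining_form_exists[of x]) (rule that)
  note sums = span_image_eq_sums[OF finite_lessThan frame(1)]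
  obtain a where a: "u = (\<Sum>i<DIM('e) - 1. a i *\<^sub>R E i x)"
    using assms frame(2)[OF U(2)] sums[OF U(2)] by auto
  have "section_on A D U (\<lambda>q. \<Sum>i<DIM('e) - 1. a i *\<^sub>R E i q)"
    unfolding section_on_def
  proof (intro conjI ballI)
    show "vector_field_on A U (\<lambda>q. \<Sum>i<DIM('e) - 1. a i *\<^sub>R E i q)"
      using U(1) E by (intro vector_field_on_sum) auto
    show "(\<Sum>i<DIM('e) - 1. a i *\<^sub>R E i q) \<in> D q" if "q \<in> U" for q
      unfolding frame(2)[OF that] sums[OF that] by blast
  qed
  then show thesis using that[OF U] a by simp
qed

(* Writing \<theta> = \<Sum>i. c i * d(co i), the Leibniz rule gives \<theta> [Z, Y] = - Y (\<theta> Z) = 0 at a zero of Z. *)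
lemma defining_form_bracket_exists:
  obtains U \<theta> B where "open U" "x \<in> U" "defining_form A D U \<theta>"
    "\<And>W X Y. open W \<Longrightarrow> x \<in> W \<Longrightarrow> section_on A D W X \<Longrightarrow> section_on A D W Y \<Longrightarrow>
      \<theta> x (lie_bracket A X Y x) = B (X x) (Y x)"
proof -
  obtain U V \<phi> bs E \<theta> c where U: "open U" "x \<in> U" "U \<subseteq> V" "(V, \<phi>) \<in> A"
    and df: "defining_form A D U \<theta>"
    and \<theta>: "\<And>q v. \<theta> q v = (\<Sum>i<DIM('e). c i q * v (\<lambda>p. inner (\<phi> p) (bs ! i)))"
    and c: "\<And>i. i < DIM('e) \<Longrightarrow> smooth_fun_on A U (c i)"
    by (rule defining_form_exists[of x]) (rule that)
  define co where "co i = (\<lambda>p. inner (\<phi> p) (bs ! i))" for i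
  have co: "smooth_near A x (co i)" for i
    unfolding co_def
    by (rule smooth_nearI[OF chart_homeomorphism(1)[OF U(4)] _ smooth_fun_on_coord[OF U(4)]]) (use U in auto)
  have zero: "\<theta> x (lie_bracket A Z Y x) = 0"
    if W: "open W" "x \<in> W" and Z: "section_on A D W Z" "Z x = 0" and Y: "section_on A D W Y" for W Z Y
  proof -
    have vf: "vector_field_on A W Z" "vector_field_on A W Y" using Z Y by (auto simp: section_on_def)
    have Yx: "Y x \<in> tangent_space A x" using vector_field_onD(1)[OF vf(2) W(2)] .
    have n: "smooth_near A x (c i)" "smooth_near A x (\<lambda>q. Z q (co i))" if "i < DIM('e)" for i
      using smooth_nearI[OF U(1,2) c[OF that]] vector_field_on_smooth_near[OF vf(1) W co] by auto
    \<comment> \<open>The half of the bracket in which \<open>Z x\<close> is the outer derivation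
      drops out because \<open>Z x = 0\<close>.\<close>
    have "\<theta> x (lie_bracket A Z Y x) = (\<Sum>i<DIM('e). c i x * (- Y x (\<lambda>q. Z q (co i))))"
      unfolding \<theta> co_def[symmetric] by (simp add: lie_bracket_def co Z(2))
    also have "\<dots> = - (\<Sum>i<DIM('e). Y x (\<lambda>q. c i q * Z q (co i)))"
      unfolding sum_negf[symmetric] by (intro sum.cong) (auto simp: tangent_mult[OF Yx] n Z(2))
    also have "(\<Sum>i<DIM('e). Y x (\<lambda>q. c i q * Z q (co i))) = Y x (\<lambda>q. \<theta> q (Z q))"
      unfolding \<theta> co_def[symmetric] by (rule tangent_sum[OF Yx, symmetric]) (auto intro: smooth_near_mult n)
    \<comment> \<open>Z is a section of D on a whole neighbourhood, so \<theta> Z vanishes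
      identically near x and not just at x.\<close>
    also have "Y x (\<lambda>q. \<theta> q (Z q)) = 0"
    proof (rule tangent_locally_0[OF Yx, of "U \<inter> W"])
      show "\<theta> q (Z q) = 0" if "q \<in> U \<inter> W" for q
        using that Z(1) df unfolding section_on_def defining_form_def by blast
    qed (use U W in auto)
    finally show ?thesis by simp
  qed
  have \<theta>_diff: "\<theta> x (1 *\<^sub>R u + (-1) *\<^sub>R v) = \<theta> x u - \<theta> x v" for u v
    unfolding \<theta> by (simp add: scaleR_fun_def sum_subtractf algebra_simps)
  have \<theta>_minus: "\<theta> x (- u) = - \<theta> x u" for u
    unfolding \<theta> by (simp add: sum_negf)
  have eq1: "\<theta> x (lie_bracket A X Y x) = \<theta> x (lie_bracket A X' Y x)"
    if W: "open W" "x \<in> W" and X: "section_on A D W X" "section_on A D W X'" "X x = X' x"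
      and Y: "section_on A D W Y" for W X X' Y
  proof -
    have "\<theta> x (lie_bracket A (\<lambda>q. 1 *\<^sub>R X q + (-1) *\<^sub>R X' q) Y x) = 0"
      by (rule zero[OF W section_on_lincomb[OF X(1,2)] _ Y]) (simp add: X(3))
    moreover have "vector_field_on A W X" "vector_field_on A W X'" "vector_field_on A W Y"
      using X Y by (auto simp: section_on_def)
    ultimately show ?thesis
      using lie_bracket_lincomb[OF W, of X X' Y 1 "-1"] \<theta>_diff by (simp del: scaleR_one)
  qed
  \<comment> \<open>Skew-symmetry of the bracket reduces a change of the second section to a change
    of the first.\<close>
  have eq: "\<theta> x (lie_bracket A X Y x) = \<theta> x (lie_bracket A X' Y' x)"
    if W: "open W" "x \<in> W" and X: "section_on A D W X" "section_on A D W X'" "X x = X' x"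
      and Y: "section_on A D W Y" "section_on A D W Y'" "Y x = Y' x" for W X X' Y Y'
    unfolding eq1[OF W X Y(1)] lie_bracket_skew[of X'] \<theta>_minus eq1[OF W Y X(2)] ..
  \<comment> \<open>Different pairs of sections may live on different neighbourhoods; restriction to
    the intersection makes the value b unique, which allows B to be defined by
    \<open>THE\<close>.\<close>
  define P where "P u v b \<longleftrightarrow> (\<exists>W X Y. open W \<and> x \<in> W \<and> section_on A D W X \<and> section_on A D W Y \<and>
      X x = u \<and> Y x = v \<and> b = \<theta> x (lie_bracket A X Y x))" for u v b
  have unique: "b = b'" if b: "P u v b" "P u v b'" for u v b b'
  proof -
    obtain W X Y where W: "open W" "x \<in> W" "section_on A D W X" "section_on A D W Y" "X x = u" "Y x = v"
        "b = \<theta> x (lie_bracket A X Y x)" using b(1) unfolding P_def by blast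
    obtain W' X' Y' where W': "open W'" "x \<in> W'" "section_on A D W' X'" "section_on A D W' Y'" "X' x = u" "Y' x = v"
        "b' = \<theta> x (lie_bracket A X' Y' x)" using b(2) unfolding P_def by blast
    show ?thesis
      unfolding W(7) W'(7)
      by (rule eq[of "W \<inter> W'", OF _ _ section_on_subset[OF W(3)] section_on_subset[OF W'(3)] _
            section_on_subset[OF W(4)] section_on_subset[OF W'(4)]]) (use W W' in auto)
  qed
  have "\<theta> x (lie_bracket A X Y x) = (THE b. P (X x) (Y x) b)"
    if "open W" "x \<in> W" "section_on A D W X" "section_on A D W Y" for W X Y
  proof -
    have "P (X x) (Y x) (\<theta> x (lie_bracket A X Y x))" unfolding P_def using that by blast
    then show ?thesis using unique by (intro the_equality[symmetric]) auto
  qed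
  then show thesis using that[OF U(1,2) df, of "\<lambda>u v. THE b. P u v b"] by blast
qed

text \<open>Both \<theta> X and \<theta> Y vanish identically near x, so only the bracket term of
  the invariant formula survives.\<close>

lemma exterior_derivative_eq:
  assumes "open U" "x \<in> U" "defining_form A D U \<theta>"
    and W: "open W" "x \<in> W" "section_on A D W X" "section_on A D W Y"
  shows "exterior_derivative A \<theta> X Y x = - \<theta> x (lie_bracket A X Y x)"
proof -
  have *: "X x (\<lambda>q. \<theta> q (Y q)) = 0" if X: "section_on A D W X" and Y: "section_on A D W Y" for X Y
  proof (rule tangent_locally_0[of "X x" x "U \<inter> W" "\<lambda>q. \<theta> q (Y q)"])
    show "X x \<in> tangent_space A x" using X W vector_field_onD(1) unfolding section_on_def by blast
    show "\<theta> q (Y q) = 0" if "q \<in> U \<inter> W" for q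
      using that Y assms(3) unfolding section_on_def defining_form_def by blast
  qed (use assms in auto)
  show ?thesis unfolding exterior_derivative_def using *[OF W(3,4)] *[OF W(4,3)] by simp
qed

lemma sections_through2:
  assumes "u \<in> D x" "v \<in> D x"
  obtains W X Y where "open W" "x \<in> W" "section_on A D W X" "section_on A D W Y" "X x = u" "Y x = v"
proof -
  obtain U X where U: "open U" "x \<in> U" "section_on A D U X" "X x = u" by (rule section_through[OF assms(1)])
  obtain V Y where V: "open V" "x \<in> V" "section_on A D V Y" "Y x = v" by (rule section_through[OF assms(2)])
  show thesis
    by (rule that[of "U \<inter> V" X Y, OF _ _ section_on_subset[OF U(3)] section_on_subset[OF V(3)]])
      (use U V in auto)
qed

text \<open>Sections through u and v exist, so the \<open>SOME\<close> in \<open>levi_map\<close> is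
  attained by an actual pair. Which pair it is remains unknown, but the value of \<theta> on its
  bracket is determined by u and v.\<close>

lemma levi_map_eq:
  assumes "u \<in> D x" "v \<in> D x"
  obtains W X Y where "open W" "x \<in> W" "section_on A D W X" "section_on A D W Y" "X x = u" "Y x = v"
    "levi_map A D x u v = coset (D x) (lie_bracket A X Y x)"
proof -
  obtain W X Y where "open W" "x \<in> W" "section_on A D W X" "section_on A D W Y" "X x = u" "Y x = v"
    by (rule sections_through2[OF assms])
  then have "\<exists>q U X Y. open U \<and> x \<in> U \<and> section_on A D U X \<and> section_on A D U Y \<and>
      X x = u \<and> Y x = v \<and> q = coset (D x) (lie_bracket A X Y x)" by blast
  from someI_ex[OF this] obtain W X Y where "open W" "x \<in> W" "section_on A D W X" "section_on A D W Y"
    "X x = u" "Y x = v" "levi_map A D x u v = coset (D x) (lie_bracket A X Y x)"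
    unfolding levi_map_def by blast
  then show thesis by (rule that)
qed

lemma frame_exists: "\<exists>S. finite S \<and> independent S \<and> card S = DIM('e) - 1 \<and> span S = D x"
proof -
  obtain U E where "x \<in> U"
    and E: "\<And>q. q \<in> U \<Longrightarrow> inj_on (\<lambda>i. E i q) {..<DIM('e) - 1}"
    "\<And>q. q \<in> U \<Longrightarrow> independent ((\<lambda>i. E i q) ` {..<DIM('e) - 1})"
    "\<And>q. q \<in> U \<Longrightarrow> D q = span ((\<lambda>i. E i q) ` {..<DIM('e) - 1})"
    by (rule defining_form_exists[of x]) (rule that)
  note E = this(2-4)[OF this(1)]
  show ?thesis
    using card_image[OF E(1)] E(2,3) by (intro exI[of _ "(\<lambda>i. E i x) ` {..<DIM('e) - 1}"]) simp
qed

end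

section \<open>Inner product spaces as subsets of a vector space\<close>

text \<open>\<open>dim\<close> is 0 on spaces without a finite basis and would not express finite
  dimension by itself; here a finite basis of the given size is part of the notion.\<close>

definition fin_dim :: "'v::real_vector set \<Rightarrow> nat \<Rightarrow> bool"
  where "fin_dim V k \<longleftrightarrow> (\<exists>S. finite S \<and> independent S \<and> card S = k \<and> span S = V)"

lemma fin_dim_subspace: "fin_dim V k \<Longrightarrow> subspace V"
  unfolding fin_dim_def using subspace_span by blast

lemma fin_dim_independent_bound:
  assumes "fin_dim V k" "independent S" "S \<subseteq> V"
  shows "finite S \<and> card S \<le> k"
proof -
  obtain T where "finite T" "card T = k" "span T = V" using assms(1) unfolding fin_dim_def by blast
  then show ?thesis using independent_span_bound[of T S] assms by simp
qed

text \<open>If a vector of V were missed, adding it would give an independent set larger than the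
  dimension.\<close>

lemma fin_dim_independent_span:
  assumes "fin_dim V k" "independent S" "S \<subseteq> V" "card S = k"
  shows "span S = V"
proof (rule ccontr)
  assume "span S \<noteq> V"
  moreover have "span S \<subseteq> V" using span_minimal[OF assms(3) fin_dim_subspace[OF assms(1)]] .
  ultimately obtain v where v: "v \<in> V" "v \<notin> span S" by auto
  then have "independent (insert v S)" using assms(2) by (intro independent_insertI)
  then have "card (insert v S) \<le> k" using fin_dim_independent_bound[OF assms(1)] assms(3) v(1) by blast
  moreover have "finite S" using fin_dim_independent_bound[OF assms(1-3)] by blast
  moreover have "v \<notin> S" using v(2) span_base by blast
  ultimately show False using assms(4) by simp
qed

lemma fin_dim_unique:
  assumes "fin_dim V k" "fin_dim V l"
  shows "k = l"
proof -
  have "dim V = k" if "fin_dim V k" for k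
    using that dim_span_eq_card_independent unfolding fin_dim_def by blast
  from this[OF assms(1)] this[OF assms(2)] show ?thesis by simp
qed

lemma fin_dim_sub:
  assumes "fin_dim V k" "subspace W" "W \<subseteq> V"
  obtains l where "fin_dim W l"
proof -
  obtain B where B: "B \<subseteq> W" "independent B" "W \<subseteq> span B" by (rule basis_exists[of W])
  have "finite B" using fin_dim_independent_bound[OF assms(1) B(2)] B(1) assms(3) by blast
  moreover have "span B = W" using B span_minimal[OF B(1) assms(2)] by blast
  ultimately show thesis using that[of "card B"] B(2) unfolding fin_dim_def by blast
qed

lemma fin_dim_pos:
  assumes "fin_dim V k" "v \<in> V" "v \<noteq> 0"
  shows "k > 0"
proof -
  have "independent {v}" using assms(3) by simp
  from fin_dim_independent_bound[OF assms(1) this] assms(2) have "card {v} \<le> k" by blast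
  then show ?thesis by simp
qed

section \<open>Linear maps and matrices relative to a carrier\<close>

definition lin_on :: "'v::real_vector set \<Rightarrow> 'w::real_vector set \<Rightarrow> ('v \<Rightarrow> 'w) \<Rightarrow> bool"
  where "lin_on V W f \<longleftrightarrow> (\<forall>u\<in>V. f u \<in> W) \<and>
    (\<forall>u\<in>V. \<forall>v\<in>V. \<forall>a b. f (a *\<^sub>R u + b *\<^sub>R v) = a *\<^sub>R f u + b *\<^sub>R f v)"

lemma lin_onD:
  assumes "lin_on V W f"
  shows "u \<in> V \<Longrightarrow> f u \<in> W"
    and "u \<in> V \<Longrightarrow> v \<in> V \<Longrightarrow> f (a *\<^sub>R u + b *\<^sub>R v) = a *\<^sub>R f u + b *\<^sub>R f v"
    and "u \<in> V \<Longrightarrow> v \<in> V \<Longrightarrow> f (u + v) = f u + f v"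
    and "u \<in> V \<Longrightarrow> f (a *\<^sub>R u) = a *\<^sub>R f u"
proof -
  show lc: "u \<in> V \<Longrightarrow> v \<in> V \<Longrightarrow> f (a *\<^sub>R u + b *\<^sub>R v) = a *\<^sub>R f u + b *\<^sub>R f v" for u v a b
    using assms unfolding lin_on_def by blast
  show "u \<in> V \<Longrightarrow> f u \<in> W" using assms unfolding lin_on_def by blast
  show "u \<in> V \<Longrightarrow> v \<in> V \<Longrightarrow> f (u + v) = f u + f v" using lc[of u v 1 1] by simp
  show "u \<in> V \<Longrightarrow> f (a *\<^sub>R u) = a *\<^sub>R f u" using lc[of u u a 0] by simp
qed

lemma lin_on_iff_vlinear:
  assumes "subspace V"
  shows "vlinear (sub_space V) (sub_space W) f \<longleftrightarrow> lin_on V W f"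
proof
  assume "vlinear (sub_space V) (sub_space W) f"
  then have "f ` V \<subseteq> W" "\<And>u v. u \<in> V \<Longrightarrow> v \<in> V \<Longrightarrow> f (u + v) = f u + f v"
    "\<And>c u. u \<in> V \<Longrightarrow> f (c *\<^sub>R u) = c *\<^sub>R f u"
    unfolding vlinear_def sub_space_def by simp_all
  then show "lin_on V W f"
    unfolding lin_on_def image_subset_iff by (simp add: subspace_scale[OF assms])
next
  assume f: "lin_on V W f"
  show "vlinear (sub_space V) (sub_space W) f"
    unfolding vlinear_def sub_space_def image_subset_iff by (simp add: lin_onD(1,3,4)[OF f])
qed

lemma lin_on_sum:
  assumes f: "lin_on V W f" and V: "subspace V" and v: "\<And>i. i \<in> I \<Longrightarrow> v i \<in> V"
  shows "f (\<Sum>i\<in>I. c i *\<^sub>R v i) = (\<Sum>i\<in>I. c i *\<^sub>R f (v i))"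
proof -
  have 0: "f 0 = 0" using lin_onD(4)[OF f subspace_0[OF V], of 0] by simp
  show ?thesis
    using v
  proof (induction I rule: infinite_finite_induct)
    case (insert i I)
    have "(\<Sum>i\<in>I. c i *\<^sub>R v i) \<in> V" using insert.prems by (intro subspace_sum subspace_scale V) auto
    then show ?case
      using insert lin_onD(2)[OF f, of "v i" "\<Sum>i\<in>I. c i *\<^sub>R v i" "c i" 1] by simp
  qed (auto simp: 0)
qed

lemma lin_on_image_subspace:
  assumes f: "lin_on V W f" and V: "subspace V"
  shows "subspace (f ` V)"
proof (rule subspaceI)
  have "f 0 = 0" using lin_onD(4)[OF f subspace_0[OF V], of 0] by simp
  then show "0 \<in> f ` V" using subspace_0[OF V] by (intro image_eqI[of _ _ 0]) auto
next
  fix x y assume "x \<in> f ` V" "y \<in> f ` V"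
  then obtain u v where "u \<in> V" "v \<in> V" "x = f u" "y = f v" by blast
  then show "x + y \<in> f ` V" using lin_onD(3)[OF f] subspace_add[OF V] by (intro image_eqI[of _ _ "u + v"]) auto
next
  fix c x assume "x \<in> f ` V"
  then obtain u where "u \<in> V" "x = f u" by blast
  then show "c *\<^sub>R x \<in> f ` V" using lin_onD(4)[OF f] subspace_scale[OF V] by (intro image_eqI[of _ _ "c *\<^sub>R u"]) auto
qed

lemma is_basis_iff_fin_dim: "is_basis V bs \<Longrightarrow> fin_dim V (length bs)"
  unfolding is_basis_def fin_dim_def by (rule exI[of _ "set bs"]) (simp add: distinct_card)

lemma is_basis_exists:
  assumes "fin_dim V k"
  obtains bs where "is_basis V bs" "length bs = k"
proof -
  obtain S where S: "finite S" "independent S" "card S = k" "span S = V" using assms unfolding fin_dim_def by blast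
  obtain bs where bs: "set bs = S" "distinct bs" using finite_distinct_list[OF S(1)] by blast
  show thesis
  proof (rule that)
    show "is_basis V bs" using S(2,4) bs by (simp add: is_basis_def)
    show "length bs = k" using S(3) bs distinct_card[of bs] by simp
  qed
qed

lemma basis_sum_list:
  assumes "is_basis V bs"
  shows "v \<in> V \<Longrightarrow> (\<Sum>i<length bs. representation (set bs) v (bs ! i) *\<^sub>R bs ! i) = v"
    and "i < length bs \<Longrightarrow> representation (set bs) (\<Sum>j<length bs. c j *\<^sub>R bs ! j) (bs ! i) = c i"
proof -
  have bs: "distinct bs" "independent (set bs)" "span (set bs) = V" using assms unfolding is_basis_def by auto
  have bij: "bij_betw ((!) bs) {..<length bs} (set bs)" by (rule bij_betw_nth[OF bs(1)]) auto
  show "(\<Sum>i<length bs. representation (set bs) v (bs ! i) *\<^sub>R bs ! i) = v" if "v \<in> V"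
    using sum_representation_eq[OF bs(2), of v "set bs"] that bs(3)
      sum.reindex_bij_betw[OF bij, of "\<lambda>b. representation (set bs) v b *\<^sub>R b"] by simp
  assume i: "i < length bs"
  have "representation (set bs) (\<Sum>j<length bs. c j *\<^sub>R bs ! j) (bs ! i) =
      (\<Sum>j<length bs. representation (set bs) (c j *\<^sub>R bs ! j) (bs ! i))"
    by (subst representation_sum[OF bs(2)]) (auto intro: span_scale[OF span_base])
  also have "\<dots> = (\<Sum>j<length bs. if j = i then c j else 0)"
    by (intro sum.cong)
      (use i nth_eq_iff_index_eq[OF bs(1)] in
        \<open>auto simp: representation_scale[OF bs(2) span_base] representation_basis[OF bs(2)]\<close>)
  finally show "representation (set bs) (\<Sum>j<length bs. c j *\<^sub>R bs ! j) (bs ! i) = c i"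
    using i by simp
qed

lemma matrix_in_basis_apply:
  assumes bs: "is_basis V bs" and J: "lin_on V V J"
  shows "J (\<Sum>j<length bs. c j *\<^sub>R bs ! j) =
    (\<Sum>i<length bs. (\<Sum>j<length bs. matrix_in_basis bs J $$ (i, j) * c j) *\<^sub>R bs ! i)"
proof -
  have V: "subspace V" "\<And>i. i < length bs \<Longrightarrow> bs ! i \<in> V"
    using bs span_base[of _ "set bs"] nth_mem[of _ bs] unfolding is_basis_def by blast+
  have "J (\<Sum>j<length bs. c j *\<^sub>R bs ! j) = (\<Sum>j<length bs. c j *\<^sub>R J (bs ! j))"
    by (rule lin_on_sum[OF J V(1)]) (use V(2) in auto)
  also have "\<dots> = (\<Sum>j<length bs. c j *\<^sub>R (\<Sum>i<length bs. matrix_in_basis bs J $$ (i, j) *\<^sub>R bs ! i))"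
  proof (intro sum.cong refl, goal_cases)
    case (1 j)
    then have "J (bs ! j) = (\<Sum>i<length bs. matrix_in_basis bs J $$ (i, j) *\<^sub>R bs ! i)"
      using basis_sum_list(1)[OF bs lin_onD(1)[OF J V(2)[of j]]] by (simp add: matrix_in_basis_def)
    then show ?case by simp
  qed
  also have "\<dots> = (\<Sum>i<length bs. (\<Sum>j<length bs. matrix_in_basis bs J $$ (i, j) * c j) *\<^sub>R bs ! i)"
    unfolding scaleR_sum_right scaleR_sum_left by (subst sum.swap) (simp add: mult.commute)
  finally show ?thesis .
qed

(* The real and imaginary parts of a complex eigenvector. *)
lemma real_eigenpair_exists:
  assumes V: "fin_dim V k" "k > 0" and J: "lin_on V V J"
  obtains a b \<mu> \<nu> where "a \<in> V" "b \<in> V" "a \<noteq> 0 \<or> b \<noteq> 0"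
    "J a = \<mu> *\<^sub>R a - \<nu> *\<^sub>R b" "J b = \<nu> *\<^sub>R a + \<mu> *\<^sub>R b"
proof -
  obtain bs where bs: "is_basis V bs" "length bs = k" using is_basis_exists[OF V(1)] .
  let ?R = "matrix_in_basis bs J" and ?M = "map_mat complex_of_real (matrix_in_basis bs J)"
  have M: "?M \<in> carrier_mat k k" by (simp add: matrix_in_basis_def bs(2))
  have "degree (char_poly ?M) = k" using degree_monic_char_poly[OF M] by simp
  then obtain l where "poly (char_poly ?M) l = 0"
    using fundamental_theorem_of_algebra[of "char_poly ?M"] V(2) by (auto simp: constant_degree)
  then have "eigenvalue ?M l" using eigenvalue_root_char_poly[OF M] by simp
  then obtain w where w: "w \<in> carrier_vec k" "w \<noteq> 0\<^sub>v k" "?M *\<^sub>v w = l \<cdot>\<^sub>v w"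
    unfolding eigenvalue_def eigenvector_def using M by auto
  define a where "a = (\<Sum>i<length bs. Re (w $ i) *\<^sub>R bs ! i)"
  define b where "b = (\<Sum>i<length bs. Im (w $ i) *\<^sub>R bs ! i)"
  have row: "(\<Sum>j<k. complex_of_real (?R $$ (i, j)) * w $ j) = l * w $ i" if "i < k" for i
  proof -
    have "(?M *\<^sub>v w) $ i = (\<Sum>j<k. complex_of_real (?R $$ (i, j)) * w $ j)"
      using that w(1) M by (auto simp: scalar_prod_def atLeast0LessThan matrix_in_basis_def bs(2) intro!: sum.cong)
    then show ?thesis using w(1) that unfolding w(3) by simp
  qed
  \<comment> \<open>With \<mu> = Re l and \<nu> = Im l these are the two components of J (a + i b) =
    (\<mu> + i \<nu>) (a + i b); they separate because the matrix of J is real.\<close>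
  have Re: "(\<Sum>j<k. ?R $$ (i, j) * Re (w $ j)) = Re l * Re (w $ i) - Im l * Im (w $ i)"
    and Im: "(\<Sum>j<k. ?R $$ (i, j) * Im (w $ j)) = Im l * Re (w $ i) + Re l * Im (w $ i)" if "i < k" for i
    using arg_cong[OF row[OF that], of Re] arg_cong[OF row[OF that], of Im] by auto
  have Ja: "J a = Re l *\<^sub>R a - Im l *\<^sub>R b"
    unfolding a_def b_def matrix_in_basis_apply[OF bs(1) J]
    by (simp add: bs(2) Re scaleR_sum_right sum_subtractf scaleR_left_diff_distrib)
  have Jb: "J b = Im l *\<^sub>R a + Re l *\<^sub>R b"
    unfolding a_def b_def matrix_in_basis_apply[OF bs(1) J]
    by (simp add: bs(2) Im scaleR_sum_right sum.distrib scaleR_left_distrib)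
  have "a \<in> V" "b \<in> V"
    using bs(1) unfolding a_def b_def is_basis_def
    by (auto intro!: subspace_sum subspace_scale intro: span_base)
  moreover have "a \<noteq> 0 \<or> b \<noteq> 0"
  proof (rule ccontr)
    assume "\<not> (a \<noteq> 0 \<or> b \<noteq> 0)"
    then have "Re (w $ i) = 0" "Im (w $ i) = 0" if "i < k" for i
      using basis_sum_list(2)[OF bs(1), of i "\<lambda>i. Re (w $ i)"] basis_sum_list(2)[OF bs(1), of i "\<lambda>i. Im (w $ i)"] that
      unfolding a_def[symmetric] b_def[symmetric] by (auto simp: bs(2) representation_zero)
    then have "w = 0\<^sub>v k" using w(1) by (intro eq_vecI) (auto simp: complex_eq_iff)
    then show False using w(2) by blast
  qed
  ultimately show thesis using that Ja Jb by blast
qed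

section \<open>Inner products on a carrier and invariant planes\<close>

locale inner_subspace =
  fixes V :: "'v::real_vector set" and g :: "'v \<Rightarrow> 'v \<Rightarrow> real"
  assumes subspace: "subspace V"
    and sym: "u \<in> V \<Longrightarrow> v \<in> V \<Longrightarrow> g u v = g v u"
    and lin: "u \<in> V \<Longrightarrow> v \<in> V \<Longrightarrow> w \<in> V \<Longrightarrow> g (a *\<^sub>R u + b *\<^sub>R v) w = a * g u w + b * g v w"
    and pos: "u \<in> V \<Longrightarrow> u \<noteq> 0 \<Longrightarrow> g u u > 0"
begin

lemma in_V [simp]: "0 \<in> V" "u \<in> V \<Longrightarrow> v \<in> V \<Longrightarrow> u + v \<in> V" "u \<in> V \<Longrightarrow> v \<in> V \<Longrightarrow> u - v \<in> V"
  "u \<in> V \<Longrightarrow> a *\<^sub>R u \<in> V" "u \<in> V \<Longrightarrow> - u \<in> V"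
  by (simp_all add: subspace_0[OF subspace] subspace_add[OF subspace] subspace_diff[OF subspace]
      subspace_scale[OF subspace] subspace_neg[OF subspace])

lemma g_left [simp]:
  "u \<in> V \<Longrightarrow> v \<in> V \<Longrightarrow> w \<in> V \<Longrightarrow> g (u + v) w = g u w + g v w"
  "u \<in> V \<Longrightarrow> v \<in> V \<Longrightarrow> w \<in> V \<Longrightarrow> g (u - v) w = g u w - g v w"
  "u \<in> V \<Longrightarrow> w \<in> V \<Longrightarrow> g (a *\<^sub>R u) w = a * g u w"
  "u \<in> V \<Longrightarrow> w \<in> V \<Longrightarrow> g (- u) w = - g u w"
  "w \<in> V \<Longrightarrow> g 0 w = 0"
  using lin[of u v w 1 1] lin[of u v w 1 "-1"] lin[of u u w a 0] lin[of u u w "-1" 0] lin[of 0 0 w 0 0]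
  by simp_all

lemma g_right [simp]:
  "u \<in> V \<Longrightarrow> v \<in> V \<Longrightarrow> w \<in> V \<Longrightarrow> g w (u + v) = g w u + g w v"
  "u \<in> V \<Longrightarrow> v \<in> V \<Longrightarrow> w \<in> V \<Longrightarrow> g w (u - v) = g w u - g w v"
  "u \<in> V \<Longrightarrow> w \<in> V \<Longrightarrow> g w (a *\<^sub>R u) = a * g w u"
  "u \<in> V \<Longrightarrow> w \<in> V \<Longrightarrow> g w (- u) = - g w u"
  "w \<in> V \<Longrightarrow> g w 0 = 0"
  using sym[of w "u + v"] sym[of w "u - v"] sym[of w "a *\<^sub>R u"] sym[of w "- u"] sym[of w 0] sym[of w u] sym[of w v]
  by simp_all

lemma g_sum_left:
  "(\<And>i. i \<in> I \<Longrightarrow> v i \<in> V) \<Longrightarrow> w \<in> V \<Longrightarrow> g (\<Sum>i\<in>I. c i *\<^sub>R v i) w = (\<Sum>i\<in>I. c i * g (v i) w)"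
proof (induction I rule: infinite_finite_induct)
  case (insert i I)
  have "(\<Sum>i\<in>I. c i *\<^sub>R v i) \<in> V" using insert.prems by (intro subspace_sum[OF subspace]) auto
  then show ?case using insert by simp
qed auto

lemma eq_0_iff: "u \<in> V \<Longrightarrow> g u u = 0 \<longleftrightarrow> u = 0"
  using pos[of u] by (cases "u = 0") auto

lemma nondegenerate: "u \<in> V \<Longrightarrow> u' \<in> V \<Longrightarrow> (\<And>v. v \<in> V \<Longrightarrow> g u v = g u' v) \<Longrightarrow> u = u'"
  using eq_0_iff[of "u - u'"] in_V(3)[of u u'] g_left(2)[of u u' "u - u'"] by simp

definition orthonormal :: "'v set \<Rightarrow> bool"
  where "orthonormal S \<longleftrightarrow> S \<subseteq> V \<and> (\<forall>u\<in>S. \<forall>v\<in>S. g u v = (if u = v then 1 else 0))"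

lemma orthonormal_independent:
  assumes "orthonormal S" "finite S"
  shows "independent S"
proof (rule independent_if_scalars_zero[OF assms(2)])
  fix c b assume 0: "(\<Sum>x\<in>S. c x *\<^sub>R x) = 0" and b: "b \<in> S"
  have "0 = g (\<Sum>x\<in>S. c x *\<^sub>R x) b" unfolding 0 using assms(1) b by (auto simp: orthonormal_def)
  also have "\<dots> = (\<Sum>x\<in>S. c x * g x b)" using assms(1) b by (intro g_sum_left) (auto simp: orthonormal_def)
  also have "\<dots> = (\<Sum>x\<in>S. if x = b then c x else 0)"
    using assms(1) b by (intro sum.cong) (auto simp: orthonormal_def)
  also have "\<dots> = c b" using assms(2) b by simp
  finally show "c b = 0" by simp
qed

lemma orthonormal_expansion:
  assumes "orthonormal S" "finite S" "v \<in> span S"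
  shows "v = (\<Sum>b\<in>S. g v b *\<^sub>R b)"
proof -
  obtain c where c: "v = (\<Sum>x\<in>S. c x *\<^sub>R x)" using assms(3) unfolding span_finite[OF assms(2)] by auto
  have "g v b = c b" if b: "b \<in> S" for b
  proof -
    have "g v b = (\<Sum>x\<in>S. c x * g x b)" unfolding c using assms(1) b by (intro g_sum_left) (auto simp: orthonormal_def)
    also have "\<dots> = (\<Sum>x\<in>S. if x = b then c x else 0)"
      using assms(1) b by (intro sum.cong) (auto simp: orthonormal_def)
    also have "\<dots> = c b" using assms(2) b by simp
    finally show ?thesis .
  qed
  then have "(\<Sum>b\<in>S. g v b *\<^sub>R b) = (\<Sum>x\<in>S. c x *\<^sub>R x)" by (intro sum.cong) auto
  then show ?thesis using c by simp
qed

text \<open>Subtracting \<open>g v e *\<^sub>R e\<close> projects v onto the complement, so a basis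
  of W together with e is a basis of V. Uniqueness of the dimension then gives that of W.\<close>

lemma orthogonal_complement:
  assumes V: "fin_dim V (Suc k)" and e: "e \<in> V" "g e e = 1"
  defines "W \<equiv> {v \<in> V. g v e = 0}"
  shows "fin_dim W k" "inner_subspace W g"
proof -
  have W: "subspace W"
    by (rule subspaceI) (auto simp: W_def e)
  then show "inner_subspace W g"
    by unfold_locales (auto simp: W_def lin pos intro: sym)
  obtain l where l: "fin_dim W l" using fin_dim_sub[OF V W] unfolding W_def by blast
  then obtain S where S: "finite S" "independent S" "card S = l" "span S = W" unfolding fin_dim_def by blast
  have SW: "S \<subseteq> W" using S(4) span_base by blast
  have eW: "e \<notin> span S" using e(2) unfolding S(4) W_def by simp
  then have "independent (insert e S)" using S(2) by (rule independent_insertI)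
  moreover have "span (insert e S) = V"
  proof
    show "span (insert e S) \<subseteq> V" using SW e(1) subspace unfolding W_def by (intro span_minimal) auto
    show "V \<subseteq> span (insert e S)"
    proof
      fix v assume v: "v \<in> V"
      have "v - g v e *\<^sub>R e \<in> span S" using v e unfolding S(4) W_def by simp
      then show "v \<in> span (insert e S)" unfolding span_insert by blast
    qed
  qed
  moreover have "e \<notin> S" using eW span_base by blast
  ultimately have "fin_dim V (Suc l)" unfolding fin_dim_def using S by (intro exI[of _ "insert e S"]) auto
  then have "l = k" using fin_dim_unique[OF V] by auto
  then show "fin_dim W k" using l by simp
qed

lemma unit_vector_exists:
  assumes "fin_dim V (Suc k)"
  obtains e where "e \<in> V" "g e e = 1"
proof -
  obtain S where S: "independent S" "card S = Suc k" "span S = V" using assms unfolding fin_dim_def by blast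
  then have "S \<noteq> {}" by auto
  then obtain v where v: "v \<in> S" by blast
  have "v \<in> V" using v S(3) span_base by blast
  moreover have "v \<noteq> 0" using v S(1) dependent_zero by blast
  ultimately have "v \<in> V" "g v v > 0" using pos by auto
  then show thesis using that[of "(1 / sqrt (g v v)) *\<^sub>R v"] by (simp add: field_simps flip: real_sqrt_mult)
qed

text \<open>If J = 0, any orthonormal pair will do. Otherwise the real and imaginary parts a, b of a
  complex eigenvector span the plane: skewness makes the eigenvalue purely imaginary, a and b
  orthogonal, and their lengths equal.\<close>

lemma skew_plane_exists:
  assumes V: "fin_dim V (Suc (Suc k))" and J: "lin_on V V J"
    and skew: "\<And>u v. u \<in> V \<Longrightarrow> v \<in> V \<Longrightarrow> g (J u) v = - g u (J v)"
  obtains a e f where "e \<in> V" "f \<in> V" "0 \<le> a" "g e e = 1" "g f f = 1" "g e f = 0"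
    "J e = a *\<^sub>R f" "J f = - (a *\<^sub>R e)"
proof (cases "\<forall>v\<in>V. J v = 0")
  case True
  obtain e where e: "e \<in> V" "g e e = 1" using unit_vector_exists[OF V] .
  interpret W: inner_subspace "{v \<in> V. g v e = 0}" g using orthogonal_complement[OF V e] by simp
  obtain f where f: "f \<in> {v \<in> V. g v e = 0}" "g f f = 1"
    using W.unit_vector_exists[OF orthogonal_complement(1)[OF V e]] .
  then show thesis using that[of e f 0] e True sym[of e f] by auto
next
  case False
  \<comment> \<open>The eigenvector is sought in the image of J because J is injective there, which
    rules out the eigenvalue 0.\<close>
  let ?W = "J ` V"
  have JV: "J v \<in> V" if "v \<in> V" for v using lin_onD(1)[OF J that] .
  have W: "subspace ?W" "?W \<subseteq> V" using lin_on_image_subspace[OF J subspace] JV by auto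
  obtain l where l: "fin_dim ?W l" using fin_dim_sub[OF V W] .
  have "l > 0" using False fin_dim_pos[OF l] by blast
  moreover have "lin_on ?W ?W J" using J W(2) unfolding lin_on_def by blast
  ultimately obtain a b \<mu> \<nu> where ab: "a \<in> ?W" "b \<in> ?W" "a \<noteq> 0 \<or> b \<noteq> 0"
    "J a = \<mu> *\<^sub>R a - \<nu> *\<^sub>R b" "J b = \<nu> *\<^sub>R a + \<mu> *\<^sub>R b"
    using real_eigenpair_exists[OF l] by metis
  have in_V: "a \<in> V" "b \<in> V" using ab W by auto
  have self: "g (J v) v = 0" if "v \<in> V" for v
    using skew[OF that that] sym[OF that JV[OF that]] by simp
  have 1: "\<mu> * g a a - \<nu> * g a b = 0" using self[OF in_V(1)] in_V sym[of a b] unfolding ab(4) by simp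
  have 2: "\<nu> * g a b + \<mu> * g b b = 0" using self[OF in_V(2)] in_V sym[of a b] unfolding ab(5) by simp
  have nonneg: "g a a \<ge> 0" "g b b \<ge> 0" using pos[OF in_V(1)] pos[OF in_V(2)] by (cases "a = 0"; cases "b = 0"; force)+
  have "g a a + g b b > 0" using ab(3) pos[OF in_V(1)] pos[OF in_V(2)] nonneg by (cases "a = 0") auto
  \<comment> \<open>Adding the two relations cancels the mixed term and isolates the real part of
    the eigenvalue.\<close>
  moreover have "\<mu> * (g a a + g b b) = 0" using 1 2 by (simp add: algebra_simps)
  ultimately have \<mu>: "\<mu> = 0" by simp
  \<comment> \<open>Kernel and image of a skew operator are orthogonal, so they meet in 0
    only.\<close>
  have inj: "v = 0" if v: "v \<in> ?W" "J v = 0" for v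
  proof -
    obtain u where u: "u \<in> V" "v = J u" using v(1) by blast
    have "g v v = - g u (J v)" using skew[OF u(1) JV[OF u(1)]] u(2) by simp
    then have "g v v = 0" using v u by simp
    then show ?thesis using eq_0_iff JV u by blast
  qed
  have \<nu>: "\<nu> \<noteq> 0"
    using ab inj[OF ab(1)] inj[OF ab(2)] \<mu> by auto
  have gab: "g a b = 0" using 1 \<mu> \<nu> by simp
  have "g (J a) b = - g a (J b)" using skew in_V .
  then have "\<nu> * g b b = \<nu> * g a a" unfolding ab(4,5) using in_V \<mu> by simp
  then have eq: "g b b = g a a" using \<nu> by simp
  then have n: "g a a > 0" using \<open>g a a + g b b > 0\<close> by simp
  define r where "r = 1 / sqrt (g a a)"
  have r: "r * (r * g a a) = 1" using n by (simp add: r_def field_simps flip: real_sqrt_mult)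
  \<comment> \<open>Here J a = - \<nu> b; the sign of \<nu> is absorbed into the second vector, so
    that the coefficient of the plane is the absolute value of \<nu> and hence nonnegative.\<close>
  let ?e = "r *\<^sub>R a" and ?f = "(- sgn \<nu> * r) *\<^sub>R b"
  have s: "sgn \<nu> * sgn \<nu> = 1" "\<bar>\<nu>\<bar> * sgn \<nu> = \<nu>" "sgn \<nu> * \<nu> = \<bar>\<nu>\<bar>" using \<nu> by (auto simp: sgn_if)
  show thesis
  proof (rule that[of ?e ?f "\<bar>\<nu>\<bar>"])
    show "g ?e ?e = 1" using in_V r by simp
    have "g ?f ?f = (sgn \<nu> * sgn \<nu>) * (r * (r * g a a))" using in_V eq by simp
    then show "g ?f ?f = 1" using r s by simp
    show "g ?e ?f = 0" using in_V gab by simp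
    have "J ?e = r *\<^sub>R (- (\<nu> *\<^sub>R b))" using lin_onD(4)[OF J in_V(1)] ab(4) \<mu> by simp
    also have "\<dots> = (- (r * (\<bar>\<nu>\<bar> * sgn \<nu>))) *\<^sub>R b" unfolding s(2) by simp
    also have "\<dots> = \<bar>\<nu>\<bar> *\<^sub>R ?f" by (simp add: mult_ac)
    finally show "J ?e = \<bar>\<nu>\<bar> *\<^sub>R ?f" .
    have "J ?f = (- sgn \<nu> * r) *\<^sub>R (\<nu> *\<^sub>R a)" using lin_onD(4)[OF J in_V(2), of "- sgn \<nu> * r"] ab(5) \<mu> by simp
    also have "\<dots> = (- (r * (sgn \<nu> * \<nu>))) *\<^sub>R a" by (simp add: mult_ac)
    also have "\<dots> = - (\<bar>\<nu>\<bar> *\<^sub>R ?e)" unfolding s(3) by (simp add: mult_ac)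
    finally show "J ?f = - (\<bar>\<nu>\<bar> *\<^sub>R ?e)" .
  qed (use in_V in auto)
qed

end

section \<open>Eigenvalues of skew operators\<close>

text \<open>The two matrices are similar through the base change matrix, whose columns are the
  vectors of bs' in the basis bs. This removes the choice of a basis from
  \<open>eigenvalues\<close>.\<close>

lemma char_poly_basis_change:
  assumes bs: "is_basis V bs" and bs': "is_basis V bs'" and J: "lin_on V V J"
  shows "char_poly (matrix_in_basis bs J) = char_poly (matrix_in_basis bs' J)"
proof (rule char_poly_similar, rule similar_matI)
  define k where "k = length bs"
  have k: "length bs = k" "length bs' = k"
    using fin_dim_unique[OF is_basis_iff_fin_dim[OF bs] is_basis_iff_fin_dim[OF bs']] by (simp_all add: k_def)
  have V: "subspace V" using fin_dim_subspace is_basis_iff_fin_dim[OF bs] by blast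
  have in_V: "bs ! i \<in> V" "bs' ! i \<in> V" if "i < k" for i
    using that bs bs' k span_base[of "bs ! i" "set bs"] span_base[of "bs' ! i" "set bs'"] by (simp_all add: is_basis_def)
  let ?M = "matrix_in_basis bs J" and ?M' = "matrix_in_basis bs' J"
  let ?P = "Matrix.mat k k (\<lambda>(i, j). representation (set bs) (bs' ! j) (bs ! i))"
  let ?Q = "Matrix.mat k k (\<lambda>(i, j). representation (set bs') (bs ! j) (bs' ! i))"
  have carr: "?M \<in> carrier_mat k k" "?M' \<in> carrier_mat k k" "?P \<in> carrier_mat k k" "?Q \<in> carrier_mat k k"
    by (auto simp: matrix_in_basis_def k)
  then show "{?M, ?M', ?P, ?Q} \<subseteq> carrier_mat k k" by simp
  have mult: "(A * B) $$ (i, j) = (\<Sum>l<k. A $$ (i, l) * B $$ (l, j))"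
    if "A \<in> carrier_mat k k" "B \<in> carrier_mat k k" "i < k" "j < k" for A B :: "real mat" and i j
    using that by (auto simp: scalar_prod_def atLeast0LessThan intro!: sum.cong)
  have P: "(\<Sum>l<k. c l *\<^sub>R bs' ! l) = (\<Sum>i<k. (\<Sum>l<k. ?P $$ (i, l) * c l) *\<^sub>R bs ! i)" for c
  proof -
    have "(\<Sum>l<k. c l *\<^sub>R bs' ! l) = (\<Sum>l<k. c l *\<^sub>R (\<Sum>i<k. ?P $$ (i, l) *\<^sub>R bs ! i))"
      using basis_sum_list(1)[OF bs in_V(2)] by (intro sum.cong) (auto simp: k)
    also have "\<dots> = (\<Sum>i<k. (\<Sum>l<k. ?P $$ (i, l) * c l) *\<^sub>R bs ! i)"
      unfolding scaleR_sum_right scaleR_sum_left by (subst sum.swap) (simp add: mult.commute)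
    finally show ?thesis .
  qed
  have coeff: "c i = d i" if "(\<Sum>l<k. c l *\<^sub>R bs ! l) = (\<Sum>l<k. d l *\<^sub>R bs ! l)" "i < k" for c d i
    using basis_sum_list(2)[OF bs, of i c] basis_sum_list(2)[OF bs, of i d] that by (simp add: k)
  show PQ: "?P * ?Q = 1\<^sub>m k"
  proof (rule eq_matI)
    fix i j assume "i < dim_row (1\<^sub>m k)" "j < dim_col (1\<^sub>m k)"
    then have ij: "i < k" "j < k" by auto
    have "(\<Sum>i<k. (if i = j then 1 else 0) *\<^sub>R bs ! i) = bs ! j"
      using ij by (simp add: if_distrib[of "\<lambda>c. c *\<^sub>R _"] cong: if_cong)
    also have "\<dots> = (\<Sum>l<k. ?Q $$ (l, j) *\<^sub>R bs' ! l)"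
      using basis_sum_list(1)[OF bs' in_V(1)[OF ij(2)]] ij by (simp add: k)
    also have "\<dots> = (\<Sum>i<k. (\<Sum>l<k. ?P $$ (i, l) * ?Q $$ (l, j)) *\<^sub>R bs ! i)" by (rule P)
    finally have "(if i = j then 1 else 0) = (\<Sum>l<k. ?P $$ (i, l) * ?Q $$ (l, j))"
      by (rule coeff[OF _ ij(1), of "\<lambda>i. if i = j then 1 else 0"])
    then show "(?P * ?Q) $$ (i, j) = 1\<^sub>m k $$ (i, j)" using mult[OF carr(3,4) ij] ij by simp
  qed auto
  show "?Q * ?P = 1\<^sub>m k" by (rule mat_mult_left_right_inverse[OF carr(3,4) PQ])
  have MP: "?M * ?P = ?P * ?M'"
  proof (rule eq_matI)
    fix i j assume "i < dim_row (?P * ?M')" "j < dim_col (?P * ?M')"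
    then have ij: "i < k" "j < k" using carr by auto
    have "(\<Sum>i<k. (\<Sum>l<k. ?M $$ (i, l) * ?P $$ (l, j)) *\<^sub>R bs ! i) = J (\<Sum>l<k. ?P $$ (l, j) *\<^sub>R bs ! l)"
      using matrix_in_basis_apply[OF bs J, of "\<lambda>l. ?P $$ (l, j)"] unfolding k by simp
    also have "(\<Sum>l<k. ?P $$ (l, j) *\<^sub>R bs ! l) = bs' ! j"
      using basis_sum_list(1)[OF bs in_V(2)[OF ij(2)]] ij by (simp add: k)
    also have "J (bs' ! j) = (\<Sum>l<k. ?M' $$ (l, j) *\<^sub>R bs' ! l)"
      using basis_sum_list(1)[OF bs' lin_onD(1)[OF J in_V(2)[OF ij(2)]]] ij by (simp add: k matrix_in_basis_def)
    also have "\<dots> = (\<Sum>i<k. (\<Sum>l<k. ?P $$ (i, l) * ?M' $$ (l, j)) *\<^sub>R bs ! i)" by (rule P)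
    finally have "(\<Sum>l<k. ?M $$ (i, l) * ?P $$ (l, j)) = (\<Sum>l<k. ?P $$ (i, l) * ?M' $$ (l, j))"
      by (rule coeff[OF _ ij(1), of "\<lambda>i. \<Sum>l<k. ?M $$ (i, l) * ?P $$ (l, j)"])
    then show "(?M * ?P) $$ (i, j) = (?P * ?M') $$ (i, j)"
      using mult[OF carr(1,3) ij] mult[OF carr(3,2) ij] by simp
  qed (use carr in auto)
  have "?M = ?M * (?P * ?Q)" unfolding PQ using carr(1) by simp
  also have "\<dots> = ?P * ?M' * ?Q" unfolding assoc_mult_mat[OF carr(1,3,4), symmetric] MP ..
  finally show "?M = ?P * ?M' * ?Q" .
qed

text \<open>Complexification commutes with \<open>char_poly\<close>, so the basis independence of
  the real characteristic polynomial carries over.\<close>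

lemma eigenvalues_eq:
  assumes bs: "is_basis V bs" and J: "lin_on V V J"
  shows "eigenvalues V J = proots (char_poly (map_mat complex_of_real (matrix_in_basis bs J)))"
proof -
  let ?b = "SOME bs. is_basis V bs"
  have b: "is_basis V ?b" using bs by (rule someI)
  have hom: "char_poly (map_mat complex_of_real (matrix_in_basis bs J)) =
      map_poly complex_of_real (char_poly (matrix_in_basis bs J))" for bs
    by (rule of_real_hom.char_poly_hom[of _ "length bs"]) (simp add: matrix_in_basis_def)
  show ?thesis unfolding eigenvalues_def hom char_poly_basis_change[OF b bs J] ..
qed

text \<open>All first vectors precede all second vectors. In this order the matrix of J consists of
  four diagonal blocks and a zero block, whose determinant is accessible at once.\<close>

definition frame_list :: "(real \<times> 'v \<times> 'v) list \<Rightarrow> 'v list \<Rightarrow> 'v list"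
  where "frame_list ts hs = map (fst \<circ> snd) ts @ map (snd \<circ> snd) ts @ hs"

(* An orthonormal basis in which J is block diagonal, with a block ((0, -a), (a, 0)) in the plane
   of e and f for each (a, e, f) in ts, and with the kernel vectors hs. *)
definition skew_frame :: "'v::real_vector set \<Rightarrow> ('v \<Rightarrow> 'v \<Rightarrow> real) \<Rightarrow> ('v \<Rightarrow> 'v) \<Rightarrow>
    (real \<times> 'v \<times> 'v) list \<Rightarrow> 'v list \<Rightarrow> bool"
  where "skew_frame V g J ts hs \<longleftrightarrow> distinct (frame_list ts hs) \<and> set (frame_list ts hs) \<subseteq> V \<and>
    (\<forall>u\<in>set (frame_list ts hs). \<forall>v\<in>set (frame_list ts hs). g u v = (if u = v then 1 else 0)) \<and>
    (\<forall>(a, e, f)\<in>set ts. 0 \<le> a \<and> J e = a *\<^sub>R f \<and> J f = - (a *\<^sub>R e)) \<and>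
    (\<forall>h\<in>set hs. J h = 0)"

lemma length_frame_list [simp]: "length (frame_list ts hs) = 2 * length ts + length hs"
  by (simp add: frame_list_def)

lemma det_diagonal_mat:
  "Determinant.det (Matrix.mat n n (\<lambda>(i, j). if i = j then d i else (0 :: 'a :: idom))) = (\<Prod>i<n. d i)"
proof -
  let ?A = "Matrix.mat n n (\<lambda>(i, j). if i = j then d i else 0)"
  have "Determinant.det ?A = prod_list (diag_mat ?A)"
    by (rule det_upper_triangular[of _ n]) auto
  also have "diag_mat ?A = map d [0..<n]" by (auto simp: diag_mat_def intro!: map_cong)
  also have "prod_list (map d [0..<n]) = (\<Prod>i<n. d i)"
    by (simp add: prod.list_conv_set_nth atLeast0LessThan)
  finally show ?thesis .
qed

text \<open>In x I - N the diagonal blocks are x, the off-diagonal ones \<alpha> and - \<alpha>,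
  followed by a block x of size r. The four n by n blocks are diagonal and commute, so they
  contribute the determinant of x^2 + \<alpha>^2, which factors into x - i \<alpha> and x + i
  \<alpha>.\<close>

lemma char_poly_skew_blocks:
  fixes \<alpha> :: "nat \<Rightarrow> complex"
  shows "char_poly (Matrix.mat (2 * n + r) (2 * n + r) (\<lambda>(i, j).
      if j < n \<and> i = n + j then \<alpha> j else if n \<le> j \<and> j < 2 * n \<and> i = j - n then - \<alpha> (j - n) else 0)) =
    (\<Prod>i<n. [:- \<i> * \<alpha> i, 1:] * [:\<i> * \<alpha> i, 1:]) * [:0, 1:] ^ r"
    (is "char_poly ?N = _")
proof -
  let ?X = "Matrix.mat n n (\<lambda>(i, j). if i = j then [:0, 1:] else (0 :: complex poly))"
  let ?B = "Matrix.mat n n (\<lambda>(i, j). if i = j then [:\<alpha> i:] else (0 :: complex poly))"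
  let ?C = "Matrix.mat n n (\<lambda>(i, j). if i = j then [:- \<alpha> i:] else (0 :: complex poly))"
  let ?Y = "Matrix.mat r r (\<lambda>(i, j). if i = j then [:0, 1:] else (0 :: complex poly))"
  let ?K = "four_block_mat ?X ?B ?C ?X"
  have N: "char_poly_matrix ?N = four_block_mat ?K (0\<^sub>m (2 * n) r) (0\<^sub>m r (2 * n)) ?Y"
    unfolding char_poly_matrix_def
  proof (rule eq_matI, goal_cases)
    case (1 i j)
    then have ij: "i < 2 * n + r" "j < 2 * n + r" by auto
    have L: "([:0, 1:] \<cdot>\<^sub>m 1\<^sub>m (dim_row ?N) + map_mat (\<lambda>a. [:- a:]) ?N) $$ (i, j) =
        (if i = j then [:0, 1:] else 0) + [:- (if j < n \<and> i = n + j then \<alpha> j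
          else if n \<le> j \<and> j < 2 * n \<and> i = j - n then - \<alpha> (j - n) else 0):]"
      using ij by simp
    have R: "four_block_mat ?K (0\<^sub>m (2 * n) r) (0\<^sub>m r (2 * n)) ?Y $$ (i, j) =
        (if i < 2 * n then if j < 2 * n then ?K $$ (i, j) else 0
         else if j < 2 * n then 0 else if i = j then [:0, 1:] else 0)"
      using ij by (simp add: mult_2) arith
    have K: "?K $$ (i, j) = (if i < n then if j < n then if i = j then [:0, 1:] else 0 else if i = j - n then [:\<alpha> i:] else 0
        else if j < n then if i - n = j then [:- \<alpha> j:] else 0 else if i = j then [:0, 1:] else 0)"
      if "i < 2 * n" "j < 2 * n"
      using that by auto
    show ?case
      unfolding L R
      by (cases "i < n"; cases "j < n"; cases "i < 2 * n"; cases "j < 2 * n") (use ij in \<open>auto simp: K\<close>)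
  qed auto
  have prod: "Matrix.mat n n (\<lambda>(i, j). if i = j then a i else 0) * Matrix.mat n n (\<lambda>(i, j). if i = j then b i else 0) =
      Matrix.mat n n (\<lambda>(i, j). if i = j then a i * b i else (0 :: complex poly))" for a b
  proof (rule eq_matI, goal_cases)
    case (1 i j)
    let ?A = "Matrix.mat n n (\<lambda>(i, j). if i = j then a i else 0)" and ?B = "Matrix.mat n n (\<lambda>(i, j). if i = j then b i else 0)"
    have ij: "i < n" "j < n" using 1 by auto
    then have "(?A * ?B) $$ (i, j) = (\<Sum>l<n. ?A $$ (i, l) * ?B $$ (l, j))"
      by (simp add: scalar_prod_def atLeast0LessThan)
    also have "\<dots> = (\<Sum>l<n. if l = i then (if i = j then a i * b i else 0) else 0)"
      using ij by (intro sum.cong refl) simp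
    also have "\<dots> = (if i = j then a i * b i else 0)" using ij by simp
    finally show ?case using ij by simp
  qed auto
  have "Determinant.det ?K = Determinant.det (?X * ?X - ?B * ?C)"
    by (rule det_four_block_mat[where n = n]) (auto simp: prod mult.commute)
  also have "?X * ?X - ?B * ?C = Matrix.mat n n (\<lambda>(i, j). if i = j then [:- \<i> * \<alpha> i, 1:] * [:\<i> * \<alpha> i, 1:] else 0)"
    unfolding prod by (rule eq_matI) (auto simp: algebra_simps)
  finally have K: "Determinant.det ?K = (\<Prod>i<n. [:- \<i> * \<alpha> i, 1:] * [:\<i> * \<alpha> i, 1:])"
    unfolding det_diagonal_mat .
  have "char_poly ?N = Determinant.det ?K * Determinant.det ?Y"
    unfolding char_poly_def N by (rule det_four_block_mat_lower_left_zero[where n = "2 * n" and m = r]) auto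
  then show ?thesis unfolding K det_diagonal_mat by simp
qed

context inner_subspace
begin

lemma skew_frame_basis:
  assumes "skew_frame V g J ts hs" "fin_dim V (2 * length ts + length hs)"
  shows "is_basis V (frame_list ts hs)"
proof -
  have on: "orthonormal (set (frame_list ts hs))" and d: "distinct (frame_list ts hs)"
    using assms(1) unfolding skew_frame_def orthonormal_def by auto
  have ind: "independent (set (frame_list ts hs))" using orthonormal_independent[OF on] by simp
  have "set (frame_list ts hs) \<subseteq> V" using on by (simp add: orthonormal_def)
  from fin_dim_independent_span[OF assms(2) ind this] show ?thesis
    unfolding is_basis_def using d ind distinct_card[OF d] by simp
qed

text \<open>A frame of full length is a basis, and in this basis the matrix of J is the block matrix
  of \<open>char_poly_skew_blocks\<close>; its linear factors display the eigenvalues.\<close>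

lemma eigenvalues_skew_frame:
  assumes J: "lin_on V V J" and frame: "skew_frame V g J ts hs" and dim: "fin_dim V (2 * length ts + length hs)"
  shows "eigenvalues V J = mset (map (\<lambda>a. \<i> * complex_of_real a) (map fst ts)) +
      mset (map (\<lambda>a. - \<i> * complex_of_real a) (map fst ts)) + replicate_mset (length hs) 0"
proof -
  define n where "n = length ts"
  define r where "r = length hs"
  define \<alpha> where "\<alpha> i = fst (ts ! i)" for i
  let ?bs = "frame_list ts hs"
  have bs: "is_basis V ?bs" using skew_frame_basis[OF frame dim] .
  then have ind: "independent (set ?bs)" and dist: "distinct ?bs" by (auto simp: is_basis_def)
  have nth: "?bs ! j = fst (snd (ts ! j))" "?bs ! (n + j) = snd (snd (ts ! j))" if "j < n" for j
    using that by (auto simp: frame_list_def nth_append n_def)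
  have nth_h: "?bs ! (2 * n + j) = hs ! j" if "j < r" for j
    using that by (auto simp: frame_list_def nth_append n_def)
  have block: "J (?bs ! j) = \<alpha> j *\<^sub>R ?bs ! (n + j)" "J (?bs ! (n + j)) = (- \<alpha> j) *\<^sub>R ?bs ! j" if "j < n" for j
  proof -
    have "ts ! j \<in> set ts" using that by (simp add: n_def)
    then show "J (?bs ! j) = \<alpha> j *\<^sub>R ?bs ! (n + j)" "J (?bs ! (n + j)) = (- \<alpha> j) *\<^sub>R ?bs ! j"
      using frame unfolding nth[OF that] \<alpha>_def skew_frame_def by (auto simp: split_beta)
  qed
  have kernel: "J (?bs ! (2 * n + j)) = 0" if "j < r" for j
    using frame that unfolding nth_h[OF that] skew_frame_def by (simp add: r_def)
  have rep: "representation (set ?bs) (c *\<^sub>R ?bs ! j) (?bs ! i) = (if i = j then c else 0)"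
    if "i < 2 * n + r" "j < 2 * n + r" for i j c
    using that nth_eq_iff_index_eq[OF dist, of i j] nth_mem[of j ?bs]
    by (auto simp: representation_scale[OF ind span_base] representation_basis[OF ind] n_def r_def)
  have entry: "representation (set ?bs) (J (?bs ! j)) (?bs ! i) =
      (if j < n \<and> i = n + j then \<alpha> j else if n \<le> j \<and> j < 2 * n \<and> i = j - n then - \<alpha> (j - n) else 0)"
    if ij: "i < 2 * n + r" "j < 2 * n + r" for i j
  proof -
    \<comment> \<open>Columns of first vectors, of second vectors, and of kernel vectors.\<close>
    consider "j < n" | "j - n < n" "j = n + (j - n)" | "j - 2 * n < r" "j = 2 * n + (j - 2 * n)"
      using ij by linarith
    then show ?thesis
    proof cases
      case 1
      then show ?thesis using ij block(1)[OF 1] rep[of i "n + j"] by auto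
    next
      case 2
      define l where "l = j - n"
      then have "l < n" "j = n + l" using 2 by auto
      then show ?thesis using ij block(2)[of l] rep[of i l "- \<alpha> l"] by auto
    next
      case 3
      then have "J (?bs ! j) = 0" using kernel by metis
      then show ?thesis using 3 by (simp add: representation_zero)
    qed
  qed
  have "map_mat complex_of_real (matrix_in_basis ?bs J) =
    Matrix.mat (2 * n + r) (2 * n + r) (\<lambda>(i, j). if j < n \<and> i = n + j then complex_of_real (\<alpha> j)
      else if n \<le> j \<and> j < 2 * n \<and> i = j - n then - complex_of_real (\<alpha> (j - n)) else 0)"
    unfolding matrix_in_basis_def by (rule eq_matI) (auto simp: entry n_def[symmetric] r_def[symmetric])
  then have "eigenvalues V J = proots ((\<Prod>i<n. [:- \<i> * complex_of_real (\<alpha> i), 1:] * [:\<i> * complex_of_real (\<alpha> i), 1:]) * [:0, 1:] ^ r)"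
    unfolding eigenvalues_eq[OF bs J]
    using char_poly_skew_blocks[of n r "\<lambda>i. complex_of_real (\<alpha> i)"] by simp
  also have "\<dots> = (\<Sum>i<n. {#\<i> * complex_of_real (\<alpha> i)#} + {#- \<i> * complex_of_real (\<alpha> i)#}) + replicate_mset r 0"
  proof -
    let ?p = "\<lambda>i. [:- \<i> * complex_of_real (\<alpha> i), 1:]" and ?q = "\<lambda>i. [:\<i> * complex_of_real (\<alpha> i), 1:]"
    have nz: "?p i * ?q i \<noteq> 0" for i unfolding mult_eq_0_iff by simp
    have pq: "proots (?p i * ?q i) = {#\<i> * complex_of_real (\<alpha> i)#} + {#- \<i> * complex_of_real (\<alpha> i)#}" for i
      by (subst proots_mult) (simp_all only: proots_linear_factor pCons_eq_0_iff one_neq_zero simp_thms minus_mult_left[symmetric] minus_minus)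
    have "proots ((\<Prod>i<n. ?p i * ?q i) * [:0, 1:] ^ r) = proots (\<Prod>i<n. ?p i * ?q i) + proots ([:0, 1:] ^ r)"
      by (rule proots_mult) (use nz in \<open>auto simp only: prod_zero_iff finite_lessThan\<close>, simp)
    also have "proots (\<Prod>i<n. ?p i * ?q i) = (\<Sum>i<n. proots (?p i * ?q i))" by (rule proots_prod) (rule nz)
    also have "proots ([:0, 1:] ^ r :: complex poly) = replicate_mset r 0"
      unfolding proots_power by (simp add: repeat_mset_replicate_mset)
    finally show ?thesis unfolding pq .
  qed
  also have "(\<Sum>i<n. {#\<i> * complex_of_real (\<alpha> i)#} + {#- \<i> * complex_of_real (\<alpha> i)#}) =
      mset (map (\<lambda>a. \<i> * complex_of_real a) (map fst ts)) + mset (map (\<lambda>a. - \<i> * complex_of_real a) (map fst ts))"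
  proof -
    have *: "mset (map (\<lambda>a. F a) (map fst ts)) = (\<Sum>i<n. {#F (\<alpha> i)#})" for F :: "real \<Rightarrow> complex"
    proof -
      have "map (\<lambda>a. F a) (map fst ts) = map (\<lambda>i. F (\<alpha> i)) [0..<n]"
        by (rule nth_equalityI) (auto simp: n_def \<alpha>_def)
      then show ?thesis
        by (simp add: sum_unfold_sum_mset atLeast0LessThan[symmetric])
    qed
    show ?thesis unfolding * by (simp only: sum.distrib)
  qed
  finally show ?thesis by (simp add: r_def)
qed

end

text \<open>The positive imaginary parts are exactly the positive entries, each counted once. The
  number of zero entries follows from the common length, and sortedness fixes the order.\<close>

lemma sorted_determined_by_eigenvalues:
  fixes \<alpha> \<beta> :: "real list"
  assumes "sorted \<alpha>" "sorted \<beta>" "length \<alpha> = length \<beta>" "\<forall>a\<in>set \<alpha>. 0 \<le> a" "\<forall>a\<in>set \<beta>. 0 \<le> a"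
    and eq: "mset (map (\<lambda>a. \<i> * complex_of_real a) \<alpha>) + mset (map (\<lambda>a. - \<i> * complex_of_real a) \<alpha>) + replicate_mset r 0 =
      mset (map (\<lambda>a. \<i> * complex_of_real a) \<beta>) + mset (map (\<lambda>a. - \<i> * complex_of_real a) \<beta>) + replicate_mset r 0"
  shows "\<alpha> = \<beta>"
proof -
  have "filter_mset (\<lambda>a. a > 0) (image_mset Im (mset (map (\<lambda>a. \<i> * complex_of_real a) \<gamma>) +
      mset (map (\<lambda>a. - \<i> * complex_of_real a) \<gamma>) + replicate_mset r 0)) = filter_mset (\<lambda>a. a > 0) (mset \<gamma>)"
    if "\<forall>a\<in>set \<gamma>. 0 \<le> a" for \<gamma>
    using that by (simp add: multiset.map_comp o_def filter_mset_eq_conv) (induction \<gamma>; force)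
  from this[OF assms(4)] this[OF assms(5)] have pos: "filter_mset (\<lambda>a. a > 0) (mset \<alpha>) = filter_mset (\<lambda>a. a > 0) (mset \<beta>)"
    unfolding eq by simp
  \<comment> \<open>Entries that are nonnegative but not positive are 0, so the positive part and
    the length determine the multiset.\<close>
  have zero: "mset \<gamma> = filter_mset (\<lambda>a. a > 0) (mset \<gamma>) +
      replicate_mset (length \<gamma> - size (filter_mset (\<lambda>a. a > 0) (mset \<gamma>))) 0"
    if "\<forall>a\<in>set \<gamma>. 0 \<le> a" for \<gamma> :: "real list"
  proof -
    have "filter_mset (\<lambda>a. \<not> a > 0) (mset \<gamma>) = replicate_mset (size (filter_mset (\<lambda>a. \<not> a > 0) (mset \<gamma>))) 0"
      using that by (intro set_mset_subset_singletonD) force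
    moreover have "mset \<gamma> = filter_mset (\<lambda>a. a > 0) (mset \<gamma>) + filter_mset (\<lambda>a. \<not> a > 0) (mset \<gamma>)"
      by (rule multiset_partition)
    moreover from this have "length \<gamma> = size (filter_mset (\<lambda>a. a > 0) (mset \<gamma>)) + size (filter_mset (\<lambda>a. \<not> a > 0) (mset \<gamma>))"
      by (metis size_mset size_union)
    ultimately show ?thesis by (metis add_diff_cancel_left')
  qed
  have "mset \<alpha> = mset \<beta>" using zero[OF assms(4)] zero[OF assms(5)] pos assms(3) by simp
  then show ?thesis using assms(1,2) by (metis properties_for_sort)
qed

section \<open>Normal forms of skew operators\<close>

text \<open>Reordering the planes only permutes \<open>frame_list\<close>; this is what allows a
  frame to be sorted by its coefficients.\<close>

lemma skew_frame_perm:
  assumes "skew_frame V g J ts hs" "mset ts' = mset ts"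
  shows "skew_frame V g J ts' hs"
proof -
  have "mset (frame_list ts' hs) = mset (frame_list ts hs)" using assms(2) by (simp add: frame_list_def)
  moreover from this have "set (frame_list ts' hs) = set (frame_list ts hs)" by (rule mset_eq_setD)
  moreover from calculation(1) have "distinct (frame_list ts' hs) = distinct (frame_list ts hs)"
    by (rule mset_eq_imp_distinct_iff)
  moreover have "set ts' = set ts" using assms(2) by (rule mset_eq_setD)
  ultimately show ?thesis using assms(1) unfolding skew_frame_def by simp
qed

text \<open>Induction on the number of planes: an invariant plane of a skew operator has an
  invariant orthogonal complement. The bound on r leaves dimension 0 or 1 at the end, and on a line
  skewness forces J = 0.\<close>

lemma skew_frame_exists:
  assumes "inner_subspace V g" "fin_dim V (2 * n + r)" "r \<le> 1" "lin_on V V J"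
    and "\<And>u v. u \<in> V \<Longrightarrow> v \<in> V \<Longrightarrow> g (J u) v = - g u (J v)"
  shows "\<exists>ts hs. length ts = n \<and> length hs = r \<and> skew_frame V g J ts hs"
  using assms
proof (induction n arbitrary: V)
  case 0
  interpret inner_subspace V g by fact
  note J = 0(4) and skew = 0(5)
  show ?case
  proof (cases "r = 0")
    case True
    then show ?thesis by (intro exI[of _ "[]"]) (simp add: skew_frame_def frame_list_def)
  next
    case False
    then have r: "r = 1" using 0(3) by simp
    have dim: "fin_dim V (Suc 0)" using 0(2) by (simp add: r)
    obtain h where h: "h \<in> V" "g h h = 1" using unit_vector_exists[OF dim] .
    then have "h \<noteq> 0" by auto
    then have "span {h} = V" using h by (intro fin_dim_independent_span[OF dim]) auto
    then obtain c where c: "J h = c *\<^sub>R h" using lin_onD(1)[OF J h(1)] by (auto simp: span_singleton)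
    have "g (J h) h = 0" using skew[OF h(1) h(1)] sym[OF h(1) lin_onD(1)[OF J h(1)]] by simp
    then have "J h = 0" using c h by simp
    then show ?thesis
      using h r by (intro exI[of _ "[]"] exI[of _ "[h]"]) (simp add: skew_frame_def frame_list_def)
  qed
next
  case (Suc n)
  interpret inner_subspace V g by fact
  note J = Suc.prems(4) and skew = Suc.prems(5)
  have dim: "fin_dim V (Suc (Suc (2 * n + r)))" using Suc.prems(2) by simp
  obtain a e f where ef: "e \<in> V" "f \<in> V" "0 \<le> a" "g e e = 1" "g f f = 1" "g e f = 0"
    "J e = a *\<^sub>R f" "J f = - (a *\<^sub>R e)"
    by (rule skew_plane_exists[OF dim J skew])
  define V1 where "V1 = {v \<in> V. g v e = 0}"
  define V2 where "V2 = {v \<in> V1. g v f = 0}"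
  have V1: "fin_dim V1 (Suc (2 * n + r))" "inner_subspace V1 g"
    using orthogonal_complement[OF dim ef(1,4)] by (simp_all add: V1_def)
  interpret V1: inner_subspace V1 g by (rule V1)
  have f1: "f \<in> V1" using ef sym[of e f] by (simp add: V1_def)
  have V2: "fin_dim V2 (2 * n + r)" "inner_subspace V2 g"
    using V1.orthogonal_complement[OF V1(1) f1 ef(5)] by (simp_all add: V2_def)
  have V2V: "V2 \<subseteq> V" by (auto simp: V2_def V1_def)
  have JV: "J v \<in> V" if "v \<in> V" for v using lin_onD(1)[OF J that] .
  have "J v \<in> V2" if "v \<in> V2" for v
  proof -
    have v: "v \<in> V" "g v e = 0" "g v f = 0" using that by (auto simp: V2_def V1_def)
    have "g (J v) e = 0" using skew[OF v(1) ef(1)] v ef by simp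
    moreover have "g (J v) f = 0" using skew[OF v(1) ef(2)] v ef by simp
    ultimately show ?thesis using JV[OF v(1)] by (simp add: V2_def V1_def)
  qed
  then have J2: "lin_on V2 V2 J" using J V2V unfolding lin_on_def by (simp add: subset_iff)
  have skew2: "g (J u) v = - g u (J v)" if "u \<in> V2" "v \<in> V2" for u v
    using that V2V by (intro skew) auto
  obtain ts hs where ts: "length ts = n" "length hs = r" "skew_frame V2 g J ts hs"
    using Suc.IH[OF V2(2,1) Suc.prems(3) J2 skew2] by blast
  let ?old = "frame_list ts hs"
  have old: "u \<in> V" "g u e = 0" "g u f = 0" "g e u = 0" "g f u = 0" if "u \<in> set ?old" for u
  proof -
    have "u \<in> V2" using ts(3) that unfolding skew_frame_def by blast
    then show "u \<in> V" "g u e = 0" "g u f = 0" by (auto simp: V2_def V1_def)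
    then show "g e u = 0" "g f u = 0" using ef sym[of e u] sym[of f u] by simp_all
  qed
  have new: "e \<notin> set ?old" "f \<notin> set ?old" "e \<noteq> f" using old(2)[of e] old(3)[of f] ef by auto
  have mset: "mset (frame_list ((a, e, f) # ts) hs) = mset (e # f # ?old)" by (simp add: frame_list_def)
  have set: "set (frame_list ((a, e, f) # ts) hs) = set (e # f # ?old)" using mset by (rule mset_eq_setD)
  have "skew_frame V g J ((a, e, f) # ts) hs"
    unfolding skew_frame_def set
  proof (intro conjI)
    show "distinct (frame_list ((a, e, f) # ts) hs)"
      unfolding mset_eq_imp_distinct_iff[OF mset] using new ts(3) by (simp add: skew_frame_def)
    show "set (e # f # ?old) \<subseteq> V" using ef old by auto
    show "\<forall>u\<in>set (e # f # ?old). \<forall>v\<in>set (e # f # ?old). g u v = (if u = v then 1 else 0)"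
      using ef old new sym[of e f] ts(3) unfolding skew_frame_def by auto
    show "\<forall>(a, e, f)\<in>set ((a, e, f) # ts). 0 \<le> a \<and> J e = a *\<^sub>R f \<and> J f = - (a *\<^sub>R e)"
      using ef ts(3) unfolding skew_frame_def by simp
    show "\<forall>h\<in>set hs. J h = 0" using ts(3) unfolding skew_frame_def by simp
  qed
  then show ?case using ts by (intro exI[of _ "(a, e, f) # ts"] exI[of _ hs]) simp
qed

lemma skew_frame_sorted_exists:
  assumes "inner_subspace V g" "fin_dim V (2 * n + r)" "r \<le> 1" "lin_on V V J"
    and "\<And>u v. u \<in> V \<Longrightarrow> v \<in> V \<Longrightarrow> g (J u) v = - g u (J v)"
  obtains ts hs where "length ts = n" "length hs = r" "skew_frame V g J ts hs" "sorted (map fst ts)"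
proof -
  obtain ts hs where ts: "length ts = n" "length hs = r" "skew_frame V g J ts hs"
    using skew_frame_exists[OF assms] by blast
  show thesis
  proof (rule that)
    show "skew_frame V g J (sort_key fst ts) hs" by (rule skew_frame_perm[OF ts(3)]) simp
  qed (simp_all add: ts)
qed

text \<open>A negative c would make the coefficients negative. Exchanging the two vectors of each
  plane reverses its orientation and restores the sign, whence the absolute value.\<close>

lemma skew_frame_scale:
  assumes "skew_frame V g J ts hs"
  obtains ts' where "skew_frame V g (\<lambda>u. c *\<^sub>R J u) ts' hs" "map fst ts' = map (\<lambda>a. \<bar>c\<bar> * a) (map fst ts)"
proof -
  define s where "s = (\<lambda>(a, e, f). if c \<ge> 0 then (\<bar>c\<bar> * a, e, f) else (\<bar>c\<bar> * a, f, e :: 'a))"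
  have mset: "mset (frame_list (map s ts) hs) = mset (frame_list ts hs)"
    by (induction ts) (auto simp: frame_list_def s_def split: prod.split)
  have set: "set (frame_list (map s ts) hs) = set (frame_list ts hs)" using mset by (rule mset_eq_setD)
  have blocks: "0 \<le> a \<and> c *\<^sub>R J e = a *\<^sub>R f \<and> c *\<^sub>R J f = - (a *\<^sub>R e)" if aef: "(a, e, f) \<in> set (map s ts)" for a e f
  proof -
    obtain t where "t \<in> set ts" "(a, e, f) = s t" using aef by auto
    moreover obtain a' e' f' where "t = (a', e', f')" by (cases t) auto
    ultimately have t: "(a', e', f') \<in> set ts" "(a, e, f) = s (a', e', f')" by auto
    then have "0 \<le> a'" "J e' = a' *\<^sub>R f'" "J f' = - (a' *\<^sub>R e')" using assms unfolding skew_frame_def by auto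
    then show ?thesis using t(2) mult_nonneg_nonneg[of "\<bar>c\<bar>" a'] by (cases "c \<ge> 0") (auto simp: s_def)
  qed
  show thesis
  proof (rule that)
    show "skew_frame V g (\<lambda>u. c *\<^sub>R J u) (map s ts) hs"
      unfolding skew_frame_def set mset_eq_imp_distinct_iff[OF mset]
    proof (intro conjI)
      show "\<forall>(a, e, f)\<in>set (map s ts). 0 \<le> a \<and> c *\<^sub>R J e = a *\<^sub>R f \<and> c *\<^sub>R J f = - (a *\<^sub>R e)"
        using blocks by blast
    qed (use assms in \<open>simp_all add: skew_frame_def\<close>)
    show "map fst (map s ts) = map (\<lambda>a. \<bar>c\<bar> * a) (map fst ts)" by (auto simp: s_def)
  qed
qed

lemma skew_frame_in_space:
  assumes "skew_frame V g J ts hs"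
  shows "(a, e, f) \<in> set ts \<Longrightarrow> e \<in> V" "(a, e, f) \<in> set ts \<Longrightarrow> f \<in> V" "h \<in> set hs \<Longrightarrow> h \<in> V"
proof -
  have V: "set (frame_list ts hs) \<subseteq> V" using assms by (simp add: skew_frame_def)
  have "e \<in> set (frame_list ts hs)" "f \<in> set (frame_list ts hs)" if "(a, e, f) \<in> set ts"
    using imageI[OF that, of "fst \<circ> snd"] imageI[OF that, of "snd \<circ> snd"] by (auto simp: frame_list_def)
  then show "(a, e, f) \<in> set ts \<Longrightarrow> e \<in> V" "(a, e, f) \<in> set ts \<Longrightarrow> f \<in> V" using V by blast+
  show "h \<in> set hs \<Longrightarrow> h \<in> V" using V by (auto simp: frame_list_def)
qed

lemma skew_frame_cong:
  assumes "skew_frame V g J ts hs" "\<And>u. u \<in> V \<Longrightarrow> J u = J' u"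
  shows "skew_frame V g J' ts hs"
proof -
  have ts: "e \<in> V" "f \<in> V" if "(a, e, f) \<in> set ts" for a e f
    using skew_frame_in_space(1,2)[OF assms(1) that] .
  have "\<forall>(a, e, f)\<in>set ts. 0 \<le> a \<and> J' e = a *\<^sub>R f \<and> J' f = - (a *\<^sub>R e)"
  proof (intro ballI, clarify)
    fix a e f assume t: "(a, e, f) \<in> set ts"
    then have "0 \<le> a \<and> J e = a *\<^sub>R f \<and> J f = - (a *\<^sub>R e)" using assms(1) unfolding skew_frame_def by blast
    then show "0 \<le> a \<and> J' e = a *\<^sub>R f \<and> J' f = - (a *\<^sub>R e)" using assms(2) ts[OF t] by simp
  qed
  moreover have "\<forall>h\<in>set hs. J' h = 0"
    using assms(2)[OF skew_frame_in_space(3)[OF assms(1)]] assms(1) unfolding skew_frame_def by simp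
  ultimately show ?thesis using assms(1) unfolding skew_frame_def by simp
qed

text \<open>Every condition on a frame is expressed by the inner product and the operator, and
  \<gamma> respects both. The images stay distinct because an isometry cannot identify two
  orthonormal vectors.\<close>

lemma skew_frame_isometry:
  assumes frame: "skew_frame V g J ts hs"
    and \<gamma>: "lin_on V V' \<gamma>" "\<And>u v. u \<in> V \<Longrightarrow> v \<in> V \<Longrightarrow> g' (\<gamma> u) (\<gamma> v) = g u v"
    and J: "lin_on V V J" "\<And>u. u \<in> V \<Longrightarrow> J' (\<gamma> u) = \<gamma> (J u)" and V: "subspace V"
  shows "skew_frame V' g' J' (map (\<lambda>(a, e, f). (a, \<gamma> e, \<gamma> f)) ts) (map \<gamma> hs)"
proof -
  let ?bs = "frame_list ts hs"
  have fl: "frame_list (map (\<lambda>(a, e, f). (a, \<gamma> e, \<gamma> f)) ts) (map \<gamma> hs) = map \<gamma> ?bs"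
    by (auto simp: frame_list_def)
  have bs: "distinct ?bs" "set ?bs \<subseteq> V" "\<And>u v. u \<in> set ?bs \<Longrightarrow> v \<in> set ?bs \<Longrightarrow> g u v = (if u = v then 1 else 0)"
    "\<And>a e f. (a, e, f) \<in> set ts \<Longrightarrow> 0 \<le> a \<and> J e = a *\<^sub>R f \<and> J f = - (a *\<^sub>R e)" "\<And>h. h \<in> set hs \<Longrightarrow> J h = 0"
    using frame unfolding skew_frame_def by auto
  have inV: "u \<in> V" if "u \<in> set ?bs" for u using bs(2) that by auto
  have \<gamma>g: "g' (\<gamma> u) (\<gamma> v) = (if u = v then 1 else 0)" if "u \<in> set ?bs" "v \<in> set ?bs" for u v
    using \<gamma>(2)[OF inV[OF that(1)] inV[OF that(2)]] bs(3)[OF that] by simp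
  have inj: "inj_on \<gamma> (set ?bs)"
  proof (rule inj_onI)
    fix u v assume uv: "u \<in> set ?bs" "v \<in> set ?bs" "\<gamma> u = \<gamma> v"
    then show "u = v" using \<gamma>g[OF uv(1,2)] \<gamma>g[OF uv(1,1)] by (simp split: if_splits)
  qed
  have ts: "e \<in> V" "f \<in> V" if "(a, e, f) \<in> set ts" for a e f
    using skew_frame_in_space(1,2)[OF frame that] .
  have hs: "h \<in> V" if "h \<in> set hs" for h using skew_frame_in_space(3)[OF frame that] .
  have neg: "\<gamma> (- (a *\<^sub>R e)) = - (a *\<^sub>R \<gamma> e)" if "e \<in> V" for a e
    using lin_onD(4)[OF \<gamma>(1) that, of "- a"] by simp
  have z: "\<gamma> 0 = 0" using lin_onD(4)[OF \<gamma>(1) subspace_0[OF V], of 0] by simp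
  show ?thesis
    unfolding skew_frame_def fl
  proof (intro conjI)
    show "distinct (map \<gamma> ?bs)" using bs(1) inj by (simp add: distinct_map)
    show "set (map \<gamma> ?bs) \<subseteq> V'" using inV lin_onD(1)[OF \<gamma>(1)] by auto
    show "\<forall>u\<in>set (map \<gamma> ?bs). \<forall>v\<in>set (map \<gamma> ?bs). g' u v = (if u = v then 1 else 0)"
      using \<gamma>g inj_on_eq_iff[OF inj] by auto
    show "\<forall>(a, e, f)\<in>set (map (\<lambda>(a, e, f). (a, \<gamma> e, \<gamma> f)) ts). 0 \<le> a \<and> J' e = a *\<^sub>R f \<and> J' f = - (a *\<^sub>R e)"
    proof (intro ballI, clarsimp)
      fix a e f assume t: "(a, e, f) \<in> set ts"
      show "0 \<le> a \<and> J' (\<gamma> e) = a *\<^sub>R \<gamma> f \<and> J' (\<gamma> f) = - (a *\<^sub>R \<gamma> e)"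
        using bs(4)[OF t] J(2)[OF ts(1)[OF t]] J(2)[OF ts(2)[OF t]] neg[OF ts(1)[OF t]]
          lin_onD(4)[OF \<gamma>(1) ts(2)[OF t]] by simp
    qed
    show "\<forall>h\<in>set (map \<gamma> hs). J' h = 0" using J(2) hs bs(5) z by auto
  qed
qed

(* The isometry that maps one frame to the other. *)
lemma skew_frames_isometry_exists:
  assumes V: "inner_subspace V g" "fin_dim V (2 * n + r)" "lin_on V V J" "skew_frame V g J ts hs"
    and V': "inner_subspace V' g'" "lin_on V' V' J'" "skew_frame V' g' J' ts' hs'"
    and len: "length ts = n" "length hs = r" "length hs' = r"
    and c: "map fst ts' = map (\<lambda>a. c * a) (map fst ts)"
  obtains \<gamma> where "lin_on V V' \<gamma>" "\<And>u v. u \<in> V \<Longrightarrow> v \<in> V \<Longrightarrow> g' (\<gamma> u) (\<gamma> v) = g u v"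
    "\<And>u. u \<in> V \<Longrightarrow> J' (\<gamma> u) = c *\<^sub>R \<gamma> (J u)"
proof -
  interpret V: inner_subspace V g by fact
  interpret V': inner_subspace V' g' by fact
  have len': "length ts' = n" using arg_cong[OF c, of length] len by simp
  define bs where "bs = frame_list ts hs"
  define bs' where "bs' = frame_list ts' hs'"
  define d where "d = 2 * n + r"
  have d: "length bs = d" "length bs' = d" by (simp_all add: bs_def bs'_def d_def len len')
  have basis: "is_basis V bs" unfolding bs_def using V.skew_frame_basis[OF V(4)] V(2) len by simp
  have dist: "distinct bs" "distinct bs'"
    using V(4) V'(3) unfolding skew_frame_def bs_def bs'_def by auto
  have nth_V: "bs ! i \<in> V" "bs' ! i \<in> V'" if "i < d" for i
    using V(4) V'(3) that nth_mem[of i bs] nth_mem[of i bs'] d unfolding skew_frame_def bs_def bs'_def by auto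
  have on: "g (bs ! i) (bs ! j) = (if i = j then 1 else 0)" "g' (bs' ! i) (bs' ! j) = (if i = j then 1 else 0)"
    if "i < d" "j < d" for i j
    using V(4) V'(3) that nth_mem[of i bs] nth_mem[of i bs'] nth_mem[of j bs] nth_mem[of j bs'] d
      nth_eq_iff_index_eq[OF dist(1), of i j] nth_eq_iff_index_eq[OF dist(2), of i j]
    unfolding skew_frame_def bs_def[symmetric] bs'_def[symmetric] by auto
  \<comment> \<open>The inner products with an orthonormal basis are the coordinates of u; the same
    coordinates are used in the other basis.\<close>
  define \<gamma> where "\<gamma> u = (\<Sum>i<d. g u (bs ! i) *\<^sub>R bs' ! i)" for u
  have lin: "lin_on V V' \<gamma>"
    unfolding lin_on_def
  proof (intro conjI ballI allI)
    show "\<gamma> u \<in> V'" if "u \<in> V" for u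
      unfolding \<gamma>_def using nth_V by (intro subspace_sum V'.subspace) auto
    show "\<gamma> (a *\<^sub>R u + b *\<^sub>R v) = a *\<^sub>R \<gamma> u + b *\<^sub>R \<gamma> v" if "u \<in> V" "v \<in> V" for u v a b
      unfolding \<gamma>_def scaleR_sum_right sum.distrib[symmetric]
      using nth_V that by (intro sum.cong) (auto simp: scaleR_left_distrib)
  qed
  have \<gamma>_bs: "\<gamma> (bs ! j) = bs' ! j" if "j < d" for j
  proof -
    have "\<gamma> (bs ! j) = (\<Sum>i<d. (if i = j then bs' ! i else 0))"
      unfolding \<gamma>_def using on(1)[OF that] by (intro sum.cong) auto
    then show ?thesis using that by simp
  qed
  have \<gamma>_sum: "\<gamma> (\<Sum>i<d. x i *\<^sub>R bs ! i) = (\<Sum>i<d. x i *\<^sub>R bs' ! i)" for x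
    using lin_on_sum[OF lin V.subspace, of "{..<d}" "\<lambda>i. bs ! i" x] nth_V \<gamma>_bs by simp
  have expand: "\<exists>x. u = (\<Sum>i<d. x i *\<^sub>R bs ! i)" if "u \<in> V" for u
    using basis_sum_list(1)[OF basis that] d by (intro exI[of _ "\<lambda>i. representation (set bs) u (bs ! i)"]) simp
  have iso: "g' (\<gamma> u) (\<gamma> v) = g u v" if uv: "u \<in> V" "v \<in> V" for u v
  proof -
    obtain x where x: "u = (\<Sum>i<d. x i *\<^sub>R bs ! i)" using expand[OF uv(1)] by blast
    have \<gamma>v: "g' (bs' ! i) (\<gamma> v) = g (bs ! i) v" if i: "i < d" for i
    proof -
      have "g' (bs' ! i) (\<gamma> v) = g' (\<gamma> v) (bs' ! i)" using V'.sym nth_V[OF i] lin_onD(1)[OF lin uv(2)] by blast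
      also have "\<dots> = (\<Sum>j<d. g v (bs ! j) * g' (bs' ! j) (bs' ! i))"
        unfolding \<gamma>_def using nth_V i by (intro V'.g_sum_left) auto
      also have "\<dots> = (\<Sum>j<d. if j = i then g v (bs ! j) else 0)" using on(2) i by (intro sum.cong) auto
      also have "\<dots> = g (bs ! i) v" using i V.sym[OF nth_V(1)[OF i] uv(2)] by simp
      finally show ?thesis .
    qed
    have "g' (\<gamma> u) (\<gamma> v) = (\<Sum>i<d. x i * g' (bs' ! i) (\<gamma> v))"
      unfolding x \<gamma>_sum using nth_V lin_onD(1)[OF lin uv(2)] by (intro V'.g_sum_left) auto
    also have "\<dots> = (\<Sum>i<d. x i * g (bs ! i) v)" using \<gamma>v by (intro sum.cong) auto
    also have "\<dots> = g u v" unfolding x using nth_V uv(2) by (intro V.g_sum_left[symmetric]) auto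
    finally show ?thesis .
  qed
  have J_bs: "J' (bs' ! i) = c *\<^sub>R \<gamma> (J (bs ! i))" if i: "i < d" for i
  proof -
    have block: "bs ! j = fst (snd (ts ! j))" "bs ! (n + j) = snd (snd (ts ! j))"
        "bs' ! j = fst (snd (ts' ! j))" "bs' ! (n + j) = snd (snd (ts' ! j))" if "j < n" for j
      using that len len' by (auto simp: frame_list_def nth_append bs_def bs'_def)
    have tail: "bs ! (2 * n + j) = hs ! j" "bs' ! (2 * n + j) = hs' ! j" if "j < r" for j
      using that len len' by (auto simp: frame_list_def nth_append bs_def bs'_def)
    have J: "J (bs ! j) = fst (ts ! j) *\<^sub>R bs ! (n + j)" "J (bs ! (n + j)) = (- fst (ts ! j)) *\<^sub>R bs ! j"
      "J' (bs' ! j) = fst (ts' ! j) *\<^sub>R bs' ! (n + j)" "J' (bs' ! (n + j)) = (- fst (ts' ! j)) *\<^sub>R bs' ! j"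
      "fst (ts' ! j) = c * fst (ts ! j)" if "j < n" for j
    proof -
      have "ts ! j \<in> set ts" "ts' ! j \<in> set ts'" using that len len' by auto
      then show "J (bs ! j) = fst (ts ! j) *\<^sub>R bs ! (n + j)" "J (bs ! (n + j)) = (- fst (ts ! j)) *\<^sub>R bs ! j"
        "J' (bs' ! j) = fst (ts' ! j) *\<^sub>R bs' ! (n + j)" "J' (bs' ! (n + j)) = (- fst (ts' ! j)) *\<^sub>R bs' ! j"
        using V(4) V'(3) unfolding block[OF that] skew_frame_def by (auto simp: split_beta)
      show "fst (ts' ! j) = c * fst (ts ! j)"
        using arg_cong[OF c, of "\<lambda>xs. xs ! j"] that len len' by simp
    qed
    \<comment> \<open>The index runs through first vectors, second vectors and kernel vectors; J
      exchanges the first two kinds up to a factor and kills the third.\<close>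
    have "i < n \<or> (i - n < n \<and> i = n + (i - n)) \<or> (i - 2 * n < r \<and> i = 2 * n + (i - 2 * n))"
      using i unfolding d_def by linarith
    then consider "i < n" | j where "j < n" "i = n + j" | j where "j < r" "i = 2 * n + j" by blast
    then show ?thesis
    proof cases
      case 1
      then have "n + i < d" by (simp add: d_def)
      then show ?thesis
        using J[OF 1] lin_onD(4)[OF lin nth_V(1), of "n + i" "fst (ts ! i)"] \<gamma>_bs[of "n + i"] by simp
    next
      case (2 j)
      then have "j < d" by (simp add: d_def)
      then show ?thesis
        using J[OF 2(1)] 2(2) lin_onD(4)[OF lin nth_V(1), of j "- fst (ts ! j)"] \<gamma>_bs[of j] by simp
    next
      case (3 j)
      have "hs ! j \<in> set hs" "hs' ! j \<in> set hs'" using 3 len by auto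
      then have "J (bs ! i) = 0" "J' (bs' ! i) = 0"
        using V(4) V'(3) unfolding 3(2) tail[OF 3(1)] skew_frame_def by auto
      then show ?thesis using lin_onD(4)[OF lin V.in_V(1), of 0] by simp
    qed
  qed
  have "J' (\<gamma> u) = c *\<^sub>R \<gamma> (J u)" if u: "u \<in> V" for u
  proof -
    obtain x where x: "u = (\<Sum>i<d. x i *\<^sub>R bs ! i)" using expand[OF u] by blast
    have "J' (\<gamma> u) = (\<Sum>i<d. x i *\<^sub>R J' (bs' ! i))"
      unfolding x \<gamma>_sum using nth_V by (intro lin_on_sum[OF V'(2) V'.subspace]) auto
    also have "\<dots> = (\<Sum>i<d. x i *\<^sub>R c *\<^sub>R \<gamma> (J (bs ! i)))" using J_bs by (intro sum.cong) auto
    also have "\<dots> = c *\<^sub>R (\<Sum>i<d. x i *\<^sub>R \<gamma> (J (bs ! i)))"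
      by (simp add: scaleR_sum_right mult.commute)
    also have "(\<Sum>i<d. x i *\<^sub>R \<gamma> (J (bs ! i))) = \<gamma> (\<Sum>i<d. x i *\<^sub>R J (bs ! i))"
      using nth_V lin_onD(1)[OF V(3)] by (intro lin_on_sum[OF lin V.subspace, symmetric]) auto
    also have "(\<Sum>i<d. x i *\<^sub>R J (bs ! i)) = J u"
      unfolding x using nth_V by (intro lin_on_sum[OF V(3) V.subspace, symmetric]) auto
    finally show ?thesis .
  qed
  then show thesis using that lin iso by blast
qed

section \<open>Osculating algebras and types\<close>

lemma coset_add:
  assumes "subspace S"
  shows "{p + q |p q. p \<in> coset S u \<and> q \<in> coset S v} = coset S (u + v)"
proof (intro equalityI subsetI)
  fix z assume "z \<in> {p + q |p q. p \<in> coset S u \<and> q \<in> coset S v}"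
  then obtain s s' where "s \<in> S" "s' \<in> S" "z = (u + s) + (v + s')" by (auto simp: coset_def)
  then have "z = (u + v) + (s + s')" "s + s' \<in> S" using subspace_add[OF assms] by (auto simp: algebra_simps)
  then show "z \<in> coset S (u + v)" unfolding coset_def by blast
next
  fix z assume "z \<in> coset S (u + v)"
  then obtain s where s: "s \<in> S" "z = (u + 0) + (v + s)" by (auto simp: coset_def algebra_simps)
  then have "u + 0 \<in> coset S u" "v + s \<in> coset S v" using subspace_0[OF assms] unfolding coset_def by blast+
  then show "z \<in> {p + q |p q. p \<in> coset S u \<and> q \<in> coset S v}" using s(2) by blast
qed

text \<open>The summand s matters for c = 0: the multiples alone would form {0} instead of the coset
  S.\<close>

lemma coset_scale:
  assumes "subspace S"
  shows "{c *\<^sub>R p + s |p s. p \<in> coset S u \<and> s \<in> S} = coset S (c *\<^sub>R u)"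
proof (intro equalityI subsetI)
  fix z assume "z \<in> {c *\<^sub>R p + s |p s. p \<in> coset S u \<and> s \<in> S}"
  then obtain s s' where "s \<in> S" "s' \<in> S" "z = c *\<^sub>R (u + s') + s" by (auto simp: coset_def)
  then have "z = c *\<^sub>R u + (c *\<^sub>R s' + s)" "c *\<^sub>R s' + s \<in> S"
    using subspace_add[OF assms] subspace_scale[OF assms] by (auto simp: algebra_simps)
  then show "z \<in> coset S (c *\<^sub>R u)" unfolding coset_def by blast
next
  fix z assume "z \<in> coset S (c *\<^sub>R u)"
  then obtain s where s: "s \<in> S" "z = c *\<^sub>R (u + 0) + s" by (auto simp: coset_def)
  then have "u + 0 \<in> coset S u" using subspace_0[OF assms] unfolding coset_def by blast
  then show "z \<in> {c *\<^sub>R p + s |p s. p \<in> coset S u \<and> s \<in> S}" using s by blast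
qed

lemma quot_space_simps:
  assumes "subspace S"
  shows "vcarrier (quot_space T S) = coset S ` T"
    "vadd (quot_space T S) (coset S u) (coset S v) = coset S (u + v)"
    "vscale (quot_space T S) c (coset S u) = coset S (c *\<^sub>R u)"
  by (simp_all add: quot_space_def coset_add[OF assms] coset_scale[OF assms])

text \<open>What remains of the manifold at a point: V, T and L are the fibre of D, the tangent
  space and the Levi map, and t is a defining form at the point. L is described through some
  representative of its coset, which is enough because t is constant on cosets of V.\<close>

locale osculating_data = inner_subspace V g
  for V :: "'v::real_vector set" and g :: "'v \<Rightarrow> 'v \<Rightarrow> real" +
  fixes T :: "'v set" and L :: "'v \<Rightarrow> 'v \<Rightarrow> 'v set" and t :: "'v \<Rightarrow> real" and J :: "'v \<Rightarrow> 'v"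
  assumes T: "subspace T" and t: "lin_on T UNIV t" and V: "V = {v \<in> T. t v = 0}"
    and t_onto: "\<exists>w\<in>T. t w = 1"
    and J: "lin_on V V J" and skew: "u \<in> V \<Longrightarrow> v \<in> V \<Longrightarrow> g (J u) v = - g u (J v)"
    and levi: "u \<in> V \<Longrightarrow> v \<in> V \<Longrightarrow> \<exists>w\<in>T. L u v = coset V w \<and> t w = - g (J u) v"
    and nonzero: "\<exists>u\<in>V. \<exists>v\<in>V. g (J u) v \<noteq> 0"
begin

text \<open>V is the kernel of t on T, so t is a coordinate on the line T/V.\<close>

lemma coset_eq: "u \<in> T \<Longrightarrow> v \<in> T \<Longrightarrow> coset V u = coset V v \<longleftrightarrow> t u = t v"
proof -
  assume uv: "u \<in> T" "v \<in> T"
  have "t (u - v) = t u - t v" using lin_onD(2)[OF t uv, of 1 "-1"] by simp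
  moreover have "u - v \<in> T" using uv subspace_diff[OF T] by blast
  ultimately show ?thesis unfolding coset_eq_iff[OF subspace] by (simp add: V)
qed

lemma t_scale: "w \<in> T \<Longrightarrow> t (c *\<^sub>R w) = c * t w"
  using lin_onD(4)[OF t] by simp

lemma T_scale: "w \<in> T \<Longrightarrow> c *\<^sub>R w \<in> T"
  using subspace_scale[OF T] .

end

text \<open>Definiteness of g gives injectivity. For surjectivity, the normal form of the zero
  operator provides an orthonormal basis of V; its image is an orthonormal list of full length and
  hence spans V'.\<close>

lemma isometry_bij_betw:
  assumes V: "inner_subspace V g" "inner_subspace V' g'" "fin_dim V k" "fin_dim V' k"
    and \<gamma>: "lin_on V V' \<gamma>" "\<And>u v. u \<in> V \<Longrightarrow> v \<in> V \<Longrightarrow> g' (\<gamma> u) (\<gamma> v) = g u v"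
  shows "bij_betw \<gamma> V V'"
proof -
  interpret V: inner_subspace V g by fact
  interpret V': inner_subspace V' g' by fact
  have "inj_on \<gamma> V"
  proof (rule inj_onI)
    fix u v assume uv: "u \<in> V" "v \<in> V" "\<gamma> u = \<gamma> v"
    have "\<gamma> (u - v) = \<gamma> u - \<gamma> v" using lin_onD(2)[OF \<gamma>(1) uv(1,2), of 1 "-1"] by simp
    then have "g (u - v) (u - v) = 0" using \<gamma>(2)[of "u - v" "u - v"] uv by simp
    then show "u = v" using V.eq_0_iff[of "u - v"] uv by simp
  qed
  moreover have "V' \<subseteq> \<gamma> ` V"
  proof -
    have k: "k mod 2 \<le> 1" by linarith
    have zero: "lin_on V V (\<lambda>_. 0)" unfolding lin_on_def by simp
    obtain ts hs where ts: "length ts = k div 2" "length hs = k mod 2" "skew_frame V g (\<lambda>_. 0) ts hs"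
      using skew_frame_exists[OF V(1) _ _ zero, of "k div 2" "k mod 2"] V(3) k by auto
    have "\<gamma> 0 = 0" using lin_onD(4)[OF \<gamma>(1) V.in_V(1), of 0] by simp
    then have "skew_frame V' g' (\<lambda>_. 0) (map (\<lambda>(a, e, f). (a, \<gamma> e, \<gamma> f)) ts) (map \<gamma> hs)"
      using skew_frame_isometry[OF ts(3) \<gamma> zero _ V.subspace, of "\<lambda>_. 0"] by simp
    from V'.skew_frame_basis[OF this] have "span (set (frame_list (map (\<lambda>(a, e, f). (a, \<gamma> e, \<gamma> f)) ts) (map \<gamma> hs))) = V'"
      using V(4) ts by (simp add: is_basis_def)
    moreover have "frame_list (map (\<lambda>(a, e, f). (a, \<gamma> e, \<gamma> f)) ts) (map \<gamma> hs) = map \<gamma> (frame_list ts hs)"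
      by (auto simp: frame_list_def)
    moreover have "set (map \<gamma> (frame_list ts hs)) \<subseteq> \<gamma> ` V"
      using ts(3) unfolding skew_frame_def by auto
    ultimately show ?thesis using span_minimal[OF _ lin_on_image_subspace[OF \<gamma>(1) V.subspace]] by metis
  qed
  ultimately show ?thesis using lin_onD(1)[OF \<gamma>(1)] unfolding bij_betw_def by blast
qed

locale osculating_pair =
  V: osculating_data V g T L t J + V': osculating_data V' g' T' L' t' J'
  for V :: "'v::real_vector set" and g T L t J and V' :: "'w::real_vector set" and g' T' L' t' J' +
  fixes k :: nat
  assumes dim: "fin_dim V k" "fin_dim V' k"
begin

text \<open>Condition (iii) of the theorem; neither the form nor the operator occurs in it.\<close>

definition preserves_levi :: "('v \<Rightarrow> 'w) \<Rightarrow> ('v set \<Rightarrow> 'w set) \<Rightarrow> bool"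
  where "preserves_levi \<gamma>1 \<gamma>2 \<longleftrightarrow> linear_isometry V g V' g' \<gamma>1 \<and>
    vlinear (quot_space T V) (quot_space T' V') \<gamma>2 \<and>
    (\<forall>X\<in>V. \<forall>Y\<in>V. L' (\<gamma>1 X) (\<gamma>1 Y) = \<gamma>2 (L X Y))"

lemma linear_isometry_iff:
  "linear_isometry V g V' g' \<gamma> \<longleftrightarrow> lin_on V V' \<gamma> \<and> (\<forall>u\<in>V. \<forall>v\<in>V. g' (\<gamma> u) (\<gamma> v) = g u v)"
  unfolding linear_isometry_def lin_on_iff_vlinear[OF V.subspace] ..

lemma linear_isometry_bij: "linear_isometry V g V' g' \<gamma> \<Longrightarrow> bij_betw \<gamma> V V'"
  unfolding linear_isometry_iff
  using isometry_bij_betw[OF V.inner_subspace_axioms V'.inner_subspace_axioms dim] by blast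

text \<open>A linear map between the lines T/V and T'/V' is multiplication by a number c in the
  coordinates t and t'. Evaluating the Levi forms by t and t' turns their compatibility into g' (J'
  (\<gamma>1 X)) (\<gamma>1 Y) = c * g (J X) Y.\<close>

lemma preserves_leviD:
  assumes "preserves_levi \<gamma>1 \<gamma>2"
  obtains c where "c \<noteq> 0" "\<And>w. w \<in> T \<Longrightarrow> \<exists>w'\<in>T'. \<gamma>2 (coset V w) = coset V' w' \<and> t' w' = c * t w"
    "\<And>u. u \<in> V \<Longrightarrow> J' (\<gamma>1 u) = c *\<^sub>R \<gamma>1 (J u)"
proof -
  have iso: "linear_isometry V g V' g' \<gamma>1" and \<gamma>2: "vlinear (quot_space T V) (quot_space T' V') \<gamma>2"
    and L: "\<And>X Y. X \<in> V \<Longrightarrow> Y \<in> V \<Longrightarrow> L' (\<gamma>1 X) (\<gamma>1 Y) = \<gamma>2 (L X Y)"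
    using assms unfolding preserves_levi_def by blast+
  have lin: "lin_on V V' \<gamma>1" and g: "\<And>u v. u \<in> V \<Longrightarrow> v \<in> V \<Longrightarrow> g' (\<gamma>1 u) (\<gamma>1 v) = g u v"
    using iso unfolding linear_isometry_iff by blast+
  have onto: "\<gamma>1 ` V = V'" using linear_isometry_bij[OF iso] by (simp add: bij_betw_def)
  obtain w0 where w0: "w0 \<in> T" "t w0 = 1" using V.t_onto by blast
  have "\<gamma>2 (coset V w0) \<in> coset V' ` T'"
    using \<gamma>2 w0(1) unfolding vlinear_def quot_space_simps(1)[OF V.subspace] quot_space_simps(1)[OF V'.subspace] by blast
  then obtain w0' where w0': "w0' \<in> T'" "\<gamma>2 (coset V w0) = coset V' w0'" by blast
  \<comment> \<open>The coordinate of the image of the unit class, since t w0 = 1.\<close>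
  define c where "c = t' w0'"
  have \<gamma>2_c: "\<exists>w'\<in>T'. \<gamma>2 (coset V w) = coset V' w' \<and> t' w' = c * t w" if w: "w \<in> T" for w
  proof (rule bexI[of _ "t w *\<^sub>R w0'"])
    have "coset V w = coset V (t w *\<^sub>R w0)"
      using V.coset_eq[OF w V.T_scale[OF w0(1)]] V.t_scale[OF w0(1)] w0(2) by simp
    also have "\<dots> = vscale (quot_space T V) (t w) (coset V w0)" by (simp add: quot_space_simps[OF V.subspace])
    also have "\<gamma>2 \<dots> = vscale (quot_space T' V') (t w) (\<gamma>2 (coset V w0))"
      using \<gamma>2 w0(1) unfolding vlinear_def quot_space_simps(1)[OF V.subspace] by blast
    also have "\<dots> = coset V' (t w *\<^sub>R w0')" unfolding w0'(2) by (simp add: quot_space_simps[OF V'.subspace])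
    finally show "\<gamma>2 (coset V w) = coset V' (t w *\<^sub>R w0') \<and> t' (t w *\<^sub>R w0') = c * t w"
      using V'.t_scale[OF w0'(1)] by (simp add: c_def)
  qed (rule V'.T_scale[OF w0'(1)])
  have gJ: "g' (J' (\<gamma>1 X)) (\<gamma>1 Y) = c * g (J X) Y" if X: "X \<in> V" and Y: "Y \<in> V" for X Y
  proof -
    obtain w where w: "w \<in> T" "L X Y = coset V w" "t w = - g (J X) Y" using V.levi[OF X Y] by blast
    obtain w' where w': "w' \<in> T'" "\<gamma>2 (coset V w) = coset V' w'" "t' w' = c * t w" using \<gamma>2_c[OF w(1)] by blast
    obtain w'' where w'': "w'' \<in> T'" "L' (\<gamma>1 X) (\<gamma>1 Y) = coset V' w''" "t' w'' = - g' (J' (\<gamma>1 X)) (\<gamma>1 Y)"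
      using V'.levi[OF lin_onD(1)[OF lin X] lin_onD(1)[OF lin Y]] by blast
    have "coset V' w'' = coset V' w'" using L[OF X Y] w w' w'' by simp
    then have "t' w'' = t' w'" using V'.coset_eq[OF w''(1) w'(1)] by simp
    then show ?thesis using w w' w'' by simp
  qed
  \<comment> \<open>The isometry is onto, so testing against the vectors \<gamma>1 v is testing
    against all of V'.\<close>
  have J: "J' (\<gamma>1 u) = c *\<^sub>R \<gamma>1 (J u)" if u: "u \<in> V" for u
  proof (rule V'.nondegenerate)
    have in_V': "\<gamma>1 u \<in> V'" "\<gamma>1 (J u) \<in> V'" using u lin_onD(1)[OF lin] lin_onD(1)[OF V.J] by blast+
    then show "J' (\<gamma>1 u) \<in> V'" "c *\<^sub>R \<gamma>1 (J u) \<in> V'" using lin_onD(1)[OF V'.J] by auto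
    fix v' assume "v' \<in> V'"
    then obtain v where v: "v \<in> V" "v' = \<gamma>1 v" using onto by blast
    then show "g' (J' (\<gamma>1 u)) v' = g' (c *\<^sub>R \<gamma>1 (J u)) v'"
      using gJ[OF u v(1)] g[OF lin_onD(1)[OF V.J u] v(1)] in_V' \<open>v' \<in> V'\<close> by simp
  qed
  \<comment> \<open>For c = 0 the operator J' would vanish, and with it the Levi form on V'.\<close>
  have "c \<noteq> 0"
  proof
    assume c: "c = 0"
    obtain u' v' where uv': "u' \<in> V'" "v' \<in> V'" "g' (J' u') v' \<noteq> 0" using V'.nonzero by blast
    then obtain u where "u \<in> V" "u' = \<gamma>1 u" using onto by blast
    then show False using uv' J[of u] c by simp
  qed
  then show thesis using that \<gamma>2_c J by blast
qed

text \<open>\<gamma>2 is multiplication by c in the coordinates t and t'. It is defined on a coset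
  through a chosen representative, which is harmless because t is constant on cosets.\<close>

lemma preserves_leviI:
  assumes iso: "linear_isometry V g V' g' \<gamma>1"
    and J: "\<And>u. u \<in> V \<Longrightarrow> J' (\<gamma>1 u) = c *\<^sub>R \<gamma>1 (J u)"
  shows "\<exists>\<gamma>2. preserves_levi \<gamma>1 \<gamma>2"
proof -
  have lin: "lin_on V V' \<gamma>1" and g: "\<And>u v. u \<in> V \<Longrightarrow> v \<in> V \<Longrightarrow> g' (\<gamma>1 u) (\<gamma>1 v) = g u v"
    using iso unfolding linear_isometry_iff by blast+
  obtain w0 where w0: "w0 \<in> T'" "t' w0 = 1" using V'.t_onto by blast
  define \<gamma>2 where "\<gamma>2 P = coset V' ((c * t (SOME w. w \<in> T \<and> P = coset V w)) *\<^sub>R w0)" for P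
  have \<gamma>2: "\<gamma>2 (coset V w) = coset V' ((c * t w) *\<^sub>R w0)" if w: "w \<in> T" for w
  proof -
    let ?w = "SOME w'. w' \<in> T \<and> coset V w = coset V w'"
    have "?w \<in> T \<and> coset V w = coset V ?w" by (rule someI[of _ w]) (simp add: w)
    then have "t ?w = t w" using V.coset_eq[OF w, of ?w] by simp
    then show ?thesis unfolding \<gamma>2_def by simp
  qed
  have "vlinear (quot_space T V) (quot_space T' V') \<gamma>2"
    unfolding vlinear_def quot_space_simps(1)[OF V.subspace] quot_space_simps(1)[OF V'.subspace]
  proof (intro conjI ballI allI)
    show "\<gamma>2 ` (coset V ` T) \<subseteq> coset V' ` T'" using \<gamma>2 V'.T_scale[OF w0(1)] by auto
  next
    fix P Q assume "P \<in> coset V ` T" "Q \<in> coset V ` T"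
    then obtain p q where pq: "p \<in> T" "q \<in> T" "P = coset V p" "Q = coset V q" by blast
    then show "\<gamma>2 (vadd (quot_space T V) P Q) = vadd (quot_space T' V') (\<gamma>2 P) (\<gamma>2 Q)"
      using \<gamma>2[OF pq(1)] \<gamma>2[OF pq(2)] \<gamma>2[OF subspace_add[OF V.T pq(1,2)]] lin_onD(3)[OF V.t pq(1,2)]
      by (simp add: quot_space_simps[OF V.subspace] quot_space_simps[OF V'.subspace] distrib_left scaleR_left_distrib)
  next
    fix a P assume "P \<in> coset V ` T"
    then obtain p where p: "p \<in> T" "P = coset V p" by blast
    then show "\<gamma>2 (vscale (quot_space T V) a P) = vscale (quot_space T' V') a (\<gamma>2 P)"
      using \<gamma>2[OF p(1)] \<gamma>2[OF V.T_scale[OF p(1)]] V.t_scale[OF p(1)]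
      by (simp add: quot_space_simps[OF V.subspace] quot_space_simps[OF V'.subspace] mult.left_commute)
  qed
  moreover have "L' (\<gamma>1 X) (\<gamma>1 Y) = \<gamma>2 (L X Y)" if X: "X \<in> V" and Y: "Y \<in> V" for X Y
  proof -
    obtain w where w: "w \<in> T" "L X Y = coset V w" "t w = - g (J X) Y" using V.levi[OF X Y] by blast
    obtain w' where w': "w' \<in> T'" "L' (\<gamma>1 X) (\<gamma>1 Y) = coset V' w'" "t' w' = - g' (J' (\<gamma>1 X)) (\<gamma>1 Y)"
      using V'.levi[OF lin_onD(1)[OF lin X] lin_onD(1)[OF lin Y]] by blast
    have "t' w' = c * t w"
      unfolding w'(3) w(3) J[OF X]
      using g[OF lin_onD(1)[OF V.J X] Y] lin_onD(1)[OF lin] lin_onD(1)[OF V.J X] Y by simp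
    then have "coset V' w' = coset V' ((c * t w) *\<^sub>R w0)"
      using V'.coset_eq[OF w'(1) V'.T_scale[OF w0(1)]] V'.t_scale[OF w0(1)] w0(2) by simp
    then show ?thesis unfolding w(2) w'(2) \<gamma>2[OF w(1)] .
  qed
  ultimately show ?thesis using iso unfolding preserves_levi_def by blast
qed

text \<open>In the coordinates t and t' the map is multiplication by a nonzero number.\<close>

lemma preserves_levi_bij:
  assumes "preserves_levi \<gamma>1 \<gamma>2"
  shows "bij_betw \<gamma>2 (coset V ` T) (coset V' ` T')"
proof -
  obtain c where c: "c \<noteq> 0" "\<And>w. w \<in> T \<Longrightarrow> \<exists>w'\<in>T'. \<gamma>2 (coset V w) = coset V' w' \<and> t' w' = c * t w"
    by (rule preserves_leviD[OF assms]) (rule that)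
  have "inj_on \<gamma>2 (coset V ` T)"
  proof (rule inj_onI)
    fix P Q assume "P \<in> coset V ` T" "Q \<in> coset V ` T" and eq: "\<gamma>2 P = \<gamma>2 Q"
    then obtain p q where pq: "p \<in> T" "q \<in> T" "P = coset V p" "Q = coset V q" by blast
    obtain p' where p': "p' \<in> T'" "\<gamma>2 P = coset V' p'" "t' p' = c * t p" using c(2)[OF pq(1)] pq(3) by blast
    obtain q' where q': "q' \<in> T'" "\<gamma>2 Q = coset V' q'" "t' q' = c * t q" using c(2)[OF pq(2)] pq(4) by blast
    have "t' p' = t' q'" using eq V'.coset_eq[OF p'(1) q'(1)] p'(2) q'(2) by simp
    then show "P = Q" using c(1) p'(3) q'(3) V.coset_eq[OF pq(1,2)] pq(3,4) by simp
  qed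
  moreover have "\<gamma>2 ` (coset V ` T) \<subseteq> coset V' ` T'" using c(2) by fastforce
  moreover have "coset V' ` T' \<subseteq> \<gamma>2 ` (coset V ` T)"
  proof
    fix Q assume "Q \<in> coset V' ` T'"
    then obtain q where q: "q \<in> T'" "Q = coset V' q" by blast
    obtain w0 where w0: "w0 \<in> T" "t w0 = 1" using V.t_onto by blast
    let ?w = "(t' q / c) *\<^sub>R w0"
    have w: "?w \<in> T" "t ?w = t' q / c" using V.T_scale[OF w0(1)] V.t_scale[OF w0(1)] w0(2) by auto
    obtain w' where w': "w' \<in> T'" "\<gamma>2 (coset V ?w) = coset V' w'" "t' w' = c * t ?w" using c(2)[OF w(1)] by blast
    have "coset V' w' = Q" using V'.coset_eq[OF w'(1) q(1)] q(2) w'(3) w(2) c(1) by simp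
    then show "Q \<in> \<gamma>2 ` (coset V ` T)" using w'(2) w(1) by blast
  qed
  ultimately show ?thesis unfolding bij_betw_def by blast
qed

end

section \<open>Comparison with isomorphisms of the graded algebras\<close>

lemma osculating_algebra_simps:
  "vcarrier (osculating_algebra A D x) = (coset (D x) ` tangent_space A x) \<times> D x"
  "vadd (osculating_algebra A D x) (P, u) (Q, v) = (vadd (quot_space (tangent_space A x) (D x)) P Q, u + v)"
  "vscale (osculating_algebra A D x) c (P, u) = (vscale (quot_space (tangent_space A x) (D x)) c P, c *\<^sub>R u)"
  "bracket (osculating_algebra A D x) (P, u) (Q, v) = (levi_map A D x u v, 0)"
  "degree_part (osculating_algebra A D x) k =
    (if k = - 1 then {coset (D x) 0} \<times> D x
     else if k = - 2 then (coset (D x) ` tangent_space A x) \<times> {0} else {(coset (D x) 0, 0)})"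
  by (simp_all add: osculating_algebra_def real_vspace.extend_def graded_lie_algebra.fields_def
      direct_sum_def sub_space_def quot_space_def)

text \<open>The second component is recovered as \<open>fst (\<gamma> (P, 0))\<close>. A bracket has
  the form (L, 0) and depends only on the degree -1 parts of its arguments, so the first component
  of the bracket identity is the compatibility of the Levi maps.\<close>

lemma graded_isometry_imp_preserves_levi:
  assumes pair: "osculating_pair (D x) (g x) (tangent_space A x) (levi_map A D x) t J
      (D' y) (g' y) (tangent_space A' y) (levi_map A' D' y) t' J' k"
    and iso: "graded_lie_iso (osculating_algebra A D x) (osculating_algebra A' D' y) \<gamma>"
    and isom: "linear_isometry (D x) (g x) (D' y) (g' y) (degree_minus_one D x \<gamma>)"
  shows "\<exists>\<gamma>1 \<gamma>2. osculating_pair.preserves_levi (D x) (g x) (tangent_space A x) (levi_map A D x)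
      (D' y) (g' y) (tangent_space A' y) (levi_map A' D' y) \<gamma>1 \<gamma>2"
proof -
  interpret osculating_pair "D x" "g x" "tangent_space A x" "levi_map A D x" t J
    "D' y" "g' y" "tangent_space A' y" "levi_map A' D' y" t' J' k by fact
  let ?O = "osculating_algebra A D x" and ?O' = "osculating_algebra A' D' y"
  let ?Q = "quot_space (tangent_space A x) (D x)" and ?Q' = "quot_space (tangent_space A' y) (D' y)"
  let ?\<gamma>2 = "\<lambda>P. fst (\<gamma> (P, 0))"
  have carr: "(P, u) \<in> vcarrier ?O \<longleftrightarrow> P \<in> vcarrier ?Q \<and> u \<in> D x" for P u
    by (simp add: osculating_algebra_simps quot_space_simps(1)[OF V.subspace])
  have carr': "z \<in> vcarrier ?O' \<longleftrightarrow> fst z \<in> vcarrier ?Q' \<and> snd z \<in> D' y" for z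
    by (cases z) (simp add: osculating_algebra_simps quot_space_simps(1)[OF V'.subspace])
  have \<gamma>: "z \<in> vcarrier ?O \<Longrightarrow> \<gamma> z \<in> vcarrier ?O'"
    "z \<in> vcarrier ?O \<Longrightarrow> z' \<in> vcarrier ?O \<Longrightarrow> \<gamma> (vadd ?O z z') = vadd ?O' (\<gamma> z) (\<gamma> z')"
    "z \<in> vcarrier ?O \<Longrightarrow> \<gamma> (vscale ?O c z) = vscale ?O' c (\<gamma> z)"
    "z \<in> vcarrier ?O \<Longrightarrow> z' \<in> vcarrier ?O \<Longrightarrow> \<gamma> (bracket ?O z z') = bracket ?O' (\<gamma> z) (\<gamma> z')" for z z' c
    using iso unfolding graded_lie_iso_def vlinear_def by blast+
  have fst_add: "fst (vadd ?O' z z') = vadd ?Q' (fst z) (fst z')" for z z'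
    by (cases z; cases z') (simp add: osculating_algebra_simps)
  have fst_scale: "fst (vscale ?O' c z) = vscale ?Q' c (fst z)" for c z
    by (cases z) (simp add: osculating_algebra_simps)
  have fst_bracket: "fst (bracket ?O' z z') = levi_map A' D' y (snd z) (snd z')" for z z'
    by (cases z; cases z') (simp add: osculating_algebra_simps)
  have "vlinear ?Q ?Q' ?\<gamma>2"
    unfolding vlinear_def
  proof (intro conjI ballI allI)
    show "?\<gamma>2 ` vcarrier ?Q \<subseteq> vcarrier ?Q'" using \<gamma>(1) carr carr' by auto
  next
    fix P Q assume PQ: "P \<in> vcarrier ?Q" "Q \<in> vcarrier ?Q"
    then have "\<gamma> (vadd ?O (P, 0) (Q, 0)) = vadd ?O' (\<gamma> (P, 0)) (\<gamma> (Q, 0))"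
      by (intro \<gamma>(2)) (simp_all add: carr)
    then show "?\<gamma>2 (vadd ?Q P Q) = vadd ?Q' (?\<gamma>2 P) (?\<gamma>2 Q)"
      unfolding osculating_algebra_simps(2) by (simp add: fst_add)
  next
    fix c P assume "P \<in> vcarrier ?Q"
    then have "\<gamma> (vscale ?O c (P, 0)) = vscale ?O' c (\<gamma> (P, 0))" by (intro \<gamma>(3)) (simp add: carr)
    then show "?\<gamma>2 (vscale ?Q c P) = vscale ?Q' c (?\<gamma>2 P)"
      unfolding osculating_algebra_simps(3) by (simp add: fst_scale)
  qed
  moreover have "levi_map A' D' y (degree_minus_one D x \<gamma> X) (degree_minus_one D x \<gamma> Y) = ?\<gamma>2 (levi_map A D x X Y)"
    if XY: "X \<in> D x" "Y \<in> D x" for X Y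
  proof -
    have "coset (D x) 0 \<in> vcarrier ?Q"
      using subspace_0[OF V.T] by (simp add: quot_space_simps(1)[OF V.subspace])
    then have "\<gamma> (bracket ?O (coset (D x) 0, X) (coset (D x) 0, Y)) =
        bracket ?O' (\<gamma> (coset (D x) 0, X)) (\<gamma> (coset (D x) 0, Y))"
      using XY by (intro \<gamma>(4)) (simp_all add: carr)
    then show ?thesis
      unfolding osculating_algebra_simps(4) by (simp add: fst_bracket degree_minus_one_def)
  qed
  ultimately show ?thesis using isom unfolding preserves_levi_def by blast
qed

text \<open>The isomorphism is the product of \<gamma>2 and \<gamma>1. Its bijectivity comes from
  that of the factors: an isometry between spaces of equal dimension, and multiplication by a
  nonzero number on a line.\<close>

lemma preserves_levi_imp_graded_isometry:
  assumes pair: "osculating_pair (D x) (g x) (tangent_space A x) (levi_map A D x) t J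
      (D' y) (g' y) (tangent_space A' y) (levi_map A' D' y) t' J' k"
    and levi: "osculating_pair.preserves_levi (D x) (g x) (tangent_space A x) (levi_map A D x)
      (D' y) (g' y) (tangent_space A' y) (levi_map A' D' y) \<gamma>1 \<gamma>2"
  shows "\<exists>\<gamma>. graded_lie_iso (osculating_algebra A D x) (osculating_algebra A' D' y) \<gamma> \<and>
      linear_isometry (D x) (g x) (D' y) (g' y) (degree_minus_one D x \<gamma>)"
proof -
  interpret osculating_pair "D x" "g x" "tangent_space A x" "levi_map A D x" t J
    "D' y" "g' y" "tangent_space A' y" "levi_map A' D' y" t' J' k by fact
  let ?O = "osculating_algebra A D x" and ?O' = "osculating_algebra A' D' y"
  let ?Q = "quot_space (tangent_space A x) (D x)" and ?Q' = "quot_space (tangent_space A' y) (D' y)"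
  define \<gamma> where "\<gamma> = (\<lambda>(P, u). (\<gamma>2 P, \<gamma>1 u))"
  have \<gamma>_Pair: "\<gamma> (P, u) = (\<gamma>2 P, \<gamma>1 u)" for P u by (simp add: \<gamma>_def)
  have iso: "linear_isometry (D x) (g x) (D' y) (g' y) \<gamma>1"
    and \<gamma>2: "vlinear ?Q ?Q' \<gamma>2"
    and L: "\<And>X Y. X \<in> D x \<Longrightarrow> Y \<in> D x \<Longrightarrow> levi_map A' D' y (\<gamma>1 X) (\<gamma>1 Y) = \<gamma>2 (levi_map A D x X Y)"
    using levi unfolding preserves_levi_def by blast+
  have bij1: "bij_betw \<gamma>1 (D x) (D' y)" using linear_isometry_bij[OF iso] .
  have bij2: "bij_betw \<gamma>2 (coset (D x) ` tangent_space A x) (coset (D' y) ` tangent_space A' y)"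
    using preserves_levi_bij[OF levi] .
  have lin1: "lin_on (D x) (D' y) \<gamma>1" using iso unfolding linear_isometry_iff by blast
  have \<gamma>1_0: "\<gamma>1 0 = 0" using lin_onD(4)[OF lin1 V.in_V(1), of 0] by simp
  have carr_0: "coset (D x) 0 \<in> vcarrier ?Q"
    using subspace_0[OF V.T] by (simp add: quot_space_simps(1)[OF V.subspace])
  have \<gamma>2_0: "\<gamma>2 (coset (D x) 0) = coset (D' y) 0"
  proof -
    have "\<gamma>2 (coset (D x) 0) \<in> vcarrier ?Q'" using \<gamma>2 carr_0 unfolding vlinear_def by blast
    then obtain w where w: "\<gamma>2 (coset (D x) 0) = coset (D' y) w"
      unfolding quot_space_simps(1)[OF V'.subspace] by blast
    have "\<gamma>2 (vscale ?Q 0 (coset (D x) 0)) = vscale ?Q' 0 (\<gamma>2 (coset (D x) 0))"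
      using \<gamma>2 carr_0 unfolding vlinear_def by blast
    then show ?thesis by (simp add: w quot_space_simps[OF V.subspace] quot_space_simps[OF V'.subspace])
  qed
  have "vlinear ?O ?O' \<gamma>"
    unfolding vlinear_def
  proof (intro conjI ballI allI)
    show "\<gamma> ` vcarrier ?O \<subseteq> vcarrier ?O'"
      using bij_betw_apply[OF bij1] bij_betw_apply[OF bij2] by (auto simp: osculating_algebra_simps \<gamma>_def)
  next
    fix z z' assume z: "z \<in> vcarrier ?O" "z' \<in> vcarrier ?O"
    obtain P u Q v where [simp]: "z = (P, u)" "z' = (Q, v)" by (cases z; cases z')
    have "P \<in> vcarrier ?Q" "Q \<in> vcarrier ?Q" "u \<in> D x" "v \<in> D x"
      using z by (auto simp: osculating_algebra_simps quot_space_simps(1)[OF V.subspace])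
    then have "\<gamma>2 (vadd ?Q P Q) = vadd ?Q' (\<gamma>2 P) (\<gamma>2 Q)" "\<gamma>1 (u + v) = \<gamma>1 u + \<gamma>1 v"
      using \<gamma>2 lin_onD(3)[OF lin1] unfolding vlinear_def by blast+
    then show "\<gamma> (vadd ?O z z') = vadd ?O' (\<gamma> z) (\<gamma> z')"
      by (simp add: osculating_algebra_simps(2) \<gamma>_Pair)
  next
    fix c z assume z: "z \<in> vcarrier ?O"
    obtain P u where [simp]: "z = (P, u)" by (cases z)
    have "P \<in> vcarrier ?Q" "u \<in> D x"
      using z by (auto simp: osculating_algebra_simps quot_space_simps(1)[OF V.subspace])
    then have "\<gamma>2 (vscale ?Q c P) = vscale ?Q' c (\<gamma>2 P)" "\<gamma>1 (c *\<^sub>R u) = c *\<^sub>R \<gamma>1 u"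
      using \<gamma>2 lin_onD(4)[OF lin1] unfolding vlinear_def by blast+
    then show "\<gamma> (vscale ?O c z) = vscale ?O' c (\<gamma> z)"
      by (simp add: osculating_algebra_simps(3) \<gamma>_Pair)
  qed
  moreover have "bij_betw \<gamma> (vcarrier ?O) (vcarrier ?O')"
    unfolding osculating_algebra_simps \<gamma>_def using bij_betw_map_prod[OF bij2 bij1] by (simp add: map_prod_def)
  moreover have "\<gamma> (bracket ?O z z') = bracket ?O' (\<gamma> z) (\<gamma> z')" if z: "z \<in> vcarrier ?O" "z' \<in> vcarrier ?O" for z z'
  proof -
    obtain P u Q v where [simp]: "z = (P, u)" "z' = (Q, v)" by (cases z; cases z')
    have "u \<in> D x" "v \<in> D x" using z by (auto simp: osculating_algebra_simps)
    then show ?thesis using L by (simp add: osculating_algebra_simps(4) \<gamma>_Pair \<gamma>1_0)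
  qed
  \<comment> \<open>Every degree part is a product set on which \<gamma> acts factorwise; what
    remains is that the zero coset and the zero vector go to their counterparts.\<close>
  moreover have "\<gamma> ` degree_part ?O k = degree_part ?O' k" for k
  proof -
    have "\<gamma> ` (S \<times> S') = (\<gamma>2 ` S) \<times> (\<gamma>1 ` S')" for S S' by (force simp: \<gamma>_def)
    then show ?thesis
      using bij1 bij2 \<gamma>1_0 \<gamma>2_0 by (auto simp: osculating_algebra_simps(5) bij_betw_def \<gamma>_Pair)
  qed
  ultimately have "graded_lie_iso ?O ?O' \<gamma>" unfolding graded_lie_iso_def by blast
  moreover have "degree_minus_one D x \<gamma> = \<gamma>1" by (auto simp: degree_minus_one_def \<gamma>_Pair)
  ultimately show ?thesis using iso by blast
qed

lemma proj_point_scale: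
  assumes "c \<noteq> 0"
  shows "proj_point (map (\<lambda>a. c * a) \<alpha>) = proj_point \<alpha>"
proof (intro equalityI subsetI)
  fix z assume "z \<in> proj_point (map (\<lambda>a. c * a) \<alpha>)"
  then obtain d where "d \<noteq> 0" "z = map ((*) d) (map (\<lambda>a. c * a) \<alpha>)" unfolding proj_point_def by blast
  then have "d * c \<noteq> 0" "z = map ((*) (d * c)) \<alpha>" using assms by (auto simp: mult.assoc)
  then show "z \<in> proj_point \<alpha>" unfolding proj_point_def by blast
next
  fix z assume "z \<in> proj_point \<alpha>"
  then obtain d where "d \<noteq> 0" "z = map ((*) d) \<alpha>" unfolding proj_point_def by blast
  then have "d / c \<noteq> 0" "z = map ((*) (d / c)) (map (\<lambda>a. c * a) \<alpha>)" using assms by auto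
  then show "z \<in> proj_point (map (\<lambda>a. c * a) \<alpha>)" unfolding proj_point_def by blast
qed

section \<open>Data at a point and the value of the type map\<close>

context corank_one_distribution
begin

text \<open>B is known only through sections, so each identity is lifted to sections on a common
  neighbourhood, where it follows from the bracket and the linearity of \<theta>. Linearity in the
  second slot comes from skew-symmetry.\<close>

lemma bracket_form_bilinear:
  assumes U: "open U" "x \<in> U" "defining_form A D U \<theta>"
    and bracket: "\<forall>W X Y. open W \<longrightarrow> x \<in> W \<longrightarrow> section_on A D W X \<longrightarrow> section_on A D W Y \<longrightarrow>
      \<theta> x (lie_bracket A X Y x) = B (X x) (Y x)"
  shows "u \<in> D x \<Longrightarrow> v \<in> D x \<Longrightarrow> B u v = - B v u"
    "v \<in> D x \<Longrightarrow> lin_on (D x) UNIV (\<lambda>u. B u v)"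
    "u \<in> D x \<Longrightarrow> lin_on (D x) UNIV (B u)"
proof -
  note B = bracket[rule_format]
  have \<theta>: "\<theta> x (a *\<^sub>R u + b *\<^sub>R v) = a * \<theta> x u + b * \<theta> x v"
    if "u \<in> tangent_space A x" "v \<in> tangent_space A x" for u v a b
    using U(2,3) that unfolding defining_form_def one_form_on_def by blast
  have tangent: "lie_bracket A X Y x \<in> tangent_space A x"
    if "open W" "x \<in> W" "section_on A D W X" "section_on A D W Y" for W X Y
    using lie_bracket_tangent[of W x X Y] that unfolding section_on_def by blast
  show skew: "B u v = - B v u" if uv: "u \<in> D x" "v \<in> D x" for u v
  proof -
    obtain W X Y where W: "open W" "x \<in> W" "section_on A D W X" "section_on A D W Y" "X x = u" "Y x = v"
      by (rule sections_through2[OF uv])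
    have "B u v = \<theta> x (lie_bracket A X Y x)" using B[OF W(1-4)] W(5,6) by simp
    \<comment> \<open>The term with coefficient 0 brings the negative into the shape in which
      linearity of a one-form is stated.\<close>
    also have "lie_bracket A X Y x = (-1) *\<^sub>R lie_bracket A Y X x + 0 *\<^sub>R lie_bracket A Y X x"
      by (simp add: lie_bracket_skew[of X])
    also have "\<theta> x \<dots> = - \<theta> x (lie_bracket A Y X x)"
      unfolding \<theta>[OF tangent[OF W(1,2,4,3)] tangent[OF W(1,2,4,3)]] by simp
    also have "\<dots> = - B v u" using B[OF W(1,2,4,3)] W(5,6) by simp
    finally show ?thesis .
  qed
  show lin: "lin_on (D x) UNIV (\<lambda>u. B u v)" if v: "v \<in> D x" for v
    unfolding lin_on_def
  proof (intro conjI ballI allI)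
    fix u u' a b assume u: "u \<in> D x" "u' \<in> D x"
    obtain W X X' where W: "open W" "x \<in> W" "section_on A D W X" "section_on A D W X'" "X x = u" "X' x = u'"
      by (rule sections_through2[OF u])
    obtain W' Y where W': "open W'" "x \<in> W'" "section_on A D W' Y" "Y x = v" by (rule section_through[OF v])
    define N where "N = W \<inter> W'"
    have N: "open N" "x \<in> N" using W W' by (auto simp: N_def)
    have s: "section_on A D N X" "section_on A D N X'" "section_on A D N Y"
      using section_on_subset[OF W(3)] section_on_subset[OF W(4)] section_on_subset[OF W'(3)] by (simp_all add: N_def)
    have "B (a *\<^sub>R u + b *\<^sub>R u') v = \<theta> x (lie_bracket A (\<lambda>q. a *\<^sub>R X q + b *\<^sub>R X' q) Y x)"
      using B[OF N section_on_lincomb[OF s(1,2)] s(3), of a b, symmetric] unfolding W(5,6) W'(4) .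
    also have "lie_bracket A (\<lambda>q. a *\<^sub>R X q + b *\<^sub>R X' q) Y x = a *\<^sub>R lie_bracket A X Y x + b *\<^sub>R lie_bracket A X' Y x"
      using s unfolding section_on_def by (intro lie_bracket_lincomb[OF N]) blast+
    also have "\<theta> x \<dots> = a * B u v + b * B u' v"
      unfolding \<theta>[OF tangent[OF N s(1,3)] tangent[OF N s(2,3)]] B[OF N s(1,3)] B[OF N s(2,3)] W(5,6) W'(4) ..
    finally show "B (a *\<^sub>R u + b *\<^sub>R u') v = a *\<^sub>R B u v + b *\<^sub>R B u' v"
      unfolding real_scaleR_def .
  qed simp
  show "lin_on (D x) UNIV (B u)" if u: "u \<in> D x" for u
    unfolding lin_on_def
  proof (intro conjI ballI allI)
    fix v v' a b assume v: "v \<in> D x" "v' \<in> D x"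
    then have "a *\<^sub>R v + b *\<^sub>R v' \<in> D x"
      by (intro subspace_add[OF subspace_D] subspace_scale[OF subspace_D])
    then show "B u (a *\<^sub>R v + b *\<^sub>R v') = a *\<^sub>R B u v + b *\<^sub>R B u v'"
      using skew[OF u] v lin_onD(2)[OF lin[OF u] v, of a b] by simp
  qed simp
qed

lemma fin_dim_D: "fin_dim (D x) (DIM('e) - 1)"
  using frame_exists unfolding fin_dim_def .

end

text \<open>Riesz representation: \<open>J u\<close> has the coordinates \<open>B u b\<close> in an
  orthonormal basis. The basis is again a frame of the zero operator.\<close>

lemma bilinear_form_representable:
  assumes "inner_subspace V g" "fin_dim V k"
    and B: "\<And>v. v \<in> V \<Longrightarrow> lin_on V UNIV (\<lambda>u. B u v)" "\<And>u. u \<in> V \<Longrightarrow> lin_on V UNIV (B u)"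
  obtains J where "lin_on V V J" "\<And>u v. u \<in> V \<Longrightarrow> v \<in> V \<Longrightarrow> g (J u) v = (B u v :: real)"
proof -
  interpret inner_subspace V g by fact
  have k: "k mod 2 \<le> 1" by linarith
  have zero: "lin_on V V (\<lambda>_. 0)" unfolding lin_on_def by simp
  obtain ts hs where ts: "length ts = k div 2" "length hs = k mod 2" "skew_frame V g (\<lambda>_. 0) ts hs"
    using skew_frame_exists[OF assms(1) _ _ zero, of "k div 2" "k mod 2"] assms(2) k by auto
  define S where "S = set (frame_list ts hs)"
  have S: "orthonormal S" "finite S" using ts(3) unfolding skew_frame_def orthonormal_def S_def by auto
  have SV: "b \<in> V" if "b \<in> S" for b using S(1) that unfolding orthonormal_def by blast
  have span: "span S = V" using skew_frame_basis[OF ts(3)] assms(2) ts by (simp add: is_basis_def S_def)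
  define J where "J u = (\<Sum>b\<in>S. B u b *\<^sub>R b)" for u
  show thesis
  proof (rule that)
    show "lin_on V V J"
      unfolding lin_on_def
    proof (intro conjI ballI allI)
      show "J u \<in> V" for u unfolding J_def using SV by (intro subspace_sum subspace) auto
      show "J (a *\<^sub>R u + b *\<^sub>R v) = a *\<^sub>R J u + b *\<^sub>R J v" if "u \<in> V" "v \<in> V" for u v a b
        unfolding J_def scaleR_sum_right sum.distrib[symmetric]
        using lin_onD(2)[OF B(1)[OF SV] that] by (intro sum.cong) (auto simp: scaleR_left_distrib)
    qed
    fix u v assume uv: "u \<in> V" "v \<in> V"
    have "g (J u) v = (\<Sum>b\<in>S. B u b * g b v)" unfolding J_def using SV uv by (intro g_sum_left) auto
    also have "\<dots> = (\<Sum>b\<in>S. g v b *\<^sub>R B u b)" using sym[OF SV uv(2)] by (intro sum.cong) auto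
    also have "\<dots> = B u (\<Sum>b\<in>S. g v b *\<^sub>R b)" using SV by (intro lin_on_sum[OF B(2)[OF uv(1)] subspace, symmetric])
    also have "(\<Sum>b\<in>S. g v b *\<^sub>R b) = v" using orthonormal_expansion[OF S, of v] uv(2) span by simp
    finally show "g (J u) v = B u v" .
  qed
qed

(* Two defining forms agree at x up to a factor c, and d\<theta> on sections of D only involves the value of \<theta> at x. *)
lemma osculating_data_exists:
  fixes A :: "('m::{t2_space,second_countable_topology}, 'e::euclidean_space) chart set"
  assumes M: "corank_one_sub_riemannian A D g"
  obtains t J where "osculating_data (D x) (g x) (tangent_space A x) (levi_map A D x) t J"
    "fin_dim (D x) (DIM('e) - 1)"
    "\<And>ts hs. skew_frame (D x) (g x) J ts hs \<Longrightarrow> length ts = (DIM('e) - 1) div 2 \<Longrightarrow>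
      length hs = (DIM('e) - 1) mod 2 \<Longrightarrow> sorted (map fst ts) \<Longrightarrow> type_map A D g x = proj_point (map fst ts)"
proof -
  have M': "smooth_atlas A" "distribution A (DIM('e) - 1) D" "riemannian_metric_on A D g"
    using M unfolding corank_one_sub_riemannian_def corank_one_structure_def by simp_all
  interpret corank_one_distribution A D
    by unfold_locales (use M' in simp_all)
  have g: "g x u v = g x v u" "g x (a *\<^sub>R u + b *\<^sub>R v) w = a * g x u w + b * g x v w" "u \<noteq> 0 \<Longrightarrow> g x u u > 0"
    if "u \<in> D x" "v \<in> D x" "w \<in> D x" for u v w a b
    using M'(3) that unfolding riemannian_metric_on_def by simp_all
  interpret inner_subspace "D x" "g x"
  proof
    show "subspace (D x)" by (rule subspace_D)
    show "g x u v = g x v u" if "u \<in> D x" "v \<in> D x" for u v using g(1)[OF that that(1)] .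
    show "g x (a *\<^sub>R u + b *\<^sub>R v) w = a * g x u w + b * g x v w" if "u \<in> D x" "v \<in> D x" "w \<in> D x" for u v w a b
      using g(2)[OF that] .
    show "g x u u > 0" if "u \<in> D x" "u \<noteq> 0" for u using g(3)[OF that(1) that(1) that(1) that(2)] .
  qed
  obtain U \<theta> B where U: "open U" "x \<in> U" and df: "defining_form A D U \<theta>"
    and B: "\<And>W X Y. open W \<Longrightarrow> x \<in> W \<Longrightarrow> section_on A D W X \<Longrightarrow> section_on A D W Y \<Longrightarrow>
      \<theta> x (lie_bracket A X Y x) = B (X x) (Y x)"
    using defining_form_bracket_exists[of x] by blast
  have "\<forall>W X Y. open W \<longrightarrow> x \<in> W \<longrightarrow> section_on A D W X \<longrightarrow> section_on A D W Y \<longrightarrow>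
      \<theta> x (lie_bracket A X Y x) = B (X x) (Y x)"
    by (intro allI impI) (rule B)
  note bilin = bracket_form_bilinear[OF U df this]
  have \<theta>: "\<theta> x (a *\<^sub>R u + b *\<^sub>R v) = a * \<theta> x u + b * \<theta> x v"
    if "u \<in> tangent_space A x" "v \<in> tangent_space A x" for u v a b
    using U(2) df that unfolding defining_form_def one_form_on_def by blast
  have D: "D x = {v \<in> tangent_space A x. \<theta> x v = 0}" using df U unfolding defining_form_def by blast
  obtain J0 where J0: "lin_on (D x) (D x) J0" "\<And>u v. u \<in> D x \<Longrightarrow> v \<in> D x \<Longrightarrow> g x (J0 u) v = B u v"
    using bilinear_form_representable[OF inner_subspace_axioms fin_dim_D bilin(2,3)] by blast
  \<comment> \<open>On sections of D, d\<theta> is minus \<theta> of the bracket; the sign makes J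
    represent d\<theta>.\<close>
  define J where "J u = - J0 u" for u
  have J: "lin_on (D x) (D x) J"
    using lin_onD(1,2)[OF J0(1)] unfolding lin_on_def J_def by simp
  have gJ: "g x (J u) v = - B u v" if "u \<in> D x" "v \<in> D x" for u v
    using J0(2)[OF that] that lin_onD(1)[OF J0(1)] by (simp add: J_def)
  have skew: "g x (J u) v = - g x u (J v)" if uv: "u \<in> D x" "v \<in> D x" for u v
    using gJ[OF uv] gJ[OF uv(2,1)] bilin(1)[OF uv] sym[OF uv(1) lin_onD(1)[OF J uv(2)]] by simp
  have levi: "\<exists>w\<in>tangent_space A x. levi_map A D x u v = coset (D x) w \<and> \<theta> x w = - g x (J u) v"
    if uv: "u \<in> D x" "v \<in> D x" for u v
  proof -
    obtain W X Y where W: "open W" "x \<in> W" "section_on A D W X" "section_on A D W Y" "X x = u" "Y x = v"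
      "levi_map A D x u v = coset (D x) (lie_bracket A X Y x)" by (rule levi_map_eq[OF uv])
    moreover have "lie_bracket A X Y x \<in> tangent_space A x"
      using W unfolding section_on_def by (intro lie_bracket_tangent) auto
    ultimately show ?thesis using B[OF W(1-4)] gJ[OF uv] by (intro bexI) auto
  qed
  obtain u0 v0 where uv0: "u0 \<in> D x" "v0 \<in> D x" "levi_map A D x u0 v0 \<noteq> coset (D x) 0"
    using M unfolding corank_one_sub_riemannian_def corank_one_structure_def by blast
  obtain w0 where w0: "w0 \<in> tangent_space A x" "levi_map A D x u0 v0 = coset (D x) w0" "\<theta> x w0 = - g x (J u0) v0"
    using levi[OF uv0(1,2)] by blast
  \<comment> \<open>The class of w0 is a nonzero value of the Levi map. Hence \<theta> does not
    vanish on w0, which yields both a vector of \<theta>-value 1 and a nonzero value of g (J u)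
    v.\<close>
  have "w0 \<notin> D x" using uv0(3) unfolding w0(2) coset_eq_iff[OF subspace_D] by simp
  then have nz: "\<theta> x w0 \<noteq> 0" using w0(1) D by blast
  define w1 where "w1 = (1 / \<theta> x w0) *\<^sub>R w0"
  have w1: "w1 \<in> tangent_space A x" "\<theta> x w1 = 1"
    using subspace_scale[OF subspace_tangent_space w0(1)] \<theta>[OF w0(1) w0(1), of "1 / \<theta> x w0" 0] nz
    by (simp_all add: w1_def)
  have data: "osculating_data (D x) (g x) (tangent_space A x) (levi_map A D x) (\<theta> x) J"
  proof unfold_locales
    show "lin_on (tangent_space A x) UNIV (\<theta> x)" using \<theta> unfolding lin_on_def by simp
    show "\<exists>w\<in>tangent_space A x. \<theta> x w = 1" using w1 by blast
    show "\<exists>u\<in>D x. \<exists>v\<in>D x. g x (J u) v \<noteq> 0"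
      by (rule bexI[OF _ uv0(1)], rule bexI[OF _ uv0(2)]) (use w0(3) nz in simp)
  qed (use D levi J skew subspace_tangent_space in auto)
  have "type_map A D g x = proj_point (map fst ts)"
    if frame: "skew_frame (D x) (g x) J ts hs" and len: "length ts = (DIM('e) - 1) div 2" "length hs = (DIM('e) - 1) mod 2"
      and sorted: "sorted (map fst ts)" for ts hs
  proof -
    have dim: "fin_dim (D x) (2 * length ts + length hs)" using fin_dim_D len by simp
    \<comment> \<open>The number of extra zero eigenvalues, 0 or 1, is the number of kernel vectors
      of the frame.\<close>
    have r: "DIM('e) - 1 - 2 * ((DIM('e) - 1) div 2) = length hs" using len by (simp add: minus_mult_div_eq_mod)
    have frame_nonneg: "\<forall>a\<in>set (map fst ts). 0 \<le> a" if "skew_frame (D x) (g x) J' ts hs" for J' ts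
      using that unfolding skew_frame_def by auto
    \<comment> \<open>The predicate under the \<open>SOME\<close> of \<open>type_map\<close>; it is
      shown to hold for the class of the given frame and for no other.\<close>
    define P where "P Q \<longleftrightarrow> (\<exists>U \<theta> J \<alpha>. open U \<and> x \<in> U \<and> defining_form A D U \<theta> \<and> represents_dtheta A D g x \<theta> J \<and>
        length \<alpha> = (DIM('e) - 1) div 2 \<and> sorted \<alpha> \<and> (\<forall>a\<in>set \<alpha>. 0 \<le> a) \<and>
        eigenvalues (D x) J =
          mset (map (\<lambda>a. \<i> * complex_of_real a) \<alpha>) + mset (map (\<lambda>a. - \<i> * complex_of_real a) \<alpha>) +
          replicate_mset (DIM('e) - 1 - 2 * ((DIM('e) - 1) div 2)) 0 \<and>
        Q = proj_point \<alpha>)" for Q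
    have rep: "represents_dtheta A D g x \<theta> J"
      unfolding represents_dtheta_def
    proof (intro conjI allI impI)
      show "vlinear (sub_space (D x)) (sub_space (D x)) J" using J lin_on_iff_vlinear[OF subspace_D] by blast
      fix W X Y assume W: "open W" "x \<in> W" "section_on A D W X" "section_on A D W Y"
      then have "X x \<in> D x" "Y x \<in> D x" unfolding section_on_def by blast+
      then show "exterior_derivative A \<theta> X Y x = g x (J (X x)) (Y x)"
        using exterior_derivative_eq[OF U df W] B[OF W] gJ by simp
    qed
    have "P (proj_point (map fst ts))"
      unfolding P_def r
      using U df rep len sorted frame_nonneg[OF frame] eigenvalues_skew_frame[OF J frame dim]
      by (intro exI[of _ U] exI[of _ \<theta>] exI[of _ J] exI[of _ "map fst ts"]) simp
    moreover have "Q = proj_point (map fst ts)" if "P Q" for Q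
    proof -
      obtain U' \<theta>' J' \<alpha> where U': "open U'" "x \<in> U'" and df': "defining_form A D U' \<theta>'"
        and rep': "represents_dtheta A D g x \<theta>' J'"
        and \<alpha>: "length \<alpha> = (DIM('e) - 1) div 2" "sorted \<alpha>" "\<forall>a\<in>set \<alpha>. 0 \<le> a"
        and ev: "eigenvalues (D x) J' =
          mset (map (\<lambda>a. \<i> * complex_of_real a) \<alpha>) + mset (map (\<lambda>a. - \<i> * complex_of_real a) \<alpha>) +
          replicate_mset (length hs) 0" and Q: "Q = proj_point \<alpha>"
        using \<open>P Q\<close> unfolding P_def r by blast
      have J': "lin_on (D x) (D x) J'"
        using rep' lin_on_iff_vlinear[OF subspace_D] unfolding represents_dtheta_def by blast
      have \<theta>': "\<theta>' x (a *\<^sub>R u + b *\<^sub>R v) = a * \<theta>' x u + b * \<theta>' x v"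
        if "u \<in> tangent_space A x" "v \<in> tangent_space A x" for u v a b
        using U'(2) df' that unfolding defining_form_def one_form_on_def by blast
      have D': "D x = {v \<in> tangent_space A x. \<theta>' x v = 0}" using df' U' unfolding defining_form_def by blast
      \<comment> \<open>Since \<theta> w1 = 1, this is the only possible ratio of the two forms; it
        is nonzero because both have the kernel D.\<close>
      define c where "c = \<theta>' x w1"
      have c: "c \<noteq> 0"
      proof
        assume "c = 0"
        then have "w1 \<in> {v \<in> tangent_space A x. \<theta>' x v = 0}" using w1(1) by (simp add: c_def)
        then have "w1 \<in> {v \<in> tangent_space A x. \<theta> x v = 0}" using D D' by blast
        then show False using w1(2) by simp
      qed
      have \<theta>'_c: "\<theta>' x v = c * \<theta> x v" if v: "v \<in> tangent_space A x" for v
      proof -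
        have "1 *\<^sub>R v + (- \<theta> x v) *\<^sub>R w1 \<in> tangent_space A x" by (rule tangent_space_lincomb[OF v w1(1)])
        moreover have "\<theta> x (1 *\<^sub>R v + (- \<theta> x v) *\<^sub>R w1) = 0" unfolding \<theta>[OF v w1(1)] w1(2) by simp
        ultimately have "\<theta>' x (1 *\<^sub>R v + (- \<theta> x v) *\<^sub>R w1) = 0" using D D' by blast
        then show ?thesis unfolding \<theta>'[OF v w1(1)] by (simp add: c_def)
      qed
      have J'_c: "c *\<^sub>R J u = J' u" if u: "u \<in> D x" for u
      proof (rule nondegenerate)
        show "c *\<^sub>R J u \<in> D x" "J' u \<in> D x" using lin_onD(1)[OF J u] lin_onD(1)[OF J' u] by auto
        fix v assume v: "v \<in> D x"
        obtain W X Y where W: "open W" "x \<in> W" "section_on A D W X" "section_on A D W Y" "X x = u" "Y x = v"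
          by (rule sections_through2[OF u v])
        have tan: "lie_bracket A X Y x \<in> tangent_space A x"
          using W unfolding section_on_def by (intro lie_bracket_tangent) auto
        have "g x (J' u) v = exterior_derivative A \<theta>' X Y x"
          using rep' W unfolding represents_dtheta_def by simp
        also have "\<dots> = - (c * B u v)"
          using exterior_derivative_eq[OF U' df' W(1-4)] \<theta>'_c[OF tan] B[OF W(1-4)] W(5,6) by simp
        also have "\<dots> = g x (c *\<^sub>R J u) v" using gJ[OF u v] lin_onD(1)[OF J u] v by simp
        finally show "g x (c *\<^sub>R J u) v = g x (J' u) v" by simp
      qed
      obtain ts' where ts': "skew_frame (D x) (g x) (\<lambda>u. c *\<^sub>R J u) ts' hs" "map fst ts' = map (\<lambda>a. \<bar>c\<bar> * a) (map fst ts)"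
        by (rule skew_frame_scale[OF frame])
      have frame': "skew_frame (D x) (g x) J' ts' hs" by (rule skew_frame_cong[OF ts'(1) J'_c])
      have len': "length ts' = length ts" using arg_cong[OF ts'(2), of length] by simp
      have "sorted (map fst ts')"
        unfolding ts'(2) using sorted by (simp add: sorted_iff_nth_mono mult_left_mono)
      \<comment> \<open>Both lists describe the spectrum of J', so the rescaled frame of J computes
        whichever list the choice has produced.\<close>
      then have "\<alpha> = map fst ts'"
        using \<alpha> len len' frame_nonneg[OF frame'] ev eigenvalues_skew_frame[OF J' frame'] dim
        by (intro sorted_determined_by_eigenvalues[of \<alpha> "map fst ts'" "length hs"]) simp_all
      then have "proj_point \<alpha> = proj_point (map (\<lambda>a. \<bar>c\<bar> * a) (map fst ts))" unfolding ts'(2)[symmetric] by (rule arg_cong)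
      also have "\<dots> = proj_point (map fst ts)" by (rule proj_point_scale) (simp add: c)
      finally show ?thesis unfolding Q .
    qed
    ultimately have "(SOME Q. P Q) = proj_point (map fst ts)" by (rule some_equality)
    then show ?thesis unfolding type_map_def Let_def P_def .
  qed
  then show thesis using that data fin_dim_D by blast
qed

text \<open>The hypotheses on \<tau> and \<tau>' give the type from any sorted frame. Proportional
  lists of two frames yield an isometry intertwining J and J' up to a factor; conversely a map that
  preserves the Levi forms carries a rescaled frame of V to a sorted frame of V'.\<close>

lemma osculating_pair_same_type_iff:
  assumes pair: "osculating_pair V g T L t J V' g' T' L' t' J' k"
    and type: "\<And>ts hs. skew_frame V g J ts hs \<Longrightarrow> length ts = k div 2 \<Longrightarrow> length hs = k mod 2 \<Longrightarrow>
      sorted (map fst ts) \<Longrightarrow> \<tau> = proj_point (map fst ts)"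
    and type': "\<And>ts hs. skew_frame V' g' J' ts hs \<Longrightarrow> length ts = k div 2 \<Longrightarrow> length hs = k mod 2 \<Longrightarrow>
      sorted (map fst ts) \<Longrightarrow> \<tau>' = proj_point (map fst ts)"
  shows "\<tau> = \<tau>' \<longleftrightarrow> (\<exists>\<gamma>1 \<gamma>2. osculating_pair.preserves_levi V g T L V' g' T' L' \<gamma>1 \<gamma>2)"
proof -
  interpret osculating_pair V g T L t J V' g' T' L' t' J' k by fact
  have k: "2 * (k div 2) + k mod 2 = k" "k mod 2 \<le> 1" by (simp, linarith)
  have dim': "fin_dim V (2 * (k div 2) + k mod 2)" "fin_dim V' (2 * (k div 2) + k mod 2)"
    unfolding k(1) by (rule dim)+
  obtain ts hs where ts: "length ts = k div 2" "length hs = k mod 2" "skew_frame V g J ts hs" "sorted (map fst ts)"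
    using skew_frame_sorted_exists[OF V.inner_subspace_axioms dim'(1) k(2) V.J V.skew] by blast
  obtain ts' hs' where ts': "length ts' = k div 2" "length hs' = k mod 2" "skew_frame V' g' J' ts' hs'" "sorted (map fst ts')"
    using skew_frame_sorted_exists[OF V'.inner_subspace_axioms dim'(2) k(2) V'.J V'.skew] by blast
  note \<tau> = type[OF ts(3,1,2,4)] and \<tau>' = type'[OF ts'(3,1,2,4)]
  show ?thesis
  proof
    assume "\<tau> = \<tau>'"
    \<comment> \<open>The list represents its own class, with factor 1; equality of the classes then
      produces the factor c.\<close>
    moreover have "map fst ts' \<in> proj_point (map fst ts')"
      unfolding proj_point_def by (intro CollectI exI[of _ 1]) simp
    ultimately have "map fst ts' \<in> proj_point (map fst ts)" using \<tau> \<tau>' by simp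
    then obtain c where "map fst ts' = map (\<lambda>a. c * a) (map fst ts)" unfolding proj_point_def by blast
    from skew_frames_isometry_exists[OF V.inner_subspace_axioms dim'(1) V.J ts(3) V'.inner_subspace_axioms V'.J ts'(3) ts(1,2) ts'(2) this]
    obtain \<gamma> where \<gamma>: "lin_on V V' \<gamma>" "\<And>u v. u \<in> V \<Longrightarrow> v \<in> V \<Longrightarrow> g' (\<gamma> u) (\<gamma> v) = g u v"
      "\<And>u. u \<in> V \<Longrightarrow> J' (\<gamma> u) = c *\<^sub>R \<gamma> (J u)"
      by blast
    then have iso: "linear_isometry V g V' g' \<gamma>" unfolding linear_isometry_iff by blast
    have "\<exists>\<gamma>2. preserves_levi \<gamma> \<gamma>2" by (rule preserves_leviI[OF iso]) (rule \<gamma>(3))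
    then show "\<exists>\<gamma>1 \<gamma>2. preserves_levi \<gamma>1 \<gamma>2" by blast
  next
    assume "\<exists>\<gamma>1 \<gamma>2. preserves_levi \<gamma>1 \<gamma>2"
    then obtain \<gamma>1 \<gamma>2 where \<gamma>: "preserves_levi \<gamma>1 \<gamma>2" by blast
    obtain c where c: "c \<noteq> 0" "\<And>u. u \<in> V \<Longrightarrow> J' (\<gamma>1 u) = c *\<^sub>R \<gamma>1 (J u)"
      by (rule preserves_leviD[OF \<gamma>]) (rule that)
    have lin: "lin_on V V' \<gamma>1" and iso: "\<And>u v. u \<in> V \<Longrightarrow> v \<in> V \<Longrightarrow> g' (\<gamma>1 u) (\<gamma>1 v) = g u v"
      using \<gamma> unfolding preserves_levi_def linear_isometry_iff by blast+
    \<comment> \<open>A frame of c J rather than of J: since J' \<gamma>1 = \<gamma>1 (c J), its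
      image is a frame of J'.\<close>
    obtain ts1 where ts1: "skew_frame V g (\<lambda>u. c *\<^sub>R J u) ts1 hs" "map fst ts1 = map (\<lambda>a. \<bar>c\<bar> * a) (map fst ts)"
      by (rule skew_frame_scale[OF ts(3)])
    have cJ: "lin_on V V (\<lambda>u. c *\<^sub>R J u)"
      using lin_onD(1,2)[OF V.J] unfolding lin_on_def by (simp add: scaleR_right_distrib mult.commute)
    have "J' (\<gamma>1 u) = \<gamma>1 (c *\<^sub>R J u)" if "u \<in> V" for u
      using c(2)[OF that] lin_onD(4)[OF lin lin_onD(1)[OF V.J that]] by simp
    note frame = skew_frame_isometry[OF ts1(1) lin iso cJ this V.subspace]
    have fst: "map fst (map (\<lambda>(a, e, f). (a, \<gamma>1 e, \<gamma>1 f)) ts1) = map (\<lambda>a. \<bar>c\<bar> * a) (map fst ts)"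
      unfolding ts1(2)[symmetric] by auto
    have len: "length ts1 = length ts" using arg_cong[OF ts1(2), of length] by simp
    \<comment> \<open>The absolute value is what keeps the list increasing, as the hypothesis on
      \<tau>' requires.\<close>
    have "sorted (map (\<lambda>a. \<bar>c\<bar> * a) (map fst ts))"
      using ts(4) by (simp add: sorted_iff_nth_mono mult_left_mono)
    then have "\<tau>' = proj_point (map (\<lambda>a. \<bar>c\<bar> * a) (map fst ts))"
      using type'[OF frame] ts(1,2) len unfolding fst by simp
    also have "\<dots> = \<tau>" unfolding \<tau> by (rule proj_point_scale) (simp add: c(1))
    finally show "\<tau> = \<tau>'" ..
  qed
qed

theorem theorem2p14:
  fixes A :: "('m::{t2_space,second_countable_topology}, 'e::euclidean_space) chart set"
    and D :: "'m \<Rightarrow> 'm tvec set"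
    and g :: "'m \<Rightarrow> 'm tvec \<Rightarrow> 'm tvec \<Rightarrow> real"
    and A' :: "('n::{t2_space,second_countable_topology}, 'f::euclidean_space) chart set"
    and D' :: "'n \<Rightarrow> 'n tvec set"
    and g' :: "'n \<Rightarrow> 'n tvec \<Rightarrow> 'n tvec \<Rightarrow> real"
    and x :: 'm and y :: 'n
  assumes "corank_one_sub_riemannian A D g"
    and "corank_one_sub_riemannian A' D' g'"
    and "DIM('e) = DIM('f)"
  shows "(type_map A D g x = type_map A' D' g' y \<longleftrightarrow>
      (\<exists>\<gamma>. graded_lie_iso (osculating_algebra A D x) (osculating_algebra A' D' y) \<gamma> \<and>
        linear_isometry (D x) (g x) (D' y) (g' y) (degree_minus_one D x \<gamma>))) \<and>
    ((\<exists>\<gamma>. graded_lie_iso (osculating_algebra A D x) (osculating_algebra A' D' y) \<gamma> \<and>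
        linear_isometry (D x) (g x) (D' y) (g' y) (degree_minus_one D x \<gamma>)) \<longleftrightarrow>
      (\<exists>\<gamma>1 \<gamma>2. linear_isometry (D x) (g x) (D' y) (g' y) \<gamma>1 \<and>
        vlinear (quot_space (tangent_space A x) (D x)) (quot_space (tangent_space A' y) (D' y)) \<gamma>2 \<and>
        (\<forall>X\<in>D x. \<forall>Y\<in>D x. levi_map A' D' y (\<gamma>1 X) (\<gamma>1 Y) = \<gamma>2 (levi_map A D x X Y))))"
proof -
  obtain t J where data: "osculating_data (D x) (g x) (tangent_space A x) (levi_map A D x) t J"
    "fin_dim (D x) (DIM('e) - 1)"
    and type: "\<And>ts hs. skew_frame (D x) (g x) J ts hs \<Longrightarrow> length ts = (DIM('e) - 1) div 2 \<Longrightarrow>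
      length hs = (DIM('e) - 1) mod 2 \<Longrightarrow> sorted (map fst ts) \<Longrightarrow> type_map A D g x = proj_point (map fst ts)"
    by (rule osculating_data_exists[OF assms(1)]) (rule that)
  obtain t' J' where data': "osculating_data (D' y) (g' y) (tangent_space A' y) (levi_map A' D' y) t' J'"
    "fin_dim (D' y) (DIM('f) - 1)"
    and type': "\<And>ts hs. skew_frame (D' y) (g' y) J' ts hs \<Longrightarrow> length ts = (DIM('f) - 1) div 2 \<Longrightarrow>
      length hs = (DIM('f) - 1) mod 2 \<Longrightarrow> sorted (map fst ts) \<Longrightarrow> type_map A' D' g' y = proj_point (map fst ts)"
    by (rule osculating_data_exists[OF assms(2)]) (rule that)
  have pair: "osculating_pair (D x) (g x) (tangent_space A x) (levi_map A D x) t J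
      (D' y) (g' y) (tangent_space A' y) (levi_map A' D' y) t' J' (DIM('e) - 1)"
    unfolding osculating_pair_def osculating_pair_axioms_def using data data' assms(3) by simp
  interpret osculating_pair "D x" "g x" "tangent_space A x" "levi_map A D x" t J
      "D' y" "g' y" "tangent_space A' y" "levi_map A' D' y" t' J' "DIM('e) - 1" by (rule pair)
  \<comment> \<open>Conditions (i) and (ii) are each compared with \<open>preserves_levi\<close>,
    which unfolds to (iii). Folding the equality of dimensions gives the frames at y the same
    lengths as those at x.\<close>
  have "type_map A D g x = type_map A' D' g' y \<longleftrightarrow> (\<exists>\<gamma>1 \<gamma>2. preserves_levi \<gamma>1 \<gamma>2)"
    by (rule osculating_pair_same_type_iff[OF pair type type'[folded assms(3)]])
  moreover have "(\<exists>\<gamma>. graded_lie_iso (osculating_algebra A D x) (osculating_algebra A' D' y) \<gamma> \<and>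
        linear_isometry (D x) (g x) (D' y) (g' y) (degree_minus_one D x \<gamma>)) \<longleftrightarrow> (\<exists>\<gamma>1 \<gamma>2. preserves_levi \<gamma>1 \<gamma>2)"
    using graded_isometry_imp_preserves_levi[where D = D and x = x and g = g and A = A and D' = D' and y = y and g' = g' and A' = A', OF pair]
      preserves_levi_imp_graded_isometry[where D = D and x = x and g = g and A = A and D' = D' and y = y and g' = g' and A' = A', OF pair]
    by blast
  ultimately show ?thesis unfolding preserves_levi_def by blast
qed

end
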